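(* Fix $\alpha\in(0,1)$ and any $\beta\in(0,\alpha)$. Assume the following. (A) (Uniform asymptotic linearity) $\sup_{\pi\in\Pi}|\hat\omega_\pi-\Omega_\pi(P_0)-P_nD_\pi(P_0)|=o_p(n^{-1/2})$ and $\sup_{\pi\in\Pi^*}|\hat\psi_\pi-\Psi_\pi(P_0)-P_n\tilde D_\pi(P_0)|=o_p(n^{-1/2})$. (B) (Restricted policy class) $\Pi$ has a bounded uniform entropy integral; $\Pi$ is closed in $L^2(P_0)$, in the sense that a $\Pi$-valued sequence converges in $L^2(P_0)$ to a map $\pi:\mathcal{X}\to\{0,1\}$ only if $\pi\in\Pi$; and $\Pi^*$ is nonempty. (C) (Standard deviations) $\inf_{\pi\in\Pi}\sigma_\pi(P_0)>0$, $\sup_{\pi\in\Pi}\sigma_\pi(P_0)<\infty$, $\inf_{\pi\in\Pi}\kappa_\pi(P_0)>0$, $\sup_{\pi\in\Pi}\kappa_\pi(P_0)<\infty$, and $\hat\sigma_\pi$, $\hat\kappa_\pi$ are uniformly (over $\pi\in\Pi$) consistent estimators of $\sigma_\pi(P_0)$ and $\kappa_\pi(P_0)$. (D) (Smoothness in the policy) The map $\pi\mapsto\Psi_\pi(P_0)$ is continuous (for the $L^2(P_0)$ topology on $\Pi$), and there is a constant $C_2$ such that $\|D_\pi(P_0)-D_{\pi'}(P_0)\|_{L^2(P_0)}\leq C_2\|\pi-\pi'\|_{L^2(P_0)}$ for all $\pi,\pi'\in\Pi$. Then the confidence interval $$\mathrm{CI}_n:=\left[\inf_{\pi\in\hat\Pi_\beta}\left\{\hat\psi_\pi-\frac{\hat\kappa_\pi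 z_{\alpha,\beta}}{n^{1/2}}\right\},\ \sup_{\pi\in\hat\Pi_\beta}\left\{\hat\psi_\pi+\frac{\hat\kappa_\pi z_{\alpha,\beta}}{n^{1/2}}\right\}\right],\qquad \hat\Pi_\beta:=\left\{\pi\in\Pi:L_n\leq\hat\omega_\pi+\frac{\hat\sigma_\pi t_\beta}{n^{1/2}}\right\},$$ satisfies $\liminf_{n\to\infty}P\left([\psi_0^\ell,\psi_0^u]\subseteq\mathrm{CI}_n\right)\geq1-\alpha$.
   Context: Let $X\in\mathcal{X}$ be a feature, $A\in\{0,1\}$ an action, and $Y\in\mathcal{Y}$ a (possibly multivariate) outcome. $\mathcal{M}$ is a nonparametric model of joint laws of $(X,A,Y)$; the data are $n$ i.i.d. draws from $P_0\in\mathcal{M}$ with empirical measure $P_n$. $\Pi$ is a set of policies $\mathcal{X}\to\{0,1\}$. For $\pi\in\Pi$, $\Omega_\pi:\mathcal{M}\to\mathbb{R}$ is a primary performance metric and $\Psi_\pi:\mathcal{M}\to\mathbb{R}$ a subsidiary one; both are smooth (pathwise differentiable) parameters, with canonical gradients $D_\pi(P)$ (of $\Omega_\pi$) and $\tilde D_\pi(P)$ (of $\Psi_\pi$) relative to a locally nonparametric model. $\Pi^*:=\{\pi\in\Pi:\Omega_\pi(P_0)=\sup_{\pi'\in\Pi}\Omega_{\pi'}(P_0)\}$, $\psi_0^\ell:=\inf_{\pi\in\Pi^*}\Psi_\pi(P_0)$, $\psi_0^u:=\sup_{\pi\in\Pi^*}\Psi_\pi(P_0)$. $\sigma_\pi(P_0):=[P_0D_\pi(P_0)^2]^{1/2}$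 and $\kappa_\pi(P_0):=[P_0\tilde D_\pi(P_0)^2]^{1/2}$, where $Pf=\int f\,dP$. $\hat\omega_\pi,\hat\psi_\pi,\hat\sigma_\pi,\hat\kappa_\pi$ are estimators of $\Omega_\pi(P_0),\Psi_\pi(P_0),\sigma_\pi(P_0),\kappa_\pi(P_0)$. $\mathcal{F}:=\{D_\pi(P_0)/\sigma_\pi(P_0):\pi\in\Pi\}$; $\{\mathbb{G}f:f\in\mathcal{F}\}$ is a mean-zero Gaussian process with covariance $(f_1,f_2)\mapsto P_0f_1f_2$; $t_\beta$ is the $1-\beta/2$ quantile of $\sup_{f\in\mathcal{F}}\mathbb{G}f$. $L_n$ is an asymptotically valid $1-\beta/2$ lower confidence bound for $\sup_{\pi\in\Pi}\Omega_\pi(P_0)$, i.e. $\liminf_n P\{L_n\le\sup_{\pi\in\Pi}\Omega_\pi(P_0)\}\ge1-\beta/2$. $z_{\alpha,\beta}$ is the $1-(\alpha-\beta)/2$ quantile of the standard normal distribution. "Bounded uniform entropy integral" means $\int_0^\infty\sup_{Q}\sqrt{\log N(\varepsilon,\Pi,L^2(Q))}\,d\varepsilon<\infty$, the supremum being over finitely supported probability measures $Q$ on $\mathcal{X}$ and $N$ denoting the covering number. *)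

theory Defs
  imports "HOL-Probability.Probability"
begin

section \<open>Square-integrable functions\<close>

definition square_integrable :: "'z measure \<Rightarrow> ('z \<Rightarrow> real) \<Rightarrow> bool" where
  "square_integrable P f \<longleftrightarrow> f \<in> borel_measurable P \<and> integrable P (\<lambda>z. (f z)\<^sup>2)"

definition l2_norm :: "'z measure \<Rightarrow> ('z \<Rightarrow> real) \<Rightarrow> real" where
  "l2_norm P f = sqrt (\<integral>z. (f z)\<^sup>2 \<partial>P)"

section \<open>Smooth parameters and canonical gradients\<close>

text \<open>
  A one-dimensional submodel through \<open>P\<close> that is differentiable in quadratic mean with score \<open>s\<close>:
  \<open>\<integral> [(\<surd>dP\<^sub>\<epsilon> - \<surd>dP) / \<epsilon> - s \<surd>dP / 2]\<^sup>2 \<rightarrow> 0\<close> as \<open>\<epsilon>\<close> decreases to \<open>0\<close>.  The measure \<open>\<mu> \<epsilon>\<close> is any measure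
  dominating both \<open>P\<^sub>\<epsilon>\<close> and \<open>P\<close>, with densities \<open>p \<epsilon>\<close> and \<open>q \<epsilon>\<close>; the integral does not depend
  on its choice.
\<close>

definition smooth_submodel ::
  "'z measure set \<Rightarrow> 'z measure \<Rightarrow> (real \<Rightarrow> 'z measure) \<Rightarrow> ('z \<Rightarrow> real) \<Rightarrow> bool" where
  "smooth_submodel Mod P \<gamma> s \<longleftrightarrow>
     square_integrable P s \<and> \<gamma> 0 = P \<and>
     (\<exists>\<delta>>0. (\<forall>\<epsilon>\<in>{0..<\<delta>}. \<gamma> \<epsilon> \<in> Mod) \<and>
       (\<exists>\<mu> p q.
         (\<forall>\<epsilon>\<in>{0..<\<delta>}.
            sigma_finite_measure (\<mu> \<epsilon>) \<and>
            p \<epsilon> \<in> borel_measurable (\<mu> \<epsilon>) \<and> (\<forall>z. 0 \<le> p \<epsilon> z) \<and>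
            q \<epsilon> \<in> borel_measurable (\<mu> \<epsilon>) \<and> (\<forall>z. 0 \<le> q \<epsilon> z) \<and>
            \<gamma> \<epsilon> = density (\<mu> \<epsilon>) (\<lambda>z. ennreal (p \<epsilon> z)) \<and>
            P = density (\<mu> \<epsilon>) (\<lambda>z. ennreal (q \<epsilon> z))) \<and>
         ((\<lambda>\<epsilon>. \<integral>\<^sup>+ z. ennreal (((sqrt (p \<epsilon> z) - sqrt (q \<epsilon> z)) / \<epsilon> - s z * sqrt (q \<epsilon> z) / 2)\<^sup>2) \<partial>\<mu> \<epsilon>)
            \<longlongrightarrow> 0) (at_right 0)))"

definition scores :: "'z measure set \<Rightarrow> 'z measure \<Rightarrow> ('z \<Rightarrow> real) set" where
  "scores Mod P = {s. \<exists>\<gamma>. smooth_submodel Mod P \<gamma> s}"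

text \<open>The \<open>L\<^sup>2(P)\<close>-closure of the linear span of the scores.\<close>

definition tangent_space :: "'z measure set \<Rightarrow> 'z measure \<Rightarrow> ('z \<Rightarrow> real) set" where
  "tangent_space Mod P =
     {f. square_integrable P f \<and>
         (\<forall>e>0. \<exists>(m::nat) c s. (\<forall>i<m. s i \<in> scores Mod P) \<and>
            l2_norm P (\<lambda>z. f z - (\<Sum>i<m. c i * s i z)) < e)}"

definition locally_nonparametric :: "'z measure set \<Rightarrow> 'z measure \<Rightarrow> bool" where
  "locally_nonparametric Mod P \<longleftrightarrow>
     tangent_space Mod P = {f. square_integrable P f \<and> (\<integral>z. f z \<partial>P) = 0}"

definition is_gradient ::
  "'z measure set \<Rightarrow> ('z measure \<Rightarrow> real) \<Rightarrow> 'z measure \<Rightarrow> ('z \<Rightarrow> real) \<Rightarrow> bool" where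
  "is_gradient Mod \<theta> P D \<longleftrightarrow>
     square_integrable P D \<and>
     (\<forall>\<gamma> s. smooth_submodel Mod P \<gamma> s \<longrightarrow>
        ((\<lambda>\<epsilon>. (\<theta> (\<gamma> \<epsilon>) - \<theta> P) / \<epsilon>) \<longlongrightarrow> (\<integral>z. D z * s z \<partial>P)) (at_right 0))"

text \<open>Existence of a canonical gradient at \<open>P\<close> expresses pathwise differentiability of \<open>\<theta>\<close> at \<open>P\<close>.\<close>

definition is_canonical_gradient ::
  "'z measure set \<Rightarrow> ('z measure \<Rightarrow> real) \<Rightarrow> 'z measure \<Rightarrow> ('z \<Rightarrow> real) \<Rightarrow> bool" where
  "is_canonical_gradient Mod \<theta> P D \<longleftrightarrow> is_gradient Mod \<theta> P D \<and> D \<in> tangent_space Mod P"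

section \<open>Data and stochastic order\<close>

text \<open>Laws of \<open>(X, A, Y)\<close> live here; the action \<open>A \<in> {0, 1}\<close> is a Boolean.\<close>

abbreviation obs_space :: "'x measure \<Rightarrow> 'y measure \<Rightarrow> ('x \<times> bool \<times> 'y) measure" where
  "obs_space MX MY \<equiv> MX \<Otimes>\<^sub>M (count_space UNIV \<Otimes>\<^sub>M MY)"

definition iid_draws :: "'w measure \<Rightarrow> 'z measure \<Rightarrow> (nat \<Rightarrow> 'w \<Rightarrow> 'z) \<Rightarrow> bool" where
  "iid_draws W P Z \<longleftrightarrow>
     prob_space W \<and> prob_space.indep_vars W (\<lambda>_. P) Z UNIV \<and> (\<forall>i. distr W P (Z i) = P)"

definition emp_mean :: "(nat \<Rightarrow> 'w \<Rightarrow> 'z) \<Rightarrow> nat \<Rightarrow> 'w \<Rightarrow> ('z \<Rightarrow> real) \<Rightarrow> real" where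
  "emp_mean Z n w f = (\<Sum>i<n. f (Z i w)) / real n"

text \<open>
  Suprema and infima over policy classes need not be measurable, so, as usual for empirical
  processes, \<open>o\<^sub>p\<close> refers to outer probability and the probability of a coverage event is an
  inner probability.  Both are ordinary probabilities for measurable events.
\<close>

definition inner_prob :: "'w measure \<Rightarrow> 'w set \<Rightarrow> real" where
  "inner_prob W A = (SUP B\<in>{B \<in> sets W. B \<subseteq> A}. measure W B)"

definition is_op :: "'w measure \<Rightarrow> (nat \<Rightarrow> 'w \<Rightarrow> ereal) \<Rightarrow> (nat \<Rightarrow> real) \<Rightarrow> bool" where
  "is_op W R r \<longleftrightarrow>
     (\<forall>\<epsilon>>0. (\<lambda>n. outer_measure_of W {w \<in> space W. ereal (\<epsilon> * r n) < R n w}) \<longlonglongrightarrow> 0)"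

section \<open>Policies\<close>

text \<open>Policies \<open>\<X> \<rightarrow> {0, 1}\<close> are Boolean-valued functions.\<close>

definition policy_dist :: "('x \<times> bool \<times> 'y) measure \<Rightarrow> ('x \<Rightarrow> bool) \<Rightarrow> ('x \<Rightarrow> bool) \<Rightarrow> real" where
  "policy_dist P \<pi> \<pi>' = l2_norm P (\<lambda>z. of_bool (\<pi> (fst z)) - of_bool (\<pi>' (fst z)))"

text \<open>
  A limit in \<open>L\<^sup>2(P)\<close> is only determined up to \<open>P\<close>-null sets, so it is required to agree almost
  everywhere with some member of the class.
\<close>

definition closed_policy_class ::
  "'x measure \<Rightarrow> ('x \<times> bool \<times> 'y) measure \<Rightarrow> ('x \<Rightarrow> bool) set \<Rightarrow> bool" where
  "closed_policy_class MX P Pols \<longleftrightarrow>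
     (\<forall>p \<pi>. (\<forall>n::nat. p n \<in> Pols) \<and> \<pi> \<in> measurable MX (count_space UNIV) \<and>
        (\<lambda>n. policy_dist P (p n) \<pi>) \<longlonglongrightarrow> 0 \<longrightarrow>
        (\<exists>\<pi>'\<in>Pols. AE z in P. \<pi>' (fst z) = \<pi> (fst z)))"

text \<open>
  Centers of the covering balls may be arbitrary functions.  For finitely supported \<open>Q\<close> and
  \<open>\<epsilon> > 0\<close> a finite cover always exists, so the minimum is attained.
\<close>

definition covering_number :: "'x pmf \<Rightarrow> real \<Rightarrow> ('x \<Rightarrow> bool) set \<Rightarrow> nat" where
  "covering_number Q \<epsilon> Pols =
     (LEAST m. \<exists>C :: ('x \<Rightarrow> real) set. finite C \<and> card C = m \<and>
        (\<forall>\<pi>\<in>Pols. \<exists>g\<in>C. l2_norm (measure_pmf Q) (\<lambda>x. of_bool (\<pi> x) - g x) < \<epsilon>))"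

definition bounded_uniform_entropy_integral :: "'x measure \<Rightarrow> ('x \<Rightarrow> bool) set \<Rightarrow> bool" where
  "bounded_uniform_entropy_integral MX Pols \<longleftrightarrow>
     (\<integral>\<^sup>+ \<epsilon>\<in>{0<..}.
        (SUP Q\<in>{Q. finite (set_pmf Q) \<and> set_pmf Q \<subseteq> space MX}.
           ennreal (sqrt (ln (real (covering_number Q \<epsilon> Pols))))) \<partial>lborel) < \<infinity>"

definition continuous_in_policy ::
  "('x \<times> bool \<times> 'y) measure \<Rightarrow> ('x \<Rightarrow> bool) set \<Rightarrow> (('x \<Rightarrow> bool) \<Rightarrow> real) \<Rightarrow> bool" where
  "continuous_in_policy P Pols f \<longleftrightarrow>
     (\<forall>\<pi>\<in>Pols. \<forall>e>0. \<exists>d>0. \<forall>\<pi>'\<in>Pols. policy_dist P \<pi> \<pi>' < d \<longrightarrow> \<bar>f \<pi>' - f \<pi>\<bar> < e)"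

definition optimal_policies ::
  "(('x \<Rightarrow> bool) \<Rightarrow> real) \<Rightarrow> ('x \<Rightarrow> bool) set \<Rightarrow> ('x \<Rightarrow> bool) set" where
  "optimal_policies \<omega> Pols = {\<pi>\<in>Pols. ereal (\<omega> \<pi>) = (SUP \<pi>'\<in>Pols. ereal (\<omega> \<pi>'))}"

text \<open>A gradient is passed as a function \<open>D\<close> of the policy and of the law.\<close>

definition std_dev ::
  "('p \<Rightarrow> 'z measure \<Rightarrow> 'z \<Rightarrow> real) \<Rightarrow> 'z measure \<Rightarrow> 'p \<Rightarrow> real" where
  "std_dev D P \<pi> = l2_norm P (D \<pi> P)"

definition normalized_gradients ::
  "('p \<Rightarrow> 'z measure \<Rightarrow> 'z \<Rightarrow> real) \<Rightarrow> 'z measure \<Rightarrow> 'p set \<Rightarrow> ('z \<Rightarrow> real) set" where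
  "normalized_gradients D P Pols = (\<lambda>\<pi> z. D \<pi> P z / std_dev D P \<pi>) ` Pols"

section \<open>Gaussian processes and quantiles\<close>

definition gaussian_rv :: "'v measure \<Rightarrow> ('v \<Rightarrow> real) \<Rightarrow> bool" where
  "gaussian_rv N X \<longleftrightarrow>
     (\<exists>m. AE v in N. X v = m) \<or>
     (\<exists>m s. 0 < s \<and> distributed N lborel X (\<lambda>x. ennreal (normal_density m s x)))"

definition gaussian_process :: "'v measure \<Rightarrow> 'i set \<Rightarrow> ('i \<Rightarrow> 'v \<Rightarrow> real) \<Rightarrow> bool" where
  "gaussian_process N I G \<longleftrightarrow>
     prob_space N \<and> (\<forall>i\<in>I. G i \<in> borel_measurable N) \<and>
     (\<forall>J c. finite J \<and> J \<subseteq> I \<longrightarrow> gaussian_rv N (\<lambda>v. \<Sum>j\<in>J. c j * G j v))"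

definition quantile ::
  "'v measure \<Rightarrow> ('v \<Rightarrow> 'b :: conditionally_complete_linorder) \<Rightarrow> real \<Rightarrow> 'b" where
  "quantile N X q = Inf {t. q \<le> measure N {v \<in> space N. X v \<le> t}}"

section \<open>The confidence interval\<close>

text \<open>
  Bounds are extended reals, so that an infimum or supremum over an empty or unbounded family is
  meaningful.  Below, \<open>L\<close>, \<open>omh\<close>, \<open>sgh\<close>, \<open>psh\<close>, \<open>kph\<close> are the realized values of the lower confidence
  bound and of the estimators at sample size \<open>n\<close>.
\<close>

definition selected_policies ::
  "('x \<Rightarrow> bool) set \<Rightarrow> nat \<Rightarrow> real \<Rightarrow> (('x \<Rightarrow> bool) \<Rightarrow> real) \<Rightarrow> (('x \<Rightarrow> bool) \<Rightarrow> real) \<Rightarrow> ereal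
    \<Rightarrow> ('x \<Rightarrow> bool) set" where
  "selected_policies Pols n L omh sgh t =
     {\<pi>\<in>Pols. ereal L \<le> ereal (omh \<pi>) + ereal (sgh \<pi>) * t / ereal (sqrt (real n))}"

definition conf_interval ::
  "('x \<Rightarrow> bool) set \<Rightarrow> nat \<Rightarrow> (('x \<Rightarrow> bool) \<Rightarrow> real) \<Rightarrow> (('x \<Rightarrow> bool) \<Rightarrow> real) \<Rightarrow> real
    \<Rightarrow> ereal set" where
  "conf_interval Pols n psh kph z =
     {(INF \<pi>\<in>Pols. ereal (psh \<pi> - kph \<pi> * z / sqrt (real n))) ..
      (SUP \<pi>\<in>Pols. ereal (psh \<pi> + kph \<pi> * z / sqrt (real n)))}"

end

theory Submission
  imports Defs "HOL-Library.Diagonal_Subsequence"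
begin

text \<open>
  Nothing makes \<open>\<pi> \<mapsto> \<Omega>\<^sub>\<pi>(P\<^sub>0)\<close> continuous, so \<open>\<Pi>\<^sup>*\<close> need not be closed and \<open>\<psi>\<^sub>0\<^sup>\<ell>\<close>, \<open>\<psi>\<^sub>0\<^sup>u\<close> need not be
  attained.  The entropy condition makes \<open>\<Pi>\<close> totally bounded, and closedness makes it compact; hence each
  endpoint is the limit of \<open>\<Psi>\<close> along optimal policies \<open>\<pi>\<^sub>j\<close> that converge rapidly to some \<open>\<pi>\<^sub>\<infinity> \<in> \<Pi>\<close>.

  Selection: the gradients \<open>D\<close> of \<open>\<pi>\<^sub>j\<close> converge in \<open>L\<^sup>2\<close>, so by Chebyshev and a union bound all late
  \<open>\<pi>\<^sub>j\<close> of both sequences are selected as soon as the two limits pass the test with some slack.  That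
  is an event about two fixed functions, so a bivariate central limit theorem suffices, and \<open>t\<^sub>\<beta>\<close>
  dominates the corresponding quantile of the maximum of the two Gaussian limits.

  Coverage of one endpoint: the gradients of \<open>\<Psi>\<close> along \<open>\<pi>\<^sub>j\<close> need not converge, but convex combinations of
  their tails with nearly minimal norm are nearly Cauchy.  An infimum is at most any convex
  combination, and by Minkowski's inequality the combined standard deviation \<open>\<Sum> c\<^sub>j \<kappa>\<^sub>j\<close> is at least the
  standard deviation of the combined gradient, to which the univariate central limit theorem applies.
  A union bound over \<open>L\<^sub>n\<close>, the selection and the two endpoints gives \<open>\<alpha>\<close>.
\<close>

section \<open>Square-integrable functions\<close>

text \<open>The limit \<open>\<pi>\<^sub>\<infinity>\<close> need not be optimal, whereas linearity
  of the estimator of \<open>Psi\<close> is given on optimal policies only; so coverage is argued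
  along the optimal \<open>\<pi>\<^sub>j\<close>, and the limit serves as the centre for the
  gradients \<open>D\<close> and for the values of \<open>Psi\<close>. The order of choices is
  decisive. At a given sample size n the tail index is taken so late that the distance of
  \<open>Psi\<close> from the endpoint is negligible against 1/sqrt n; hence each probability bound
  has to reach every tail at the same n. For the selection this is a union bound over all late j,
  possible because the variances of the gradient differences are summable. For the coverage it is
  the approximation of one fixed combination by combinations of every later tail. Both sequences
  must be selected on one event, since the error \<beta>/2 may be charged only once: two univariate
  arguments would charge it twice, and the total would exceed \<alpha>.\<close>

lemma square_integrableD:
  assumes "square_integrable P f"
  shows "f \<in> borel_measurable P" "integrable P (\<lambda>z. (f z)\<^sup>2)"
  using assms by (auto simp: square_integrable_def)

lemma square_integrable_mult_integrable:
  assumes "square_integrable P f" "square_integrable P g"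
  shows "integrable P (\<lambda>z. f z * g z)"
proof (rule Bochner_Integration.integrable_bound)
  note [measurable] = square_integrableD(1)[OF assms(1)] square_integrableD(1)[OF assms(2)]
  show "integrable P (\<lambda>z. (f z)\<^sup>2 + (g z)\<^sup>2)"
    using assms by (auto simp: square_integrable_def)
  show "(\<lambda>z. f z * g z) \<in> borel_measurable P" by measurable
  show "AE z in P. norm (f z * g z) \<le> norm ((f z)\<^sup>2 + (g z)\<^sup>2)"
  proof (rule AE_I2)
    fix z
    have "2 * (\<bar>f z\<bar> * \<bar>g z\<bar>) \<le> \<bar>f z\<bar>\<^sup>2 + \<bar>g z\<bar>\<^sup>2"
      using sum_squares_bound[of "\<bar>f z\<bar>" "\<bar>g z\<bar>"] by (simp add: mult.assoc)
    moreover have "0 \<le> \<bar>f z\<bar> * \<bar>g z\<bar>" by simp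
    ultimately have "\<bar>f z\<bar> * \<bar>g z\<bar> \<le> \<bar>f z\<bar>\<^sup>2 + \<bar>g z\<bar>\<^sup>2" by linarith
    then show "norm (f z * g z) \<le> norm ((f z)\<^sup>2 + (g z)\<^sup>2)"
      by (simp add: abs_mult)
  qed
qed

lemma square_integrable_add:
  assumes "square_integrable P f" "square_integrable P g"
  shows "square_integrable P (\<lambda>z. f z + g z)"
proof -
  note [measurable] = square_integrableD(1)[OF assms(1)] square_integrableD(1)[OF assms(2)]
  have "integrable P (\<lambda>z. (f z)\<^sup>2 + (g z)\<^sup>2 + 2 * (f z * g z))"
    using assms square_integrable_mult_integrable[OF assms]
    by (auto simp: square_integrable_def)
  moreover have "(\<lambda>z. (f z)\<^sup>2 + (g z)\<^sup>2 + 2 * (f z * g z)) = (\<lambda>z. (f z + g z)\<^sup>2)"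
    by (simp add: power2_sum algebra_simps)
  ultimately show ?thesis unfolding square_integrable_def by simp
qed

lemma square_integrable_cmult:
  assumes "square_integrable P f"
  shows "square_integrable P (\<lambda>z. c * f z)"
  using assms by (auto simp: square_integrable_def power_mult_distrib)

lemma square_integrable_divide:
  assumes "square_integrable P f"
  shows "square_integrable P (\<lambda>z. f z / c)"
  using square_integrable_cmult[OF assms, of "1/c"] by simp

lemma square_integrable_uminus:
  assumes "square_integrable P f"
  shows "square_integrable P (\<lambda>z. - f z)"
  using square_integrable_cmult[OF assms, of "-1"] by simp

lemma square_integrable_diff:
  assumes "square_integrable P f" "square_integrable P g"
  shows "square_integrable P (\<lambda>z. f z - g z)"
  using square_integrable_add[OF assms(1) square_integrable_uminus[OF assms(2)]] by simp

lemma square_integrable_zero: "square_integrable P (\<lambda>z. 0)"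
  by (simp add: square_integrable_def)

lemma square_integrable_sum:
  assumes "\<And>i. i \<in> I \<Longrightarrow> square_integrable P (f i)"
  shows "square_integrable P (\<lambda>z. \<Sum>i\<in>I. f i z)"
  using assms
proof (induction I rule: infinite_finite_induct)
  case (insert x F)
  then have "square_integrable P (\<lambda>z. f x z + (\<Sum>i\<in>F. f i z))"
    by (intro square_integrable_add) auto
  then show ?case using insert.hyps by simp
qed (simp_all add: square_integrable_zero)

lemma (in prob_space) square_integrable_integrable:
  assumes "square_integrable M f"
  shows "integrable M f"
  by (rule square_integrable_imp_integrable) (use assms in \<open>auto simp: square_integrable_def\<close>)

lemma l2_norm_nonneg [simp]: "0 \<le> l2_norm P f"
  by (simp add: l2_norm_def)

lemma l2_norm_power2: "(l2_norm P f)\<^sup>2 = (\<integral>z. (f z)\<^sup>2 \<partial>P)"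
  by (simp add: l2_norm_def)

lemma l2_norm_uminus: "l2_norm P (\<lambda>z. - f z) = l2_norm P f"
  by (simp add: l2_norm_def)

lemma l2_norm_cmult: "l2_norm P (\<lambda>z. c * f z) = \<bar>c\<bar> * l2_norm P f"
  by (simp add: l2_norm_def power_mult_distrib real_sqrt_mult)

lemma l2_norm_minus_commute: "l2_norm P (\<lambda>z. f z - g z) = l2_norm P (\<lambda>z. g z - f z)"
  by (simp add: l2_norm_def power2_commute)

lemma l2_norm_Cauchy_Schwarz:
  assumes "square_integrable P f" "square_integrable P g"
  shows "(\<integral>z. f z * g z \<partial>P) \<le> l2_norm P f * l2_norm P g"
proof -
  define a b where "a = l2_norm P f" and "b = l2_norm P g"
  have nn: "a \<ge> 0" "b \<ge> 0" by (auto simp: a_def b_def)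
  \<comment> \<open>This is nonnegativity of the integral of (c f - d g)^2 with free multipliers. If
    both norms are positive, c = b and d = a give the claim; if one norm is 0, the multiplier of
    that function is taken large.\<close>
  have key: "2 * c * d * (\<integral>z. f z * g z \<partial>P) \<le> c\<^sup>2 * a\<^sup>2 + d\<^sup>2 * b\<^sup>2" for c d :: real
  proof -
    have "2 * c * d * (\<integral>z. f z * g z \<partial>P) = (\<integral>z. 2 * c * d * (f z * g z) \<partial>P)" by simp
    also have "\<dots> \<le> (\<integral>z. c\<^sup>2 * (f z)\<^sup>2 + d\<^sup>2 * (g z)\<^sup>2 \<partial>P)"
    proof (rule integral_mono)
      show "integrable P (\<lambda>z. 2 * c * d * (f z * g z))"
        using square_integrable_mult_integrable[OF assms] by simp
      show "integrable P (\<lambda>z. c\<^sup>2 * (f z)\<^sup>2 + d\<^sup>2 * (g z)\<^sup>2)"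
        using assms by (auto simp: square_integrable_def)
      show "2 * c * d * (f z * g z) \<le> c\<^sup>2 * (f z)\<^sup>2 + d\<^sup>2 * (g z)\<^sup>2" for z
        using sum_squares_bound[of "c * f z" "d * g z"]
        by (simp add: power_mult_distrib algebra_simps)
    qed
    also have "\<dots> = c\<^sup>2 * a\<^sup>2 + d\<^sup>2 * b\<^sup>2"
      using assms by (simp add: square_integrable_def a_def b_def l2_norm_power2)
    finally show ?thesis .
  qed
  have "(\<integral>z. f z * g z \<partial>P) \<le> a * b"
  proof (rule ccontr)
    assume "\<not> ?thesis"
    then have gt: "(\<integral>z. f z * g z \<partial>P) > a * b" by simp
    define I where "I = (\<integral>z. f z * g z \<partial>P)"
    have I: "I > a * b" "I > 0"
      using gt nn mult_nonneg_nonneg[of a b] unfolding I_def by linarith+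

    show False
    proof (cases "a = 0")
      case True
      have "2 * ((b\<^sup>2 + 1) / I) * 1 * I \<le> b\<^sup>2"
        using key[of "(b\<^sup>2 + 1) / I" 1] True by (simp only: I_def) simp
      moreover have "2 * ((b\<^sup>2 + 1) / I) * 1 * I = 2 * b\<^sup>2 + 2" using I by simp
      ultimately have "2 * b\<^sup>2 + 2 \<le> b\<^sup>2" by (simp only:)
      then show False using zero_le_power2[of b] by linarith
    next
      case a: False
      show False
      proof (cases "b = 0")
        case True
        have "2 * ((a\<^sup>2 + 1) / I) * I \<le> a\<^sup>2"
          using key[of 1 "(a\<^sup>2 + 1) / I"] True by (simp only: I_def) simp
        moreover have "2 * ((a\<^sup>2 + 1) / I) * I = 2 * a\<^sup>2 + 2" using I by simp
        ultimately have "2 * a\<^sup>2 + 2 \<le> a\<^sup>2" by (simp only:)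
        then show False using zero_le_power2[of a] by linarith
      next
        case False
        have "2 * (a * b) * I \<le> 2 * (a * b) * (a * b)"
          using key[of b a] by (simp add: I_def algebra_simps power2_eq_square)
        moreover have "a * b > 0" using a False nn by simp
        ultimately have "I \<le> a * b" by (simp only: mult_le_cancel_left_pos)
        then show False using I by simp
      qed
    qed
  qed
  then show ?thesis by (simp add: a_def b_def)
qed

lemma l2_norm_triangle:
  assumes "square_integrable P f" "square_integrable P g"
  shows "l2_norm P (\<lambda>z. f z + g z) \<le> l2_norm P f + l2_norm P g"
proof (rule power2_le_imp_le)
  have "(l2_norm P (\<lambda>z. f z + g z))\<^sup>2 = (\<integral>z. (f z)\<^sup>2 + (g z)\<^sup>2 + 2 * (f z * g z) \<partial>P)"
    unfolding l2_norm_power2 by (simp add: power2_sum algebra_simps)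
  also have "\<dots> = (l2_norm P f)\<^sup>2 + (l2_norm P g)\<^sup>2 + 2 * (\<integral>z. f z * g z \<partial>P)"
    unfolding l2_norm_power2 using assms square_integrable_mult_integrable[OF assms]
    by (simp add: square_integrable_def)
  also have "\<dots> \<le> (l2_norm P f + l2_norm P g)\<^sup>2"
    using l2_norm_Cauchy_Schwarz[OF assms] by (simp add: power2_sum)
  finally show "(l2_norm P (\<lambda>z. f z + g z))\<^sup>2 \<le> (l2_norm P f + l2_norm P g)\<^sup>2" .
qed simp

lemma l2_norm_triangle_diff:
  assumes "square_integrable P f" "square_integrable P g"
  shows "\<bar>l2_norm P f - l2_norm P g\<bar> \<le> l2_norm P (\<lambda>z. f z - g z)"
  using l2_norm_triangle[OF square_integrable_diff[OF assms] assms(2)]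
    l2_norm_triangle[OF square_integrable_diff[OF assms(2,1)] assms(1)]
    l2_norm_minus_commute[of P f g]
  by simp

lemma l2_norm_sum_le:
  assumes "\<And>i. i \<in> I \<Longrightarrow> square_integrable P (f i)"
  shows "l2_norm P (\<lambda>z. \<Sum>i\<in>I. c i * f i z) \<le> (\<Sum>i\<in>I. \<bar>c i\<bar> * l2_norm P (f i))"
  using assms
proof (induction I rule: infinite_finite_induct)
  case (insert x F)
  have "l2_norm P (\<lambda>z. c x * f x z + (\<Sum>i\<in>F. c i * f i z))
      \<le> l2_norm P (\<lambda>z. c x * f x z) + l2_norm P (\<lambda>z. \<Sum>i\<in>F. c i * f i z)"
    using insert.prems
    by (intro l2_norm_triangle square_integrable_cmult square_integrable_sum) auto
  also have "\<dots> \<le> \<bar>c x\<bar> * l2_norm P (f x) + (\<Sum>i\<in>F. \<bar>c i\<bar> * l2_norm P (f i))"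
    using insert.IH insert.prems by (auto simp: l2_norm_cmult)
  finally show ?case using insert.hyps by simp
qed (auto simp: l2_norm_def)

section \<open>Convex combinations of the tails of a sequence\<close>

definition tail_weights :: "nat \<Rightarrow> (nat \<Rightarrow> real) set" where
  "tail_weights k = {c. (\<forall>j. 0 \<le> c j) \<and> (\<forall>j<k. c j = 0) \<and>
     (\<exists>l. (\<forall>j\<ge>l. c j = 0) \<and> (\<Sum>j<l. c j) = 1)}"

lemma tail_weightsE:
  assumes "c \<in> tail_weights k"
  obtains l where "\<And>j. 0 \<le> c j" "\<And>j. j < k \<Longrightarrow> c j = 0" "\<forall>j\<ge>l. c j = 0" "(\<Sum>j<l. c j) = 1"
  using assms unfolding tail_weights_def by blast

lemma sum_nonzero_weights:
  fixes c x :: "nat \<Rightarrow> real"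
  assumes "\<forall>j\<ge>l. c j = 0"
  shows "(\<Sum>j | c j \<noteq> 0. c j * x j) = (\<Sum>j<l. c j * x j)"
  using assms by (intro sum.mono_neutral_left) (auto simp: not_le[symmetric])

text \<open>Any element of almost minimal norm in the convex hull of a late enough tail will do, by the
  parallelogram law.\<close>

lemma nearly_Cauchy_tail_combinations:
  fixes h :: "nat \<Rightarrow> 'z \<Rightarrow> real"
  defines "comb c \<equiv> (\<lambda>z. \<Sum>j | c j \<noteq> 0. c j * h j z)"
  assumes h: "\<And>j. square_integrable P (h j)" and bdd: "\<And>j. l2_norm P (h j) \<le> K"
    and e: "0 < e"
  obtains c k where "c \<in> tail_weights k"
    "\<And>m. k \<le> m \<Longrightarrow> \<exists>c'\<in>tail_weights m. l2_norm P (\<lambda>z. comb c' z - comb c z) \<le> e"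
proof -
  note sum_l = sum_nonzero_weights
  have sq: "square_integrable P (comb c)" for c
    unfolding comb_def by (intro square_integrable_sum square_integrable_cmult h)
  have norm_le: "l2_norm P (comb c) \<le> K" if c: "c \<in> tail_weights k" for c k
  proof -
    obtain l where l: "\<forall>j\<ge>l. c j = 0" "(\<Sum>j<l. c j) = 1" "\<And>j. 0 \<le> c j"
      by (rule tail_weightsE[OF c]) blast
    have "l2_norm P (comb c) = l2_norm P (\<lambda>z. \<Sum>j<l. c j * h j z)"
      unfolding comb_def sum_l[OF l(1)] ..
    also have "\<dots> \<le> (\<Sum>j<l. \<bar>c j\<bar> * l2_norm P (h j))" by (intro l2_norm_sum_le h)
    also have "\<dots> \<le> (\<Sum>j<l. c j * K)" using l(3) bdd by (intro sum_mono) (auto intro: mult_left_mono)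
    also have "\<dots> = K" using l(2) by (simp add: sum_distrib_right[symmetric])
    finally show ?thesis .
  qed
  \<comment> \<open>Averaging with weights of a later tail stays in the earlier hull. There the
    minimal norm bounds the midpoint from below, which is what the parallelogram law
    consumes.\<close>
  have mid: "\<exists>c3\<in>tail_weights k. \<forall>z. comb c3 z = (comb c1 z + comb c2 z) / 2"
    if mc: "c1 \<in> tail_weights k" "c2 \<in> tail_weights m" "k \<le> m" for c1 c2 k m
  proof -
    obtain l1 where l1: "\<forall>j\<ge>l1. c1 j = 0" "(\<Sum>j<l1. c1 j) = 1" "\<And>j. 0 \<le> c1 j" "\<And>j. j < k \<Longrightarrow> c1 j = 0"
      by (rule tail_weightsE[OF mc(1)]) blast
    obtain l2 where l2: "\<forall>j\<ge>l2. c2 j = 0" "(\<Sum>j<l2. c2 j) = 1" "\<And>j. 0 \<le> c2 j" "\<And>j. j < m \<Longrightarrow> c2 j = 0"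
      by (rule tail_weightsE[OF mc(2)]) blast
    define l where "l = max l1 l2"
    have 1: "\<forall>j\<ge>l. c1 j = 0" "\<forall>j\<ge>l. c2 j = 0" using l1 l2 by (auto simp: l_def)
    have "(\<Sum>j<l. c1 j) = (\<Sum>j<l1. c1 j)" "(\<Sum>j<l. c2 j) = (\<Sum>j<l2. c2 j)"
      using l1(1) l2(1) by (auto simp: l_def intro!: sum.mono_neutral_right) (meson not_less)+
    then have "(\<Sum>j<l. (c1 j + c2 j) / 2) = 1"
      using l1 l2 by (simp add: sum_divide_distrib[symmetric] sum.distrib)
    then have "(\<lambda>j. (c1 j + c2 j) / 2) \<in> tail_weights k"
      using l1(3,4) l2(3,4) 1 \<open>k \<le> m\<close> unfolding tail_weights_def
      by (intro CollectI conjI exI[of _ l]) auto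
    moreover have "comb (\<lambda>j. (c1 j + c2 j) / 2) z = (comb c1 z + comb c2 z) / 2" for z
    proof -
      have "\<forall>j\<ge>l. (c1 j + c2 j) / 2 = 0" using 1 by auto
      then show ?thesis
        unfolding comb_def sum_l[OF 1(1)] sum_l[OF 1(2)] sum_l[OF \<open>\<forall>j\<ge>l. (c1 j + c2 j) / 2 = 0\<close>]
        by (simp only: sum.distrib[symmetric] sum_divide_distrib distrib_right times_divide_eq_left)
    qed
    ultimately show ?thesis by blast
  qed
  have ne: "tail_weights k \<noteq> {}" for k
  proof -
    have "(\<lambda>j. if j = k then 1 else 0) \<in> tail_weights k"
      unfolding tail_weights_def by (intro CollectI conjI exI[of _ "Suc k"]) auto
    then show ?thesis by blast
  qed
  define q where "q c = (l2_norm P (comb c))\<^sup>2" for c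
  define d where "d k = (INF c\<in>tail_weights k. q c)" for k
  \<comment> \<open>The parallelogram law will give 2 \<open>q c\<close> + 2 \<open>q c'\<close> - 4
    \<open>q c3\<close>, where \<open>q c\<close> < \<open>d k\<close> + \<epsilon>,
    \<open>q c'\<close> < \<open>d k\<close> + 2 \<epsilon> and \<open>q c3\<close> >=
    \<open>d k\<close>: at most 6 \<epsilon> in all.\<close>
  define \<epsilon> where "\<epsilon> = e\<^sup>2 / 6"
  have \<epsilon>: "\<epsilon> > 0" using e by (simp add: \<epsilon>_def)
  have bb: "bdd_below (q ` A)" for A by (rule bdd_belowI2[of _ 0]) (simp add: q_def)
  have d_le: "d k \<le> q c" if "c \<in> tail_weights k" for c k
    unfolding d_def by (rule cINF_lower[OF bb that])
  have "d k \<le> K\<^sup>2" for k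
  proof -
    obtain c where c: "c \<in> tail_weights k" using ne by blast
    have "q c \<le> K\<^sup>2" unfolding q_def using norm_le[OF c] by (intro power_mono) auto
    then show ?thesis using d_le[OF c] by simp
  qed
  then have bd: "bdd_above (range d)" by (rule bdd_aboveI2)
  \<comment> \<open>From this tail on, the minimal squared norm can rise by less than \<epsilon>, so
    a near minimizer for any later tail is nearly minimal for tail k as well.\<close>
  have "\<exists>k. (SUP k. d k) - \<epsilon> < d k"
    using less_cSUP_iff[OF _ bd, of "(SUP k. d k) - \<epsilon>"] \<epsilon> by simp
  then obtain k where k: "(SUP k. d k) - \<epsilon> < d k" by blast
  have near: "\<exists>c\<in>tail_weights m. q c < d m + \<epsilon>" for m
    using cINF_less_iff[OF ne bb, of m "d m + \<epsilon>"] \<epsilon> by (simp add: d_def)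
  obtain c where c: "c \<in> tail_weights k" "q c < d k + \<epsilon>" using near by blast
  show thesis
  proof (rule that[OF c(1)])
    fix m assume "k \<le> m"
    obtain c' where c': "c' \<in> tail_weights m" "q c' < d m + \<epsilon>" using near by blast
    have "d m \<le> (SUP k. d k)" using bd by (intro cSUP_upper) auto
    then have qc': "q c' < d k + 2 * \<epsilon>" using c' k by simp
    obtain c3 where c3: "c3 \<in> tail_weights k" "\<And>z. comb c3 z = (comb c z + comb c' z) / 2"
      by (rule bexE[OF mid[OF c(1) c'(1) \<open>k \<le> m\<close>]]) blast
    have int: "integrable P (\<lambda>z. (comb x z)\<^sup>2)" for x using sq by (simp add: square_integrable_def)
    have "(l2_norm P (\<lambda>z. comb c' z - comb c z))\<^sup>2
        = (\<integral>z. 2 * (comb c z)\<^sup>2 + 2 * (comb c' z)\<^sup>2 - 4 * (comb c3 z)\<^sup>2 \<partial>P)"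
    proof -
      have "(x - y)\<^sup>2 = 2 * y\<^sup>2 + 2 * x\<^sup>2 - 4 * ((y + x) / 2)\<^sup>2" for x y :: real
        by (simp add: power2_eq_square field_simps)
      then show ?thesis unfolding l2_norm_power2 c3(2) by (simp only:)
    qed
    also have "\<dots> = 2 * q c + 2 * q c' - 4 * q c3"
      unfolding q_def l2_norm_power2 using int by simp
    also have "\<dots> \<le> 6 * \<epsilon>" using c qc' d_le[OF c3(1)] by simp
    finally have "(l2_norm P (\<lambda>z. comb c' z - comb c z))\<^sup>2 \<le> e\<^sup>2" by (simp add: \<epsilon>_def)
    then have "l2_norm P (\<lambda>z. comb c' z - comb c z) \<le> e"
      by (rule power2_le_imp_le) (use e in simp)
    then show "\<exists>c'\<in>tail_weights m. l2_norm P (\<lambda>z. comb c' z - comb c z) \<le> e" using c'(1) by blast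
  qed
qed

section \<open>Joint convergence in distribution\<close>

context
  fixes M :: "'a measure" and w X :: "'a \<Rightarrow> real" and K :: real
  assumes prob: "prob_space M"
    and meas [measurable]: "w \<in> borel_measurable M" "X \<in> borel_measurable M"
    and bounds: "\<And>x. 1 \<le> w x" "\<And>x. w x \<le> K"
begin

interpretation prob_space M by (rule prob)

lemma integrable_weight: "integrable M w"
  using bounds by (intro integrable_const_bound[of _ K]) (auto intro!: AE_I2 simp: abs_le_iff order_trans[of 0 1] intro: order_trans[of _ 0])

lemma one_le_integral_weight: "1 \<le> integral\<^sup>L M w"
proof -
  have "(\<integral>x. 1 \<partial>M) \<le> integral\<^sup>L M w"
    by (rule integral_mono) (auto simp: bounds integrable_weight)
  then show ?thesis by (simp add: prob_space)
qed

text \<open>Tilting by a weight that depends on a second variable brings joint information into a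
  law on the real line, where the one-dimensional limit theorems apply. Weights of at least 1 keep
  the normalizing constant away from 0.\<close>

definition weighted_law :: "real measure" where
  "weighted_law = distr (density M (\<lambda>x. ennreal (w x / integral\<^sup>L M w))) borel X"

lemma weight_nonneg: "0 \<le> w x" using bounds(1)[of x] by linarith

lemma real_distribution_weighted_law: "real_distribution weighted_law"
proof -
  have m: "0 < integral\<^sup>L M w" using one_le_integral_weight by linarith
  have "emeasure (density M (\<lambda>x. ennreal (w x / integral\<^sup>L M w))) (space M)
      = (\<integral>\<^sup>+x. ennreal (w x / integral\<^sup>L M w) \<partial>M)"
    by (subst emeasure_density) (auto intro!: nn_integral_cong)
  also have "\<dots> = ennreal (\<integral>x. w x / integral\<^sup>L M w \<partial>M)"
    using m weight_nonneg integrable_weight by (intro nn_integral_eq_integral) auto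
  also have "\<dots> = 1" using m by simp
  finally have "prob_space (density M (\<lambda>x. ennreal (w x / integral\<^sup>L M w)))"
    by (intro prob_spaceI) simp
  then show ?thesis
    unfolding weighted_law_def real_distribution_def real_distribution_axioms_def
    by (auto intro!: prob_space.prob_space_distr)
qed

text \<open>The values lie in a general Banach space because both the complex \<open>iexp\<close>
  and real test functions are inserted.\<close>

lemma integral_weighted_law:
  fixes g :: "real \<Rightarrow> 'b::{banach, second_countable_topology}"
  assumes [measurable]: "g \<in> borel_measurable borel"
  shows "integral\<^sup>L M w *\<^sub>R integral\<^sup>L weighted_law g = (\<integral>x. w x *\<^sub>R g (X x) \<partial>M)"
proof -
  have m: "0 < integral\<^sup>L M w" using one_le_integral_weight by linarith
  have "integral\<^sup>L weighted_law g = (\<integral>x. (w x / integral\<^sup>L M w) *\<^sub>R g (X x) \<partial>M)"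
    unfolding weighted_law_def
    by (subst integral_distr, simp, simp, subst integral_density)
      (use m weight_nonneg in \<open>auto intro!: AE_I2\<close>)
  also have "\<dots> = (\<integral>x. (1 / integral\<^sup>L M w) *\<^sub>R (w x *\<^sub>R g (X x)) \<partial>M)" by simp
  also have "\<dots> = (1 / integral\<^sup>L M w) *\<^sub>R (\<integral>x. w x *\<^sub>R g (X x) \<partial>M)"
    by (rule integral_scaleR_right)
  finally show ?thesis using m by simp
qed

end

text \<open>Levy's continuity theorem for the laws of \<open>U n\<close> under the probability measures obtained by
  normalizing the weights.\<close>

lemma weighted_levy_continuity:
  fixes U u :: "nat \<Rightarrow> 'w \<Rightarrow> real" and X x :: "'v \<Rightarrow> real" and \<psi> :: "real \<Rightarrow> real"
  assumes W: "prob_space W" and N: "prob_space N"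
    and [measurable]: "\<And>n. U n \<in> borel_measurable W" "\<And>n. u n \<in> borel_measurable W"
      "X \<in> borel_measurable N" "x \<in> borel_measurable N"
    and u: "\<And>n w. 1 \<le> u n w" "\<And>n w. u n w \<le> K" and x: "\<And>v. 1 \<le> x v" "\<And>v. x v \<le> K"
    and conv: "\<And>a. (\<lambda>n. \<integral>w. u n w *\<^sub>R iexp (a * U n w) \<partial>W) \<longlonglongrightarrow> (\<integral>v. x v *\<^sub>R iexp (a * X v) \<partial>N)"
    and \<psi>: "\<And>t. isCont \<psi> t" "\<And>t. \<bar>\<psi> t\<bar> \<le> B"
  shows "(\<lambda>n. \<integral>w. u n w * \<psi> (U n w) \<partial>W) \<longlonglongrightarrow> (\<integral>v. x v * \<psi> (X v) \<partial>N)"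
proof -
  have [measurable]: "\<psi> \<in> borel_measurable borel"
    using \<psi>(1) by (intro borel_measurable_continuous_onI continuous_at_imp_continuous_on) auto
  define Q where "Q n = weighted_law W (u n) (U n)" for n
  define q where "q = weighted_law N x X"
  have Q: "real_distribution (Q n)" for n
    unfolding Q_def by (rule real_distribution_weighted_law[OF W _ _ u]) auto
  have q: "real_distribution q"
    unfolding q_def by (rule real_distribution_weighted_law[OF N _ _ x]) auto
  have IQ: "integral\<^sup>L W (u n) *\<^sub>R integral\<^sup>L (Q n) g = (\<integral>w. u n w *\<^sub>R g (U n w) \<partial>W)"
    if [measurable]: "g \<in> borel_measurable borel" for n and g :: "real \<Rightarrow> 'c::{banach, second_countable_topology}"
    unfolding Q_def by (rule integral_weighted_law[OF W _ _ u]) auto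
  have Iq: "integral\<^sup>L N x *\<^sub>R integral\<^sup>L q g = (\<integral>v. x v *\<^sub>R g (X v) \<partial>N)"
    if [measurable]: "g \<in> borel_measurable borel" for g :: "real \<Rightarrow> 'c::{banach, second_countable_topology}"
    unfolding q_def by (rule integral_weighted_law[OF N _ _ x]) auto
  have mn: "1 \<le> integral\<^sup>L W (u n)" for n by (rule one_le_integral_weight[where X="U n", OF W _ _ u]) auto
  have m: "1 \<le> integral\<^sup>L N x" by (rule one_le_integral_weight[where X=X, OF N _ _ x]) auto
  \<comment> \<open>Frequency 0 of the hypothesis is the convergence of the normalizing
    constants.\<close>
  have "(\<lambda>n. \<integral>w. complex_of_real (u n w) \<partial>W) \<longlonglongrightarrow> (\<integral>v. complex_of_real (x v) \<partial>N)"
    using conv[of 0] by (simp add: scaleR_conv_of_real)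
  then have mlim: "(\<lambda>n. integral\<^sup>L W (u n)) \<longlonglongrightarrow> integral\<^sup>L N x"
    by (simp only: integral_complex_of_real tendsto_of_real_iff)
  have char_eq: "integral\<^sup>L W (u n) *\<^sub>R char (Q n) a = (\<integral>w. u n w *\<^sub>R iexp (a * U n w) \<partial>W)" for n a
    unfolding char_def by (rule IQ) simp
  have char_eq': "integral\<^sup>L N x *\<^sub>R char q a = (\<integral>v. x v *\<^sub>R iexp (a * X v) \<partial>N)" for a
    unfolding char_def by (rule Iq) simp
  have "(\<lambda>n. char (Q n) a) \<longlonglongrightarrow> char q a" for a
  proof -
    have "(\<lambda>n. (1 / integral\<^sup>L W (u n)) *\<^sub>R (integral\<^sup>L W (u n) *\<^sub>R char (Q n) a))
        \<longlonglongrightarrow> (1 / integral\<^sup>L N x) *\<^sub>R (integral\<^sup>L N x *\<^sub>R char q a)"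
      unfolding char_eq char_eq' using m by (intro tendsto_intros conv mlim) auto
    moreover have "(1 / integral\<^sup>L W (u n)) *\<^sub>R (integral\<^sup>L W (u n) *\<^sub>R char (Q n) a) = char (Q n) a" for n
      using mn[of n] by simp
    moreover have "(1 / integral\<^sup>L N x) *\<^sub>R (integral\<^sup>L N x *\<^sub>R char q a) = char q a"
      using m by simp
    ultimately show ?thesis by simp
  qed
  then have "weak_conv_m Q q" by (intro levy_continuity Q q)
  then have "(\<lambda>n. integral\<^sup>L (Q n) \<psi>) \<longlonglongrightarrow> integral\<^sup>L q \<psi>"
    using Q q \<psi> by (intro weak_conv_imp_integral_bdd_continuous_conv[of Q q \<psi> B]) auto
  then have "(\<lambda>n. integral\<^sup>L W (u n) *\<^sub>R integral\<^sup>L (Q n) \<psi>) \<longlonglongrightarrow> integral\<^sup>L N x *\<^sub>R integral\<^sup>L q \<psi>"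
    by (intro tendsto_intros mlim)
  then show ?thesis by (subst (asm) IQ, simp, subst (asm) Iq) auto
qed

text \<open>Two applications of the previous lemma: first to \<open>U\<close> with weights \<open>2 + cos (b * V)\<close> and
  \<open>2 + sin (b * V)\<close>, then to \<open>V\<close> with the weights \<open>1 + f U\<close>.\<close>

lemma joint_levy_continuity:
  fixes U V :: "nat \<Rightarrow> 'w \<Rightarrow> real" and X Y :: "'v \<Rightarrow> real" and f g :: "real \<Rightarrow> real"
  assumes W: "prob_space W" and N: "prob_space N"
    and [measurable]: "\<And>n. U n \<in> borel_measurable W" "\<And>n. V n \<in> borel_measurable W"
      "X \<in> borel_measurable N" "Y \<in> borel_measurable N"
    and conv: "\<And>a b. (\<lambda>n. \<integral>w. iexp (a * U n w + b * V n w) \<partial>W)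
      \<longlonglongrightarrow> (\<integral>v. iexp (a * X v + b * Y v) \<partial>N)"
    and f: "\<And>t. isCont f t" "\<And>t. 0 \<le> f t" "\<And>t. f t \<le> 1"
    and g: "\<And>t. isCont g t" "\<And>t. 0 \<le> g t" "\<And>t. g t \<le> 1"
  shows "(\<lambda>n. \<integral>w. f (U n w) * g (V n w) \<partial>W) \<longlonglongrightarrow> (\<integral>v. f (X v) * g (Y v) \<partial>N)"
proof -
  interpret W: prob_space W by fact
  interpret N: prob_space N by fact
  have [measurable]: "f \<in> borel_measurable borel" "g \<in> borel_measurable borel"
    using f(1) g(1)
    by (auto intro!: borel_measurable_continuous_onI continuous_at_imp_continuous_on)
  have fb: "\<bar>f t\<bar> \<le> 1" and gb: "\<bar>g t\<bar> \<le> 1" for t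
    using f(2,3)[of t] g(2,3)[of t] by auto
  have iW: "integrable W (\<lambda>w. iexp (p w))" if "p \<in> borel_measurable W" for p
    using that by (intro W.integrable_const_bound[of _ 1]) auto
  have iN: "integrable N (\<lambda>w. iexp (p w))" if "p \<in> borel_measurable N" for p
    using that by (intro N.integrable_const_bound[of _ 1]) auto
  have iexp_cis: "iexp x = cis x" for x
    by (simp add: cis_conv_exp)
  \<comment> \<open>Product-to-sum formulas: trigonometric weights in V turn a weighted
    characteristic function of U into joint characteristic functions, whose limits
    \<open>conv\<close> supplies. The summand 2 keeps the weights between 1 and 3.\<close>
  have cos_eq: "(2 + cos y) *\<^sub>R iexp x = 2 * iexp x + (iexp (x + y) + iexp (x - y)) / 2" for x y
    unfolding iexp_cis by (simp add: complex_eq_iff cos_add cos_diff sin_add sin_diff algebra_simps add_divide_distrib diff_divide_distrib)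
  have sin_eq: "(2 + sin y) *\<^sub>R iexp x = 2 * iexp x + \<i> / 2 * (iexp (x - y) - iexp (x + y))" for x y
    unfolding iexp_cis
    by (simp add: complex_eq_iff cos_add cos_diff sin_add sin_diff algebra_simps add_divide_distrib diff_divide_distrib)
  have cos_integral: "(\<integral>w. (2 + cos (q w)) *\<^sub>R iexp (p w) \<partial>M)
      = 2 * (\<integral>w. iexp (p w) \<partial>M) + ((\<integral>w. iexp (p w + q w) \<partial>M) + (\<integral>w. iexp (p w - q w) \<partial>M)) / 2"
    if i: "integrable M (\<lambda>w. iexp (p w))" "integrable M (\<lambda>w. iexp (p w + q w))"
      "integrable M (\<lambda>w. iexp (p w - q w))" for M :: "'z measure" and p q
    unfolding cos_eq
      Bochner_Integration.integral_add[OF integrable_mult_right[OF i(1)]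
        integrable_divide[OF Bochner_Integration.integrable_add[OF i(2,3)]]]
      integral_mult_right_zero integral_divide_zero Bochner_Integration.integral_add[OF i(2,3)] ..
  have sin_integral: "(\<integral>w. (2 + sin (q w)) *\<^sub>R iexp (p w) \<partial>M)
      = 2 * (\<integral>w. iexp (p w) \<partial>M) + \<i> / 2 * ((\<integral>w. iexp (p w - q w) \<partial>M) - (\<integral>w. iexp (p w + q w) \<partial>M))"
    if i: "integrable M (\<lambda>w. iexp (p w))" "integrable M (\<lambda>w. iexp (p w - q w))"
      "integrable M (\<lambda>w. iexp (p w + q w))" for M :: "'z measure" and p q
    unfolding sin_eq
      Bochner_Integration.integral_add[OF integrable_mult_right[OF i(1)]
        integrable_mult_right[OF Bochner_Integration.integrable_diff[OF i(2,3)]]]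
      integral_mult_right_zero Bochner_Integration.integral_diff[OF i(2,3)] ..
  have c1: "(\<lambda>n. \<integral>w. iexp (a * U n w) \<partial>W) \<longlonglongrightarrow> (\<integral>v. iexp (a * X v) \<partial>N)" for a
    using conv[of a 0] by simp
  have c2: "(\<lambda>n. \<integral>w. iexp (a * U n w - b * V n w) \<partial>W)
      \<longlonglongrightarrow> (\<integral>v. iexp (a * X v - b * Y v) \<partial>N)" for a b
    using conv[of a "-b"] by simp
  have cosU: "(\<lambda>n. \<integral>w. (2 + cos (b * V n w)) * f (U n w) \<partial>W)
      \<longlonglongrightarrow> (\<integral>v. (2 + cos (b * Y v)) * f (X v) \<partial>N)" for b
  proof (rule weighted_levy_continuity[OF W N, where U=U and X=X and \<psi>=f and K=3 and B=1])
    have k: "-1 \<le> cos t" "cos t \<le> 1" for t :: real by auto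
    show "1 \<le> 2 + cos (b * V n w)" "2 + cos (b * V n w) \<le> 3" for n w using k[of "b * V n w"] by linarith+
    show "1 \<le> 2 + cos (b * Y v)" "2 + cos (b * Y v) \<le> 3" for v using k[of "b * Y v"] by linarith+
    fix a
    show "(\<lambda>n. \<integral>w. (2 + cos (b * V n w)) *\<^sub>R iexp (a * U n w) \<partial>W)
        \<longlonglongrightarrow> (\<integral>v. (2 + cos (b * Y v)) *\<^sub>R iexp (a * X v) \<partial>N)"
    proof -
      have W: "(\<integral>w. (2 + cos (b * V n w)) *\<^sub>R iexp (a * U n w) \<partial>W)
          = 2 * (\<integral>w. iexp (a * U n w) \<partial>W)
            + ((\<integral>w. iexp (a * U n w + b * V n w) \<partial>W) + (\<integral>w. iexp (a * U n w - b * V n w) \<partial>W)) / 2" for n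
        by (rule cos_integral; rule iW) measurable
      have N: "(\<integral>v. (2 + cos (b * Y v)) *\<^sub>R iexp (a * X v) \<partial>N)
          = 2 * (\<integral>w. iexp (a * X w) \<partial>N)
            + ((\<integral>w. iexp (a * X w + b * Y w) \<partial>N) + (\<integral>w. iexp (a * X w - b * Y w) \<partial>N)) / 2"
        by (rule cos_integral; rule iN) measurable
      show ?thesis
        unfolding W N by (rule tendsto_add[OF tendsto_mult_left[OF c1] tendsto_divide[OF tendsto_add[OF conv c2] tendsto_const]]) simp?
    qed
  qed (use f fb in auto)
  have sinU: "(\<lambda>n. \<integral>w. (2 + sin (b * V n w)) * f (U n w) \<partial>W)
      \<longlonglongrightarrow> (\<integral>v. (2 + sin (b * Y v)) * f (X v) \<partial>N)" for b
  proof (rule weighted_levy_continuity[OF W N, where U=U and X=X and \<psi>=f and K=3 and B=1])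
    have k: "-1 \<le> sin t" "sin t \<le> 1" for t :: real by auto
    show "1 \<le> 2 + sin (b * V n w)" "2 + sin (b * V n w) \<le> 3" for n w using k[of "b * V n w"] by linarith+
    show "1 \<le> 2 + sin (b * Y v)" "2 + sin (b * Y v) \<le> 3" for v using k[of "b * Y v"] by linarith+
    fix a
    show "(\<lambda>n. \<integral>w. (2 + sin (b * V n w)) *\<^sub>R iexp (a * U n w) \<partial>W)
        \<longlonglongrightarrow> (\<integral>v. (2 + sin (b * Y v)) *\<^sub>R iexp (a * X v) \<partial>N)"
    proof -
      have W: "(\<integral>w. (2 + sin (b * V n w)) *\<^sub>R iexp (a * U n w) \<partial>W)
          = 2 * (\<integral>w. iexp (a * U n w) \<partial>W)
            + \<i> / 2 * ((\<integral>w. iexp (a * U n w - b * V n w) \<partial>W) - (\<integral>w. iexp (a * U n w + b * V n w) \<partial>W))" for n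
        by (rule sin_integral; rule iW) measurable
      have N: "(\<integral>v. (2 + sin (b * Y v)) *\<^sub>R iexp (a * X v) \<partial>N)
          = 2 * (\<integral>w. iexp (a * X w) \<partial>N)
            + \<i> / 2 * ((\<integral>w. iexp (a * X w - b * Y w) \<partial>N) - (\<integral>w. iexp (a * X w + b * Y w) \<partial>N))"
        by (rule sin_integral; rule iN) measurable
      show ?thesis
        unfolding W N by (rule tendsto_add[OF tendsto_mult_left[OF c1] tendsto_mult_left[OF tendsto_diff[OF c2 conv]]]) simp?
    qed
  qed (use f fb in auto)
  have fU: "(\<lambda>n. \<integral>w. f (U n w) \<partial>W) \<longlonglongrightarrow> (\<integral>v. f (X v) \<partial>N)"
  proof -
    have "(\<lambda>n. \<integral>w. 1 * f (U n w) \<partial>W) \<longlonglongrightarrow> (\<integral>v. 1 * f (X v) \<partial>N)"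
      by (rule weighted_levy_continuity[OF W N, where K=1 and B=1])
        (simp_all add: f fb c1 del: of_real_mult)
    then show ?thesis by simp
  qed
  have V1: "(\<lambda>n. \<integral>w. iexp (b * V n w) \<partial>W) \<longlonglongrightarrow> (\<integral>v. iexp (b * Y v) \<partial>N)" for b
    using conv[of 0 b] by simp
  have gV: "(\<lambda>n. \<integral>w. g (V n w) \<partial>W) \<longlonglongrightarrow> (\<integral>v. g (Y v) \<partial>N)"
  proof -
    have "(\<lambda>n. \<integral>w. 1 * g (V n w) \<partial>W) \<longlonglongrightarrow> (\<integral>v. 1 * g (Y v) \<partial>N)"
      by (rule weighted_levy_continuity[OF W N, where K=1 and B=1])
        (simp_all add: g gb V1 del: of_real_mult)
    then show ?thesis by simp
  qed
  have iWr: "integrable W (\<lambda>w. p w * f (U n w))" if "p \<in> borel_measurable W" "\<And>w. \<bar>p w\<bar> \<le> 1" for p n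
    using that fb by (intro W.integrable_const_bound[of _ 1]) (auto simp: abs_mult intro!: mult_le_one)
  have iNr: "integrable N (\<lambda>w. p w * f (X w))" if "p \<in> borel_measurable N" "\<And>w. \<bar>p w\<bar> \<le> 1" for p
    using that fb by (intro N.integrable_const_bound[of _ 1]) (auto simp: abs_mult intro!: mult_le_one)
  have iWf: "integrable W (\<lambda>w. f (U n w))" for n using iWr[of "\<lambda>_. 1" n] by simp
  have iNf: "integrable N (\<lambda>w. f (X w))" using iNr[of "\<lambda>_. 1"] by simp
  have cosf: "(\<lambda>n. \<integral>w. cos (b * V n w) * f (U n w) \<partial>W) \<longlonglongrightarrow> (\<integral>v. cos (b * Y v) * f (X v) \<partial>N)" for b
    using tendsto_diff[OF cosU[of b] tendsto_mult_left[OF fU, of 2]]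
    by (simp add: distrib_right iWr iNr iWf iNf)
  have sinf: "(\<lambda>n. \<integral>w. sin (b * V n w) * f (U n w) \<partial>W) \<longlonglongrightarrow> (\<integral>v. sin (b * Y v) * f (X v) \<partial>N)" for b
    using tendsto_diff[OF sinU[of b] tendsto_mult_left[OF fU, of 2]]
    by (simp add: distrib_right iWr iNr iWf iNf)
  \<comment> \<open>The second round reduces to the first: the cosine and sine parts are the mixed
    moments of f(U) with \<open>cos (b * V)\<close> and \<open>sin (b * V)\<close>, whose limits are
    now known.\<close>
  have split: "(1 + x) *\<^sub>R iexp y = iexp y + complex_of_real (cos y * x) + \<i> * complex_of_real (sin y * x)" for x y
    unfolding iexp_cis by (simp add: complex_eq_iff algebra_simps)
  have split_integral: "(\<integral>w. (1 + p w) *\<^sub>R iexp (q w) \<partial>M)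
      = (\<integral>w. iexp (q w) \<partial>M) + complex_of_real (\<integral>w. cos (q w) * p w \<partial>M)
        + \<i> * complex_of_real (\<integral>w. sin (q w) * p w \<partial>M)"
    if i: "integrable M (\<lambda>w. iexp (q w))" "integrable M (\<lambda>w. cos (q w) * p w)"
      "integrable M (\<lambda>w. sin (q w) * p w)" for M :: "'z measure" and p q
  proof -
    have c: "integrable M (\<lambda>w. complex_of_real (cos (q w) * p w))"
      "integrable M (\<lambda>w. \<i> * complex_of_real (sin (q w) * p w))"
      using i(2,3) by (intro integrable_of_real integrable_mult_right; simp)+
    show ?thesis
      unfolding split Bochner_Integration.integral_add[OF Bochner_Integration.integrable_add[OF i(1) c(1)] c(2)]
        Bochner_Integration.integral_add[OF i(1) c(1)] integral_mult_right_zero integral_complex_of_real ..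
  qed
  have fg: "(\<lambda>n. \<integral>w. (1 + f (U n w)) * g (V n w) \<partial>W) \<longlonglongrightarrow> (\<integral>v. (1 + f (X v)) * g (Y v) \<partial>N)"
  proof (rule weighted_levy_continuity[OF W N, where U=V and X=Y and \<psi>=g and K=2 and B=1])
    show "1 \<le> 1 + f (U n w)" "1 + f (U n w) \<le> 2" for n w using f(2,3)[of "U n w"] by auto
    show "1 \<le> 1 + f (X v)" "1 + f (X v) \<le> 2" for v using f(2,3)[of "X v"] by auto
    fix b
    have eW: "(\<integral>w. (1 + f (U n w)) *\<^sub>R iexp (b * V n w) \<partial>W)
        = (\<integral>w. iexp (b * V n w) \<partial>W) + complex_of_real (\<integral>w. cos (b * V n w) * f (U n w) \<partial>W)
          + \<i> * complex_of_real (\<integral>w. sin (b * V n w) * f (U n w) \<partial>W)" for n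
      by (rule split_integral; (rule iW)?; (rule iWr)?; simp)
    have eN: "(\<integral>v. (1 + f (X v)) *\<^sub>R iexp (b * Y v) \<partial>N)
        = (\<integral>v. iexp (b * Y v) \<partial>N) + complex_of_real (\<integral>v. cos (b * Y v) * f (X v) \<partial>N)
          + \<i> * complex_of_real (\<integral>v. sin (b * Y v) * f (X v) \<partial>N)"
      by (rule split_integral; (rule iN)?; (rule iNr)?; simp)
    show "(\<lambda>n. \<integral>w. (1 + f (U n w)) *\<^sub>R iexp (b * V n w) \<partial>W)
        \<longlonglongrightarrow> (\<integral>v. (1 + f (X v)) *\<^sub>R iexp (b * Y v) \<partial>N)"
      unfolding eW eN by (intro tendsto_intros V1 cosf sinf)
  qed (use g gb in auto)
  have iWg: "integrable W (\<lambda>w. g (V n w))" "integrable W (\<lambda>w. f (U n w) * g (V n w))" for n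
    using f g
    by (intro W.integrable_const_bound[of _ 1]; simp add: abs_mult mult_le_one)+
  have iNg: "integrable N (\<lambda>w. g (Y w))" "integrable N (\<lambda>w. f (X w) * g (Y w))"
    using f g
    by (intro N.integrable_const_bound[of _ 1]; simp add: abs_mult mult_le_one)+
  \<comment> \<open>The summand 1 served to keep the weight at least 1; its contribution is removed
    by the limit of the mean of g(V).\<close>
  show ?thesis
    using tendsto_diff[OF fg gV] by (simp add: distrib_right iWg iNg)
qed

section \<open>Empirical means of independent draws\<close>

locale iid_sample =
  fixes W :: "'w measure" and P :: "'z measure" and Z :: "nat \<Rightarrow> 'w \<Rightarrow> 'z"
  assumes iid: "iid_draws W P Z"
begin

sublocale W: prob_space W
  using iid by (simp add: iid_draws_def)

lemma indep_draws: "W.indep_vars (\<lambda>_. P) Z UNIV"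
  using iid by (simp add: iid_draws_def)

lemma distr_draw: "distr W P (Z i) = P"
  using iid by (simp add: iid_draws_def)

lemma measurable_draw [measurable]: "Z i \<in> measurable W P"
  using indep_draws by (simp add: W.indep_vars_def)

sublocale P: prob_space P
  using W.prob_space_distr[OF measurable_draw, of 0] by (simp add: distr_draw)

lemma integral_draw:
  fixes f :: "'z \<Rightarrow> 'b::{banach, second_countable_topology}"
  assumes "f \<in> borel_measurable P"
  shows "(\<integral>w. f (Z i w) \<partial>W) = (\<integral>z. f z \<partial>P)"
  using integral_distr[OF measurable_draw assms, of i] by (simp add: distr_draw)

lemma integrable_draw:
  fixes f :: "'z \<Rightarrow> 'b::{banach, second_countable_topology}"
  assumes "integrable P f"
  shows "integrable W (\<lambda>w. f (Z i w))"
  by (rule integrable_distr[OF measurable_draw[of i]]) (unfold distr_draw, rule assms)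

lemma AE_draw:
  assumes "AE z in P. Q z"
  shows "AE w in W. Q (Z i w)"
proof -
  have "AE z in distr W P (Z i). Q z" unfolding distr_draw by (rule assms)
  then show ?thesis by (rule AE_distrD[OF measurable_draw])
qed

lemma indep_values:
  assumes "f \<in> borel_measurable P"
  shows "W.indep_vars (\<lambda>_. borel) (\<lambda>i w. f (Z i w)) UNIV"
  by (rule W.indep_vars_compose2[OF indep_draws assms])

definition scaled_mean :: "('z \<Rightarrow> real) \<Rightarrow> nat \<Rightarrow> 'w \<Rightarrow> real" where
  "scaled_mean f n w = sqrt (real n) * emp_mean Z n w f"

lemma scaled_mean_eq: "scaled_mean f n w = (\<Sum>i<n. f (Z i w)) / sqrt (real n)"
proof -
  have "sqrt (real n) * (S / real n) = S / sqrt (real n)" for S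
    using sqrt_divide_self_eq[of "real n"] by (simp add: divide_inverse mult.assoc mult.left_commute)
  then show ?thesis by (simp add: scaled_mean_def emp_mean_def)
qed

lemma measurable_scaled_mean [measurable]:
  assumes [measurable]: "f \<in> borel_measurable P"
  shows "scaled_mean f n \<in> borel_measurable W"
  unfolding scaled_mean_eq[abs_def] by measurable

lemma scaled_mean_add: "scaled_mean (\<lambda>z. f z + g z) n w = scaled_mean f n w + scaled_mean g n w"
  by (simp add: scaled_mean_eq sum.distrib add_divide_distrib)

lemma scaled_mean_diff: "scaled_mean (\<lambda>z. f z - g z) n w = scaled_mean f n w - scaled_mean g n w"
  by (simp add: scaled_mean_eq sum_subtractf diff_divide_distrib)

lemma scaled_mean_cmult: "scaled_mean (\<lambda>z. c * f z) n w = c * scaled_mean f n w"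
  by (simp add: scaled_mean_eq sum_distrib_left[symmetric])

lemma scaled_mean_uminus: "scaled_mean (\<lambda>z. - f z) n w = - scaled_mean f n w"
  by (simp add: scaled_mean_eq sum_negf)

lemma scaled_mean_sum:
  "scaled_mean (\<lambda>z. \<Sum>j\<in>J. c j * f j z) n w = (\<Sum>j\<in>J. c j * scaled_mean (f j) n w)"
  by (simp add: scaled_mean_eq sum.swap[of _ J] sum_distrib_left[symmetric] sum_divide_distrib[symmetric])

lemma AE_scaled_mean_eq_0:
  assumes "AE z in P. f z = 0"
  shows "AE w in W. scaled_mean f n w = 0"
proof -
  have "AE w in W. \<forall>i\<in>{..<n}. f (Z i w) = 0"
    using AE_draw[OF assms] by (intro AE_finite_allI) auto
  then show ?thesis by eventually_elim (simp add: scaled_mean_eq)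
qed

text \<open>Independence and centering remove the off-diagonal terms of the squared sum, and the
  scaling cancels the number of diagonal ones. As the result is free of n, Chebyshev bounds below
  are uniform in n.\<close>

lemma scaled_mean_second_moment:
  assumes f: "square_integrable P f" and mean: "(\<integral>z. f z \<partial>P) = 0" and n: "0 < n"
  shows "integrable W (\<lambda>w. (scaled_mean f n w)\<^sup>2)"
    and "(\<integral>w. (scaled_mean f n w)\<^sup>2 \<partial>W) = (l2_norm P f)\<^sup>2"
    and "(\<integral>w. scaled_mean f n w \<partial>W) = 0"
proof -
  note [measurable] = square_integrableD(1)[OF f]
  have int: "integrable P f" by (rule P.square_integrable_integrable[OF f])
  have prod: "integrable W (\<lambda>w. f (Z i w) * f (Z j w)) \<and>
      (\<integral>w. f (Z i w) * f (Z j w) \<partial>W) = (if i = j then (l2_norm P f)\<^sup>2 else 0)" for i j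
  proof (cases "i = j")
    case True
    then show ?thesis
      using integrable_draw[OF square_integrableD(2)[OF f], of i] integral_draw[of "\<lambda>z. (f z)\<^sup>2" i]
      by (simp add: power2_eq_square l2_norm_power2[unfolded power2_eq_square])
  next
    case False
    have ind: "W.indep_vars (\<lambda>_. borel) (\<lambda>k w. f (Z k w)) {i, j}"
      by (rule W.indep_vars_subset[OF indep_values]) auto
    show ?thesis
      using W.indep_vars_lebesgue_integral[OF _ ind integrable_draw[OF int]]
        W.indep_vars_integrable[OF _ ind integrable_draw[OF int]] False
      by (simp add: integral_draw mean)
  qed
  have eq: "(scaled_mean f n w)\<^sup>2 = (\<Sum>i<n. \<Sum>j<n. f (Z i w) * f (Z j w)) / real n" for w
    unfolding scaled_mean_eq by (simp add: power_divide power2_eq_square sum_product)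
  show "integrable W (\<lambda>w. (scaled_mean f n w)\<^sup>2)"
    unfolding eq using prod by (intro integrable_divide Bochner_Integration.integrable_sum) auto
  have "(\<integral>w. (scaled_mean f n w)\<^sup>2 \<partial>W)
      = (\<Sum>i<n. \<Sum>j<n. (\<integral>w. f (Z i w) * f (Z j w) \<partial>W)) / real n"
    unfolding eq using prod by (simp add: Bochner_Integration.integral_sum Bochner_Integration.integrable_sum)
  also have "\<dots> = (l2_norm P f)\<^sup>2"
    using prod n by simp
  finally show "(\<integral>w. (scaled_mean f n w)\<^sup>2 \<partial>W) = (l2_norm P f)\<^sup>2" .
  show "(\<integral>w. scaled_mean f n w \<partial>W) = 0"
    unfolding scaled_mean_eq using integrable_draw[OF int]
    by (simp add: Bochner_Integration.integral_sum integral_draw mean)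
qed

lemma scaled_mean_Chebyshev:
  assumes f: "square_integrable P f" and mean: "(\<integral>z. f z \<partial>P) = 0" and n: "0 < n" and a: "0 < a"
  shows "measure W {w \<in> space W. a \<le> \<bar>scaled_mean f n w\<bar>} \<le> (l2_norm P f)\<^sup>2 / a\<^sup>2"
proof -
  note [measurable] = square_integrableD(1)[OF f]
  show ?thesis
    using W.Chebyshev_inequality[OF measurable_scaled_mean scaled_mean_second_moment(1)[OF f mean n] a]
      scaled_mean_second_moment(2,3)[OF f mean n] by simp
qed

lemma scaled_mean_weak_conv:
  assumes f: "square_integrable P f" and mean: "(\<integral>z. f z \<partial>P) = 0" and pos: "0 < l2_norm P f"
  shows "weak_conv_m (\<lambda>n. distr W borel (\<lambda>w. scaled_mean f n w / l2_norm P f)) std_normal_distribution"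
proof -
  note [measurable] = square_integrableD(1)[OF f]
  have "weak_conv_m (\<lambda>n. distr W borel (\<lambda>w. (\<Sum>i<n. f (Z i w)) / sqrt (real n * (l2_norm P f)\<^sup>2)))
      std_normal_distribution"
  proof (rule W.central_limit_theorem_zero_mean[OF indep_values])
    show "integrable W (\<lambda>w. (f (Z n w))\<^sup>2)" for n
      by (rule integrable_draw[OF square_integrableD(2)[OF f]])
    show "distr W borel (\<lambda>w. f (Z n w)) = distr P borel f" for n
      using distr_distr[of f P borel "Z n" W] by (simp add: distr_draw comp_def)
    show "W.variance (\<lambda>w. f (Z n w)) = (l2_norm P f)\<^sup>2" for n
      using integral_draw[of "\<lambda>z. (f z)\<^sup>2" n] by (simp add: integral_draw mean l2_norm_power2)
  qed (use pos mean in \<open>auto simp: integral_draw\<close>)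
  then show ?thesis using pos by (simp add: scaled_mean_eq real_sqrt_mult)
qed

text \<open>Applied to all linear combinations of two functions, this gives the joint characteristic
  function, as in the Cramer-Wold device. Combinations of norm 0 escape the central limit theorem,
  but their scaled means vanish almost surely, in accordance with the limit exp 0.\<close>

lemma scaled_mean_char_limit:
  assumes f: "square_integrable P f" and mean: "(\<integral>z. f z \<partial>P) = 0"
  shows "(\<lambda>n. \<integral>w. iexp (scaled_mean f n w) \<partial>W) \<longlonglongrightarrow> exp (- (l2_norm P f)\<^sup>2 / 2)"
proof (cases "l2_norm P f = 0")
  case True
  note [measurable] = square_integrableD(1)[OF f]
  have "(\<integral>z. (f z)\<^sup>2 \<partial>P) = 0" using True l2_norm_power2[of P f] by simp
  then have "AE z in P. f z = 0"
    using integral_nonneg_eq_0_iff_AE[OF square_integrableD(2)[OF f]] by simp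
  then have "(\<integral>w. iexp (scaled_mean f n w) \<partial>W) = (\<integral>w. 1 \<partial>W)" for n
    using AE_scaled_mean_eq_0[of f n] by (intro integral_cong_AE) auto
  then show ?thesis using True by (simp add: W.prob_space)
next
  case False
  then have pos: "0 < l2_norm P f" using l2_norm_nonneg[of P f] by linarith
  note [measurable] = square_integrableD(1)[OF f]
  have "real_distribution (distr W borel (\<lambda>w. scaled_mean f n w / l2_norm P f))" for n
    by (rule W.real_distribution_distr) simp
  \<comment> \<open>Evaluation at the frequency \<open>l2_norm P f\<close> undoes the
    standardization.\<close>
  then have "(\<lambda>n. char (distr W borel (\<lambda>w. scaled_mean f n w / l2_norm P f)) (l2_norm P f))
      \<longlonglongrightarrow> char std_normal_distribution (l2_norm P f)"
    by (intro levy_continuity1 scaled_mean_weak_conv[OF f mean pos] real_dist_normal_dist)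
  moreover have "char (distr W borel (\<lambda>w. scaled_mean f n w / l2_norm P f)) (l2_norm P f)
      = (\<integral>w. iexp (scaled_mean f n w) \<partial>W)" for n
    unfolding char_def using pos by (subst integral_distr) auto
  ultimately show ?thesis by (simp add: char_std_normal_distribution)
qed

end

section \<open>The standard normal distribution\<close>

interpretation std_normal: real_distribution std_normal_distribution
  by (rule real_dist_normal_dist)

lemma std_normal_density_le_1: "std_normal_density x \<le> 1"
proof -
  have "1 \<le> sqrt (2 * pi)" using pi_gt3 by simp
  then have "1 / sqrt (2 * pi) \<le> 1" by simp
  moreover have "exp (- x\<^sup>2 / 2) \<le> 1" by simp
  ultimately show ?thesis
    unfolding std_normal_density_def by (intro mult_le_one) auto
qed

text \<open>The density is at most 1, so mass is at most length. This crude bound makes the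
  distribution function 1-Lipschitz and prices every later shift of a threshold.\<close>

lemma std_normal_interval_le:
  assumes "a \<le> b"
  shows "measure std_normal_distribution {a<..b} \<le> b - a"
proof -
  have "emeasure std_normal_distribution {a<..b}
      = (\<integral>\<^sup>+x. ennreal (std_normal_density x) * indicator {a<..b} x \<partial>lborel)"
    by (subst emeasure_density) auto
  also have "\<dots> \<le> (\<integral>\<^sup>+x. indicator {a<..b} x \<partial>lborel)"
    using std_normal_density_le_1
    by (intro nn_integral_mono) (auto simp: indicator_def ennreal_le_1)
  also have "\<dots> = ennreal (b - a)" using assms by simp
  finally show ?thesis using assms by (simp add: std_normal.emeasure_eq_measure)
qed

lemma std_normal_cdf_diff_le:
  assumes "a \<le> b"
  shows "cdf std_normal_distribution b - cdf std_normal_distribution a \<le> b - a"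
proof (cases "a = b")
  case False
  then show ?thesis
    using std_normal_interval_le[OF assms] assms
      finite_borel_measure.cdf_diff_eq[OF std_normal.finite_borel_measure_M, of a b] by simp
qed simp

lemma std_normal_isCont_cdf: "isCont (cdf std_normal_distribution) x"
proof -
  have "emeasure std_normal_distribution {x} = 0"
    by (subst emeasure_density) (auto intro!: nn_integral_zero' AE_I[where N="{x}"] simp: indicator_def)
  then show ?thesis by (simp add: std_normal.isCont_cdf measure_def)
qed

text \<open>The two closed half lines have equal mass by symmetry, and 0 is not an atom. This makes
  the quantiles at levels above 1/2 positive.\<close>

lemma std_normal_cdf_0: "cdf std_normal_distribution 0 \<le> 1 / 2"
proof -
  have eq: "emeasure std_normal_distribution {..0} = emeasure std_normal_distribution {0..}"
  proof -
    have "emeasure std_normal_distribution {..0}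
        = (\<integral>\<^sup>+x. ennreal (std_normal_density x) * indicator {..0} x \<partial>lborel)"
      by (subst emeasure_density) auto
    also have "\<dots> = (\<integral>\<^sup>+x. ennreal (std_normal_density (- x)) * indicator {..0} (- x) \<partial>lborel)"
      using nn_integral_real_affine[of "\<lambda>x. ennreal (std_normal_density x) * indicator {..0} x" "-1" 0] by simp
    also have "\<dots> = (\<integral>\<^sup>+x. ennreal (std_normal_density x) * indicator {0..} x \<partial>lborel)"
      by (intro nn_integral_cong) (auto simp: std_normal_density_def indicator_def)
    also have "\<dots> = emeasure std_normal_distribution {0..}"
      by (subst emeasure_density) auto
    finally show ?thesis .
  qed
  have "measure std_normal_distribution {..0} = measure std_normal_distribution {0..}"
    using eq by (simp add: measure_def)
  moreover have "measure std_normal_distribution {0<..} \<le> 1 - cdf std_normal_distribution 0"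
    using std_normal.prob_compl[of "{..0}"] by (simp add: cdf_def Compl_eq_Diff_UNIV[symmetric])
  moreover have "measure std_normal_distribution {0..} = measure std_normal_distribution {0<..}"
  proof -
    have "emeasure std_normal_distribution {0} = 0"
      by (subst emeasure_density) (auto intro!: nn_integral_zero' AE_I[where N="{0}"] simp: indicator_def)
    then have "measure std_normal_distribution {0} = 0" by (simp add: measure_def)
    moreover have "{0::real..} = insert 0 {0<..}" by auto
    ultimately show ?thesis
      using std_normal.finite_measure_Union[of "{0}" "{0<..}"]
      by simp
  qed
  ultimately show ?thesis by (simp add: cdf_def)
qed

section \<open>Asymptotic bounds for tail combinations and for pairs of means\<close>

context iid_sample
begin

text \<open>A scale s above the norm only raises the threshold, because x is nonnegative. The
  freedom in s admits functions whose norm is tiny or 0, as happens when gradients cancel in a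
  combination.\<close>

lemma scaled_mean_cdf_bound:
  assumes f: "square_integrable P f" and mean: "(\<integral>z. f z \<partial>P) = 0"
    and s: "l2_norm P f \<le> s" "0 < s" and x: "0 \<le> x" and e: "0 < e"
  shows "\<forall>\<^sub>F n in sequentially.
    cdf std_normal_distribution x - e \<le> measure W {w \<in> space W. scaled_mean f n w \<le> s * x}"
proof (cases "l2_norm P f = 0")
  case True
  note [measurable] = square_integrableD(1)[OF f]
  have "(\<integral>z. (f z)\<^sup>2 \<partial>P) = 0" using True l2_norm_power2[of P f] by simp
  then have "AE z in P. f z = 0"
    using integral_nonneg_eq_0_iff_AE[OF square_integrableD(2)[OF f]] by simp
  then have "AE w in W. scaled_mean f n w \<le> s * x" for n
    using AE_scaled_mean_eq_0[of f n] s x by auto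
  then have "measure W {w \<in> space W. scaled_mean f n w \<le> s * x} = 1" for n
    by (subst W.prob_Collect_eq_1) auto
  moreover have "cdf std_normal_distribution x \<le> 1"
    by (simp add: cdf_def)
  ultimately show ?thesis using e by simp
next
  case False
  then have pos: "0 < l2_norm P f" using l2_norm_nonneg[of P f] by linarith
  note [measurable] = square_integrableD(1)[OF f]
  define y where "y = s * x / l2_norm P f"
  have "x * l2_norm P f \<le> s * x" using mult_right_mono[OF s(1) x] by (simp add: mult.commute)
  then have xy: "x \<le> y" using pos by (simp add: y_def field_simps)
  have "(\<lambda>n. cdf (distr W borel (\<lambda>w. scaled_mean f n w / l2_norm P f)) y)
      \<longlonglongrightarrow> cdf std_normal_distribution y"
    using scaled_mean_weak_conv[OF f mean pos] std_normal_isCont_cdf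
    unfolding weak_conv_m_def weak_conv_def by blast
  moreover have "cdf (distr W borel (\<lambda>w. scaled_mean f n w / l2_norm P f)) y
      = measure W {w \<in> space W. scaled_mean f n w \<le> s * x}" for n
    unfolding cdf_def using pos
    by (subst measure_distr) (auto intro!: arg_cong[where f="measure W"] simp: y_def field_simps)
  ultimately have "(\<lambda>n. measure W {w \<in> space W. scaled_mean f n w \<le> s * x})
      \<longlonglongrightarrow> cdf std_normal_distribution y" by simp
  then have "\<forall>\<^sub>F n in sequentially.
      cdf std_normal_distribution y - e < measure W {w \<in> space W. scaled_mean f n w \<le> s * x}"
    using e by (intro order_tendstoD(1)) auto
  moreover have "cdf std_normal_distribution x \<le> cdf std_normal_distribution y"
    by (rule finite_borel_measure.cdf_nondecreasing[OF std_normal.finite_borel_measure_M xy])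
  ultimately show ?thesis by (auto elim!: eventually_mono)
qed

text \<open>The central limit theorem is applied to a single nearly minimal combination. Every tail
  contains a combination close to it in L2, and Chebyshev's inequality transfers the bound at the
  same n. The quantifier over m stands inside the eventuality because the tail will be chosen after
  n.\<close>

lemma tail_combination_coverage:
  fixes h :: "nat \<Rightarrow> 'z \<Rightarrow> real"
  assumes h: "\<And>j. square_integrable P (h j)" and mean: "\<And>j. (\<integral>z. h j z \<partial>P) = 0"
    and \<kappa>: "0 < k0" "\<And>j. k0 \<le> l2_norm P (h j)" "\<And>j. l2_norm P (h j) \<le> K"
    and x: "0 \<le> x" "x < z" and e: "0 < e"
  defines "\<delta> \<equiv> k0 * (z - x) / 4"
  shows "\<forall>\<^sub>F n in sequentially. \<forall>m. \<exists>c\<in>tail_weights m. \<exists>B\<in>sets W.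
    cdf std_normal_distribution x - e \<le> measure W B \<and>
    (\<forall>w\<in>B. (\<Sum>j | c j \<noteq> 0. c j * (scaled_mean (h j) n w - z * l2_norm P (h j))) \<le> - \<delta>)"
proof -
  have \<delta>: "0 < \<delta>" "4 * \<delta> = k0 * (z - x)" using \<kappa> x by (auto simp: \<delta>_def)
  have z: "0 < z" using x by simp
  \<comment> \<open>The first entry keeps the Chebyshev bound \<epsilon>^2/\<delta>^2 below e/2; the
    second keeps the loss \<epsilon> z in the standard deviation below \<delta>. The gap s (z - x)
    is at least 4 \<delta>, so it pays for this loss and for a fluctuation \<delta> and still leaves
    the required margin.\<close>
  define \<epsilon> where "\<epsilon> = min (\<delta> * sqrt (e / 2)) (\<delta> / z)"
  have \<epsilon>: "0 < \<epsilon>" using \<delta> z e by (auto simp: \<epsilon>_def)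
  have "\<epsilon> \<le> \<delta> * sqrt (e / 2)" by (simp add: \<epsilon>_def)
  then have "\<epsilon>\<^sup>2 \<le> (\<delta> * sqrt (e / 2))\<^sup>2" using \<epsilon> by (intro power_mono) auto
  then have \<epsilon>1: "\<epsilon>\<^sup>2 / \<delta>\<^sup>2 \<le> e / 2" using \<delta> e by (simp add: power_mult_distrib field_simps)
  have "\<epsilon> \<le> \<delta> / z" by (simp add: \<epsilon>_def)
  then have \<epsilon>2: "\<epsilon> * z \<le> \<delta>" using z by (simp add: field_simps)
  define comb where "comb c z = (\<Sum>j | c j \<noteq> 0. c j * h j z)" for c z
  have sq: "square_integrable P (comb c)" for c
    unfolding comb_def[abs_def] by (intro square_integrable_sum square_integrable_cmult h)
  have mean_comb: "(\<integral>z. comb c z \<partial>P) = 0" for c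
    unfolding comb_def using P.square_integrable_integrable[OF h] mean
    by (subst Bochner_Integration.integral_sum) auto
  obtain c0 k where c0: "c0 \<in> tail_weights k" "\<And>m. k \<le> m \<Longrightarrow> \<exists>c'\<in>tail_weights m.
      l2_norm P (\<lambda>z. comb c' z - comb c0 z) \<le> \<epsilon>"
    unfolding comb_def by (rule nearly_Cauchy_tail_combinations[where h=h, OF h \<kappa>(3) \<epsilon>]) blast
  define g where "g = comb c0"
  \<comment> \<open>Cancellation can make the norm of the combined gradient small, while the
    weighted sum of the norms stays above \<open>k0\<close>. The maximum is a scale which that sum
    reaches up to \<epsilon> and which is bounded away from 0.\<close>
  define s where "s = max k0 (l2_norm P g)"
  have s: "l2_norm P g \<le> s" "0 < s" "k0 \<le> s" using \<kappa> by (auto simp: s_def)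
  have gsq: "square_integrable P g" unfolding g_def by (rule sq)
  note [measurable] = square_integrableD(1)[OF gsq] square_integrableD(1)[OF sq]
  have "\<forall>\<^sub>F n in sequentially. cdf std_normal_distribution x - e / 2
      \<le> measure W {w \<in> space W. scaled_mean g n w \<le> s * x}"
    using e x s mean_comb[of c0] by (intro scaled_mean_cdf_bound gsq) (auto simp: g_def)
  then show ?thesis
    using eventually_gt_at_top[of 0]
  proof eventually_elim
    case (elim n)
    show ?case
    proof
      fix m
      obtain c' where c': "c' \<in> tail_weights (max m k)" "l2_norm P (\<lambda>z. comb c' z - g z) \<le> \<epsilon>"
        using c0(2)[of "max m k"] by (auto simp: g_def)
      have c'm: "c' \<in> tail_weights m" using c'(1) by (auto simp: tail_weights_def)
      obtain l where l: "\<And>j. 0 \<le> c' j" "\<forall>j\<ge>l. c' j = 0" "(\<Sum>j<l. c' j) = 1"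
        by (rule tail_weightsE[OF c'(1)]) blast
      define d where "d = (\<lambda>z. comb c' z - g z)"
      have dsq: "square_integrable P d" unfolding d_def by (intro square_integrable_diff sq gsq)
      note [measurable] = square_integrableD(1)[OF dsq]
      have dmean: "(\<integral>z. d z \<partial>P) = 0"
        unfolding d_def g_def using mean_comb P.square_integrable_integrable[OF sq] by simp
      define A where "A = {w \<in> space W. scaled_mean g n w \<le> s * x}"
      define C where "C = {w \<in> space W. \<delta> \<le> \<bar>scaled_mean d n w\<bar>}"
      have [measurable]: "A \<in> sets W" "C \<in> sets W" unfolding A_def C_def by measurable
      have "measure W C \<le> (l2_norm P d)\<^sup>2 / \<delta>\<^sup>2"
        unfolding C_def using elim \<delta> by (intro scaled_mean_Chebyshev dsq dmean) auto
      also have "\<dots> \<le> \<epsilon>\<^sup>2 / \<delta>\<^sup>2"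
        using c'(2) by (intro divide_right_mono power_mono) (auto simp: d_def)
      also have "\<dots> \<le> e / 2" by (rule \<epsilon>1)
      finally have C: "measure W C \<le> e / 2" .
      have "measure W A \<le> measure W ((A - C) \<union> C)"
        by (intro W.finite_measure_mono) auto
      also have "\<dots> \<le> measure W (A - C) + measure W C"
        by (intro measure_Un_le) auto
      finally have AC: "cdf std_normal_distribution x - e \<le> measure W (A - C)"
        using elim C unfolding A_def[symmetric] by linarith
      have k_ge: "s - \<epsilon> \<le> (\<Sum>j | c' j \<noteq> 0. c' j * l2_norm P (h j))"
      proof -
        have "(\<Sum>j<l. c' j * k0) \<le> (\<Sum>j<l. c' j * l2_norm P (h j))"
          using \<kappa> l by (intro sum_mono mult_left_mono) auto
        then have "k0 \<le> (\<Sum>j | c' j \<noteq> 0. c' j * l2_norm P (h j))"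
          unfolding sum_nonzero_weights[OF l(2)] using l(3) by (simp add: sum_distrib_right[symmetric])
        moreover have "l2_norm P (comb c') \<le> (\<Sum>j | c' j \<noteq> 0. \<bar>c' j\<bar> * l2_norm P (h j))"
          unfolding comb_def[abs_def] by (intro l2_norm_sum_le h)
        moreover have "l2_norm P g - \<epsilon> \<le> l2_norm P (comb c')"
          using l2_norm_triangle_diff[OF sq[of c'] gsq] c'(2) by linarith
        ultimately show ?thesis using l(1) \<epsilon> by (auto simp: s_def max_def)
      qed
      have "(\<Sum>j | c' j \<noteq> 0. c' j * (scaled_mean (h j) n w - z * l2_norm P (h j))) \<le> - \<delta>"
        if w: "w \<in> A - C" for w
      proof -
        have "(\<Sum>j | c' j \<noteq> 0. c' j * (scaled_mean (h j) n w - z * l2_norm P (h j)))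
            = (\<Sum>j | c' j \<noteq> 0. c' j * scaled_mean (h j) n w)
              - z * (\<Sum>j | c' j \<noteq> 0. c' j * l2_norm P (h j))"
          by (simp add: algebra_simps sum_subtractf sum_distrib_left)
        also have "(\<Sum>j | c' j \<noteq> 0. c' j * scaled_mean (h j) n w) = scaled_mean (comb c') n w"
          unfolding comb_def[abs_def] scaled_mean_sum ..
        also have "scaled_mean (comb c') n w = scaled_mean g n w + scaled_mean d n w"
          unfolding d_def scaled_mean_diff by simp
        also have "\<dots> - z * (\<Sum>j | c' j \<noteq> 0. c' j * l2_norm P (h j)) \<le> s * x + \<delta> - z * (s - \<epsilon>)"
        proof -
          have "z * (s - \<epsilon>) \<le> z * (\<Sum>j | c' j \<noteq> 0. c' j * l2_norm P (h j))"
            using k_ge z by (intro mult_left_mono) auto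
          moreover have "scaled_mean g n w \<le> s * x" "scaled_mean d n w \<le> \<delta>"
            using w by (auto simp: A_def C_def)
          ultimately show ?thesis by linarith
        qed
        also have "\<dots> = - (s * (z - x)) + \<delta> + \<epsilon> * z" by (simp add: algebra_simps)
        also have "\<dots> \<le> - \<delta>"
        proof -
          have "k0 * (z - x) \<le> s * (z - x)" using s x by (intro mult_right_mono) auto
          then show ?thesis using \<epsilon>2 \<delta> by linarith
        qed
        finally show ?thesis .
      qed
      then show "\<exists>c\<in>tail_weights m. \<exists>B\<in>sets W. cdf std_normal_distribution x - e \<le> measure W B \<and>
        (\<forall>w\<in>B. (\<Sum>j | c j \<noteq> 0. c j * (scaled_mean (h j) n w - z * l2_norm P (h j))) \<le> - \<delta>)"
        using c'm AC by (intro bexI[of _ c'] bexI[of _ "A - C"]) auto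
    qed
  qed
qed

text \<open>A continuous ramp, 1 up to u and 0 beyond t, is squeezed between the two indicators, so
  convergence for continuous functions is enough. The sign changes between the two events because a
  centered Gaussian limit is symmetric: a bound on X from above corresponds to a bound on the scaled
  mean from below.\<close>

lemma joint_lower_bound:
  fixes X Y :: "'v \<Rightarrow> real"
  assumes f: "square_integrable P f" "(\<integral>z. f z \<partial>P) = 0"
    and g: "square_integrable P g" "(\<integral>z. g z \<partial>P) = 0"
    and N: "prob_space N" and [measurable]: "X \<in> borel_measurable N" "Y \<in> borel_measurable N"
    and char: "\<And>a b. (\<integral>v. iexp (a * X v + b * Y v) \<partial>N)
      = exp (- (l2_norm P (\<lambda>z. a * f z + b * g z))\<^sup>2 / 2)"
    and ut: "u < t" and e: "0 < e"
  shows "\<forall>\<^sub>F n in sequentially. measure N {v \<in> space N. X v \<le> u \<and> Y v \<le> u} - e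
    \<le> measure W {w \<in> space W. - t \<le> scaled_mean f n w \<and> - t \<le> scaled_mean g n w}"
proof -
  interpret N: prob_space N by fact
  note [measurable] = square_integrableD(1)[OF f(1)] square_integrableD(1)[OF g(1)]
  define \<phi> where "\<phi> x = max 0 (min 1 ((t - x) / (t - u)))" for x
  have \<phi>: "isCont \<phi> x" "0 \<le> \<phi> x" "\<phi> x \<le> 1" for x
    unfolding \<phi>_def using ut by (auto intro!: continuous_intros)
  have \<phi>1: "\<phi> x = 1" if "x \<le> u" for x using that ut by (simp add: \<phi>_def)
  have \<phi>0: "\<phi> x = 0" if "t < x" for x using that ut by (simp add: \<phi>_def divide_nonpos_pos)
  have [measurable]: "\<phi> \<in> borel_measurable borel"
    using \<phi>(1) by (intro borel_measurable_continuous_onI continuous_at_imp_continuous_on) auto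
  have "(\<lambda>n. \<integral>w. \<phi> (- scaled_mean f n w) * \<phi> (- scaled_mean g n w) \<partial>W)
      \<longlonglongrightarrow> (\<integral>v. \<phi> (X v) * \<phi> (Y v) \<partial>N)"
  proof (rule joint_levy_continuity[OF W.prob_space_axioms N _ _ _ _ _ \<phi> \<phi>])
    fix a b
    have sq: "square_integrable P (\<lambda>z. - (a * f z + b * g z))"
      by (intro square_integrable_uminus square_integrable_add square_integrable_cmult f g)
    have "(\<integral>z. - (a * f z + b * g z) \<partial>P) = 0"
      using f g P.square_integrable_integrable[OF f(1)] P.square_integrable_integrable[OF g(1)] by simp
    from scaled_mean_char_limit[OF sq this]
    show "(\<lambda>n. \<integral>w. iexp (a * - scaled_mean f n w + b * - scaled_mean g n w) \<partial>W)
        \<longlonglongrightarrow> (\<integral>v. iexp (a * X v + b * Y v) \<partial>N)"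
      unfolding char l2_norm_uminus scaled_mean_uminus scaled_mean_add scaled_mean_cmult by simp
  qed measurable
  then have "\<forall>\<^sub>F n in sequentially. (\<integral>v. \<phi> (X v) * \<phi> (Y v) \<partial>N) - e
      < (\<integral>w. \<phi> (- scaled_mean f n w) * \<phi> (- scaled_mean g n w) \<partial>W)"
    using e by (intro order_tendstoD(1)) auto
  then show ?thesis
  proof eventually_elim
    case (elim n)
    have "(\<integral>w. \<phi> (- scaled_mean f n w) * \<phi> (- scaled_mean g n w) \<partial>W)
        \<le> (\<integral>w. indicator {w \<in> space W. - t \<le> scaled_mean f n w \<and> - t \<le> scaled_mean g n w} w \<partial>W)"
    proof (rule integral_mono)
      show "integrable W (\<lambda>w. \<phi> (- scaled_mean f n w) * \<phi> (- scaled_mean g n w))"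
        using \<phi> by (intro W.integrable_const_bound[of _ 1]) (auto simp: abs_mult mult_le_one)
      fix w assume "w \<in> space W"
      then show "\<phi> (- scaled_mean f n w) * \<phi> (- scaled_mean g n w)
          \<le> indicator {w \<in> space W. - t \<le> scaled_mean f n w \<and> - t \<le> scaled_mean g n w} w"
        using \<phi>(2,3)[of "- scaled_mean f n w"] \<phi>(2,3)[of "- scaled_mean g n w"]
          \<phi>0[of "- scaled_mean f n w"] \<phi>0[of "- scaled_mean g n w"]
        by (auto simp: indicator_def mult_le_one not_le)
    qed (rule integrable_real_indicator; simp add: W.emeasure_eq_measure)
    also have "\<dots> = measure W {w \<in> space W. - t \<le> scaled_mean f n w \<and> - t \<le> scaled_mean g n w}"
      by simp
    finally have 1: "(\<integral>w. \<phi> (- scaled_mean f n w) * \<phi> (- scaled_mean g n w) \<partial>W)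
      \<le> measure W {w \<in> space W. - t \<le> scaled_mean f n w \<and> - t \<le> scaled_mean g n w}" .
    have "measure N {v \<in> space N. X v \<le> u \<and> Y v \<le> u}
        = (\<integral>v. indicator {v \<in> space N. X v \<le> u \<and> Y v \<le> u} v \<partial>N)"
      by simp
    also have "\<dots> \<le> (\<integral>v. \<phi> (X v) * \<phi> (Y v) \<partial>N)"
    proof (rule integral_mono)
      show "integrable N (\<lambda>v. \<phi> (X v) * \<phi> (Y v))"
        using \<phi> by (intro N.integrable_const_bound[of _ 1]) (auto simp: abs_mult mult_le_one)
      show "indicator {v \<in> space N. X v \<le> u \<and> Y v \<le> u} v \<le> \<phi> (X v) * \<phi> (Y v)" for v
        using \<phi>(2) \<phi>1 by (auto simp: indicator_def)
    qed (rule integrable_real_indicator; simp add: N.emeasure_eq_measure)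
    finally show ?case using 1 elim by linarith
  qed
qed

end

section \<open>Gaussian processes\<close>

lemma gaussian_rv_char:
  assumes N: "prob_space N" and [measurable]: "X \<in> borel_measurable N"
    and g: "gaussian_rv N X" and mean: "(\<integral>v. X v \<partial>N) = 0"
  shows "(\<integral>v. iexp (X v) \<partial>N) = exp (- (\<integral>v. (X v)\<^sup>2 \<partial>N) / 2)"
proof -
  interpret prob_space N by fact
  consider m where "AE v in N. X v = m"
    | m s where "0 < s" "distributed N lborel X (\<lambda>x. ennreal (normal_density m s x))"
    using g unfolding gaussian_rv_def by blast
  then show ?thesis
  proof cases
    case 1
    have "(\<integral>v. X v \<partial>N) = (\<integral>v. m \<partial>N)" using 1 by (intro integral_cong_AE) auto
    then have "m = 0" using mean by (simp add: prob_space)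
    then have "(\<integral>v. iexp (X v) \<partial>N) = (\<integral>v. 1 \<partial>N)" "(\<integral>v. (X v)\<^sup>2 \<partial>N) = (\<integral>v. 0 \<partial>N)"
      using 1 by (intro integral_cong_AE; auto)+
    then show ?thesis by (simp add: prob_space)
  next
    case 2
    have m: "m = 0" using normal_distributed_expectation[OF 2] mean by simp
    have v: "(\<integral>v. (X v)\<^sup>2 \<partial>N) = s\<^sup>2" using normal_distributed_variance[OF 2] mean by simp
    have D: "distributed N lborel (\<lambda>v. X v / s) std_normal_density"
      using normal_standard_normal_convert[OF 2(1), of X m] 2(2) m by simp
    have "distr N borel (\<lambda>v. X v / s) = distr N lborel (\<lambda>v. X v / s)" by (rule distr_cong) auto
    also have "\<dots> = std_normal_distribution" using distributed_distr_eq_density[OF D] by simp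
    finally have "char (distr N borel (\<lambda>v. X v / s)) s = exp (- s\<^sup>2 / 2)"
      by (simp add: char_std_normal_distribution)
    moreover have "char (distr N borel (\<lambda>v. X v / s)) s = (\<integral>v. iexp (X v) \<partial>N)"
      unfolding char_def using 2(1) by (subst integral_distr) auto
    ultimately show ?thesis using v by simp
  qed
qed

text \<open>The covariance identity also yields square integrability of \<open>G f\<close>, because the integral of a
  non-integrable function is \<open>0\<close>.\<close>

lemma gaussian_process_pair_char:
  fixes f g :: "'z \<Rightarrow> real"
  assumes G: "gaussian_process N F G" and fg: "f \<in> F" "g \<in> F"
    and mean: "\<And>f. f \<in> F \<Longrightarrow> (\<integral>v. G f v \<partial>N) = 0"
    and cov: "\<And>f g. f \<in> F \<Longrightarrow> g \<in> F \<Longrightarrow> (\<integral>v. G f v * G g v \<partial>N) = (\<integral>z. f z * g z \<partial>P)"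
    and sq: "square_integrable P f" "square_integrable P g"
    and nz: "l2_norm P f \<noteq> 0" "l2_norm P g \<noteq> 0"
  shows "(\<integral>v. iexp (a * G f v + b * G g v) \<partial>N)
    = exp (- (l2_norm P (\<lambda>z. a * f z + b * g z))\<^sup>2 / 2)"
proof -
  interpret prob_space N using G by (simp add: gaussian_process_def)
  have [measurable]: "G f \<in> borel_measurable N" "G g \<in> borel_measurable N"
    using G fg by (auto simp: gaussian_process_def)
  have Gsq: "square_integrable N (G k)" if "k \<in> F" "l2_norm P k \<noteq> 0" for k
  proof -
    have "(\<integral>v. G k v * G k v \<partial>N) \<noteq> 0"
      using cov[OF that(1,1)] that(2) by (simp add: l2_norm_def power2_eq_square)
    then have "integrable N (\<lambda>v. G k v * G k v)" using not_integrable_integral_eq by blast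
    then show ?thesis using G that by (simp add: square_integrable_def gaussian_process_def power2_eq_square)
  qed
  note Gf = Gsq[OF fg(1) nz(1)] and Gg = Gsq[OF fg(2) nz(2)]
  have "gaussian_rv N (\<lambda>v. a * G f v + b * G g v)"
  \<comment> \<open>If f = g, the index set {f, g} collapses to one element, whose coefficient has
    to be a + b.\<close>
  proof (cases "f = g")
    case True
    have "gaussian_rv N (\<lambda>v. \<Sum>j\<in>{f}. (a + b) * G j v)"
      using G fg unfolding gaussian_process_def by (elim conjE allE[of _ "{f}"] allE[of _ "\<lambda>_. a + b"]) auto
    then show ?thesis using True by (simp add: distrib_right)
  next
    case False
    have "gaussian_rv N (\<lambda>v. \<Sum>j\<in>{f, g}. (if j = f then a else b) * G j v)"
      using G fg unfolding gaussian_process_def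
      by (elim conjE allE[of _ "{f, g}"] allE[of _ "\<lambda>j. if j = f then a else b"]) auto
    then show ?thesis using False by simp
  qed
  then have "(\<integral>v. iexp (a * G f v + b * G g v) \<partial>N) = exp (- (\<integral>v. (a * G f v + b * G g v)\<^sup>2 \<partial>N) / 2)"
    using mean fg square_integrable_integrable[OF Gf] square_integrable_integrable[OF Gg]
    by (intro gaussian_rv_char prob_space_axioms) auto
  moreover have quad: "(\<integral>v. (a * p v + b * q v)\<^sup>2 \<partial>M)
      = a\<^sup>2 * (\<integral>v. p v * p v \<partial>M) + 2 * a * b * (\<integral>v. p v * q v \<partial>M) + b\<^sup>2 * (\<integral>v. q v * q v \<partial>M)"
    if "square_integrable M p" "square_integrable M q" for M :: "'m measure" and p q
  proof -
    have "(\<integral>v. (a * p v + b * q v)\<^sup>2 \<partial>M)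
        = (\<integral>v. a\<^sup>2 * (p v * p v) + 2 * a * b * (p v * q v) + b\<^sup>2 * (q v * q v) \<partial>M)"
      by (simp add: power2_eq_square algebra_simps)
    also have "\<dots> = a\<^sup>2 * (\<integral>v. p v * p v \<partial>M) + 2 * a * b * (\<integral>v. p v * q v \<partial>M) + b\<^sup>2 * (\<integral>v. q v * q v \<partial>M)"
      using square_integrable_mult_integrable[OF that(1,1)] square_integrable_mult_integrable[OF that]
        square_integrable_mult_integrable[OF that(2,2)] by simp
    finally show ?thesis .
  qed
  have "(\<integral>v. (a * G f v + b * G g v)\<^sup>2 \<partial>N) = (l2_norm P (\<lambda>z. a * f z + b * g z))\<^sup>2"
    unfolding l2_norm_power2 quad[OF Gf Gg] quad[OF sq] using cov fg by simp
  ultimately show ?thesis by simp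
qed

section \<open>Compactness of the policy class\<close>

locale policy_class =
  fixes MX :: "'x measure" and MY :: "'y measure"
    and P :: "('x \<times> bool \<times> 'y) measure" and Pols :: "('x \<Rightarrow> bool) set"
  assumes prob: "prob_space P" and sets_P: "sets P = sets (obs_space MX MY)"
    and policies: "Pols \<subseteq> measurable MX (count_space UNIV)"
begin

sublocale prob_space P by (rule prob)

lemma space_P: "space P = space (obs_space MX MY)"
  by (rule sets_eq_imp_space_eq[OF sets_P])

lemma fst_in_space: "z \<in> space P \<Longrightarrow> fst z \<in> space MX"
  by (auto simp: space_P space_pair_measure)

lemma measurable_fst_P [measurable]: "fst \<in> measurable P MX"
  by (simp add: measurable_cong_sets[OF sets_P refl])

lemma measurable_policy_fst:
  assumes "\<pi> \<in> measurable MX (count_space UNIV)"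
  shows "(\<lambda>z. \<pi> (fst z)) \<in> measurable P (count_space UNIV)"
  by (rule measurable_compose[OF measurable_fst_P assms])

lemma sets_disagree:
  fixes \<pi> \<pi>' :: "'x \<Rightarrow> bool"
  assumes "\<pi> \<in> measurable MX (count_space UNIV)" "\<pi>' \<in> measurable MX (count_space UNIV)"
  shows "{z \<in> space P. \<pi> (fst z) \<noteq> \<pi>' (fst z)} \<in> sets P"
proof -
  define A where "A \<pi> = (\<lambda>z. \<pi> (fst z)) -` {True} \<inter> space P" for \<pi> :: "'x \<Rightarrow> bool"
  have "A \<pi> \<in> sets P" "A \<pi>' \<in> sets P"
    unfolding A_def by (intro measurable_sets[OF measurable_policy_fst] assms; simp)+
  moreover have "{z \<in> space P. \<pi> (fst z) \<noteq> \<pi>' (fst z)} = (A \<pi> - A \<pi>') \<union> (A \<pi>' - A \<pi>)"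
    by (auto simp: A_def)
  ultimately show ?thesis by auto
qed

lemma policy_dist_power2:
  assumes "\<pi> \<in> measurable MX (count_space UNIV)" "\<pi>' \<in> measurable MX (count_space UNIV)"
  shows "(policy_dist P \<pi> \<pi>')\<^sup>2 = measure P {z \<in> space P. \<pi> (fst z) \<noteq> \<pi>' (fst z)}"
proof -
  have "(policy_dist P \<pi> \<pi>')\<^sup>2 = (\<integral>z. (of_bool (\<pi> (fst z)) - of_bool (\<pi>' (fst z)))\<^sup>2 \<partial>P)"
    unfolding policy_dist_def by (rule l2_norm_power2)
  also have "\<dots> = (\<integral>z. indicator {z \<in> space P. \<pi> (fst z) \<noteq> \<pi>' (fst z)} z \<partial>P)"
    by (rule Bochner_Integration.integral_cong) (auto simp: indicator_def)
  also have "\<dots> = measure P {z \<in> space P. \<pi> (fst z) \<noteq> \<pi>' (fst z)}"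
    using sets_disagree[OF assms] by simp
  finally show ?thesis .
qed

lemma square_integrable_policy:
  assumes "\<pi> \<in> measurable MX (count_space UNIV)"
  shows "square_integrable P (\<lambda>z. of_bool (\<pi> (fst z)))"
proof -
  note [measurable] = measurable_policy_fst[OF assms]
  show ?thesis
    unfolding square_integrable_def by (auto intro!: integrable_const_bound[of _ 1])
qed

lemma policy_dist_triangle:
  assumes "\<pi>1 \<in> measurable MX (count_space UNIV)" "\<pi>2 \<in> measurable MX (count_space UNIV)"
    "\<pi>3 \<in> measurable MX (count_space UNIV)"
  shows "policy_dist P \<pi>1 \<pi>3 \<le> policy_dist P \<pi>1 \<pi>2 + policy_dist P \<pi>2 \<pi>3"
  unfolding policy_dist_def
  using l2_norm_triangle[OF square_integrable_diff square_integrable_diff,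
      OF square_integrable_policy square_integrable_policy square_integrable_policy square_integrable_policy,
      OF assms(1,2,2,3)]
  by simp

lemma policy_dist_commute: "policy_dist P \<pi> \<pi>' = policy_dist P \<pi>' \<pi>"
  unfolding policy_dist_def by (rule l2_norm_minus_commute)

lemma policy_dist_same: "policy_dist P \<pi> \<pi> = 0"
  by (simp add: policy_dist_def l2_norm_def)

text \<open>\<open>Q\<close> is the image of the law of \<open>X\<close> under a map that sends each cell of the finite partition
  generated by \<open>S\<close> to one of its points.\<close>

lemma finitely_supported_isometry:
  assumes S: "finite S" "S \<subseteq> measurable MX (count_space UNIV)"
  obtains Q where "finite (set_pmf Q)" "set_pmf Q \<subseteq> space MX"
    "\<And>\<pi> \<pi>'. \<pi> \<in> S \<Longrightarrow> \<pi>' \<in> S \<Longrightarrow>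
      l2_norm (measure_pmf Q) (\<lambda>x. of_bool (\<pi> x) - of_bool (\<pi>' x)) = policy_dist P \<pi> \<pi>'"
proof -
  define cell where "cell x = {\<pi> \<in> S. \<pi> x}" for x
  \<comment> \<open>The choice sees x only through its cell, so r is constant on each cell and takes
    finitely many values.\<close>
  define r where "r x = (SOME y. y \<in> space MX \<and> cell y = cell x)" for x
  have r: "r x \<in> space MX" "cell (r x) = cell x" if "x \<in> space MX" for x
    using someI[of "\<lambda>y. y \<in> space MX \<and> cell y = cell x" x] that by (auto simp: r_def)
  have fin: "finite (r ` space MX)"
  proof -
    have "cell x \<in> Pow S" for x by (simp add: cell_def)
    then have "r ` space MX \<subseteq> (\<lambda>c. SOME y. y \<in> space MX \<and> cell y = c) ` Pow S"
      unfolding r_def by blast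
    moreover have "finite ((\<lambda>c. SOME y. y \<in> space MX \<and> cell y = c) ` Pow S)" using S(1) by simp
    ultimately show ?thesis by (rule finite_subset)
  qed
  have cell_sets: "{x \<in> space MX. cell x = c} \<in> sets MX" for c
  proof (cases "c \<subseteq> S")
    case True
    have "{x \<in> space MX. cell x = c} = {x \<in> space MX. \<forall>\<pi>\<in>S. \<pi> x \<longleftrightarrow> \<pi> \<in> c}"
    proof -
      have "cell x = c \<longleftrightarrow> (\<forall>\<pi>\<in>S. \<pi> x \<longleftrightarrow> \<pi> \<in> c)" for x
      proof
        assume "cell x = c"
        then show "\<forall>\<pi>\<in>S. \<pi> x \<longleftrightarrow> \<pi> \<in> c" unfolding cell_def by blast
      next
        assume h: "\<forall>\<pi>\<in>S. \<pi> x \<longleftrightarrow> \<pi> \<in> c"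
        show "cell x = c"
          unfolding cell_def using True h by (intro equalityI subsetI) (auto dest: subsetD)
      qed
      then show ?thesis by simp
    qed
    also have "\<dots> \<in> sets MX"
    proof (rule sets.sets_Collect_finite_All[OF _ S(1)])
      fix \<pi> assume "\<pi> \<in> S"
      then have "\<pi> -` {\<pi> \<in> c} \<inter> space MX \<in> sets MX"
        using S(2) by (intro measurable_sets) auto
      moreover have "\<pi> -` {\<pi> \<in> c} \<inter> space MX = {x \<in> space MX. \<pi> x \<longleftrightarrow> \<pi> \<in> c}" by auto
      ultimately show "{x \<in> space MX. \<pi> x \<longleftrightarrow> \<pi> \<in> c} \<in> sets MX" by simp
    qed
    finally show ?thesis .
  next
    case False
    then have "{x \<in> space MX. cell x = c} = {}" by (auto simp: cell_def)
    then show ?thesis by (metis sets.empty_sets)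
  qed
  have r_meas: "r \<in> measurable MX (count_space UNIV)"
  proof (rule measurableI)
    fix A :: "'x set"
    have "r -` A \<inter> space MX = (\<Union>c\<in>{c\<in>Pow S. (SOME y. y \<in> space MX \<and> cell y = c) \<in> A}. {x \<in> space MX. cell x = c})"
    proof -
      have "cell x \<in> Pow S" for x by (simp add: cell_def)
      then show ?thesis unfolding r_def by blast
    qed
    also have "\<dots> \<in> sets MX" using S(1) cell_sets by (intro sets.finite_UN) auto
    finally show "r -` A \<inter> space MX \<in> sets MX" .
  qed simp
  have rP: "(\<lambda>z. r (fst z)) \<in> measurable P (count_space UNIV)"
    by (rule measurable_compose[OF measurable_fst_P r_meas])
  define D where "D = distr P (count_space UNIV) (\<lambda>z. r (fst z))"
  have sets_D: "sets D = UNIV" by (simp add: D_def)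
  interpret D: prob_space D unfolding D_def by (rule prob_space_distr[OF rP])
  have D_null: "measure D {x} = 0" if "x \<notin> r ` space MX" for x
  proof -
    have "(\<lambda>z. r (fst z)) -` {x} \<inter> space P = {}"
      using that fst_in_space by auto
    then show ?thesis unfolding D_def by (subst measure_distr[OF rP]) auto
  qed
  \<comment> \<open>This is the condition in the type of probability mass functions that remains to
    be checked. It holds because D is concentrated on the finite range of r.\<close>
  have "AE x in D. measure D {x} \<noteq> 0"
  proof (rule AE_I')
    define A where "A = {x \<in> r ` space MX. measure D {x} = 0}"
    have "(\<Union>x\<in>A. {x}) \<in> null_sets D"
    proof (rule null_sets_UN')
      show "countable A" using fin by (intro countable_finite) (simp add: A_def)
      show "{x} \<in> null_sets D" if "x \<in> A" for x
        using that D.emeasure_eq_measure[of "{x}"] by (simp add: null_sets_def A_def sets_D)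
    qed
    then have "{x \<in> r ` space MX. measure D {x} = 0} \<in> null_sets D" by (simp add: A_def)
    moreover have "- (r ` space MX) \<in> null_sets D"
    proof -
      have "(\<lambda>z. r (fst z)) -` (- (r ` space MX)) \<inter> space P = {}"
        using fst_in_space by auto
      then have "emeasure D (- (r ` space MX)) = 0"
        unfolding D_def by (subst emeasure_distr[OF rP]) auto
      then show ?thesis by (simp add: null_sets_def sets_D)
    qed
    ultimately show "{x \<in> r ` space MX. measure D {x} = 0} \<union> - (r ` space MX) \<in> null_sets D"
      by (rule null_sets.Un)
  qed auto
  then have inv: "measure_pmf (Abs_pmf D) = D"
    by (intro Abs_pmf_inverse) (simp add: D.prob_space_axioms sets_D)
  show thesis
  proof (rule that[of "Abs_pmf D"])
    have sub: "set_pmf (Abs_pmf D) \<subseteq> r ` space MX"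
      using D_null by (auto simp: set_pmf_eq pmf.rep_eq inv)
    then show "finite (set_pmf (Abs_pmf D))" using fin by (rule finite_subset)
    show "set_pmf (Abs_pmf D) \<subseteq> space MX" using sub r(1) by auto
    fix \<pi> \<pi>' assume "\<pi> \<in> S" "\<pi>' \<in> S"
    then have eq: "\<pi> (r x) = \<pi> x" "\<pi>' (r x) = \<pi>' x" if "x \<in> space MX" for x
      using r(2)[OF that] by (auto simp: cell_def)
    have "(\<integral>x. (of_bool (\<pi> x) - of_bool (\<pi>' x))\<^sup>2 \<partial>D)
        = (\<integral>z. (of_bool (\<pi> (r (fst z))) - of_bool (\<pi>' (r (fst z))))\<^sup>2 \<partial>P :: real)"
      unfolding D_def by (subst integral_distr[OF rP]) auto
    also have "\<dots> = (\<integral>z. (of_bool (\<pi> (fst z)) - of_bool (\<pi>' (fst z)))\<^sup>2 \<partial>P)"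
      using eq fst_in_space by (intro Bochner_Integration.integral_cong) auto
    finally show "l2_norm (measure_pmf (Abs_pmf D)) (\<lambda>x. of_bool (\<pi> x) - of_bool (\<pi>' x)) = policy_dist P \<pi> \<pi>'"
      by (simp add: l2_norm_def policy_dist_def inv)
  qed
qed

section \<open>Covering numbers and total boundedness\<close>

lemma finite_pmf_square_integrable:
  fixes f :: "'q \<Rightarrow> real"
  shows "finite (set_pmf Q) \<Longrightarrow> square_integrable (measure_pmf Q) f"
  by (simp add: square_integrable_def integrable_measure_pmf_finite)

text \<open>On a finite support the indicators of its subsets represent every policy with error 0,
  so the set behind \<open>LEAST\<close> is nonempty and its least element is a true minimum rather
  than an arbitrary value.\<close>

lemma covering_number_attained:
  fixes Pols' :: "('q \<Rightarrow> bool) set"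
  assumes Q: "finite (set_pmf Q)" and e: "0 < e"
  obtains C where "finite C" "card C = covering_number Q e Pols'"
    "\<And>\<pi>. \<pi> \<in> Pols' \<Longrightarrow> \<exists>g\<in>C. l2_norm (measure_pmf Q) (\<lambda>x. of_bool (\<pi> x) - g x) < e"
proof -
  define C where "C = (\<lambda>T x. of_bool (x \<in> T) :: real) ` Pow (set_pmf Q)"
  have "finite C" using Q by (simp add: C_def)
  moreover have "\<exists>g\<in>C. l2_norm (measure_pmf Q) (\<lambda>x. of_bool (\<pi> x) - g x) < e" for \<pi>
  proof (rule bexI[of _ "\<lambda>x. of_bool (x \<in> {x \<in> set_pmf Q. \<pi> x})"])
    have "(\<integral>x. (of_bool (\<pi> x) - of_bool (x \<in> {x \<in> set_pmf Q. \<pi> x}))\<^sup>2 \<partial>measure_pmf Q)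
        = (\<integral>x. (0::real) \<partial>measure_pmf Q)"
      by (intro integral_cong_AE) (auto simp: AE_measure_pmf_iff)
    then show "l2_norm (measure_pmf Q) (\<lambda>x. of_bool (\<pi> x) - of_bool (x \<in> {x \<in> set_pmf Q. \<pi> x})) < e"
      using e by (simp add: l2_norm_def)
    show "(\<lambda>x. of_bool (x \<in> {x \<in> set_pmf Q. \<pi> x})) \<in> C" unfolding C_def by blast
  qed
  ultimately have "\<exists>m. \<exists>C :: ('q \<Rightarrow> real) set. finite C \<and> card C = m \<and>
      (\<forall>\<pi>\<in>Pols'. \<exists>g\<in>C. l2_norm (measure_pmf Q) (\<lambda>x. of_bool (\<pi> x) - g x) < e)"
    by blast
  from LeastI_ex[OF this] show thesis
    unfolding covering_number_def[symmetric] using that by blast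
qed

lemma covering_number_antimono:
  fixes Pols' :: "('q \<Rightarrow> bool) set"
  assumes Q: "finite (set_pmf Q)" and e: "0 < e" "e \<le> e'"
  shows "covering_number Q e' Pols' \<le> covering_number Q e Pols'"
proof -
  obtain C where C: "finite C" "card C = covering_number Q e Pols'"
    "\<And>\<pi>. \<pi> \<in> Pols' \<Longrightarrow> \<exists>g\<in>C. l2_norm (measure_pmf Q) (\<lambda>x. of_bool (\<pi> x) - g x) < e"
    by (rule covering_number_attained[OF Q e(1), of Pols']) blast
  have "\<forall>\<pi>\<in>Pols'. \<exists>g\<in>C. l2_norm (measure_pmf Q) (\<lambda>x. of_bool (\<pi> x) - g x) < e'"
    using C(3) e(2) by (meson less_le_trans)
  then show ?thesis
    unfolding covering_number_def[of Q e'] using C(1,2) by (intro Least_le exI[of _ C]) auto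
qed

text \<open>Covering numbers grow as the radius shrinks. If the supremum over Q were infinite at
  radius e, the integrand would be infinite on all of (0, e], and the entropy integral would
  diverge.\<close>

lemma covering_number_bounded:
  assumes entropy: "bounded_uniform_entropy_integral MX Pols" and ne: "Pols \<noteq> {}" and e: "0 < e"
  obtains m :: nat where "\<And>Q. finite (set_pmf Q) \<Longrightarrow> set_pmf Q \<subseteq> space MX \<Longrightarrow> covering_number Q e Pols \<le> m"
proof -
  define I where "I = {Q :: 'x pmf. finite (set_pmf Q) \<and> set_pmf Q \<subseteq> space MX}"
  define g where "g e = (SUP Q\<in>I. ennreal (sqrt (ln (real (covering_number Q e Pols)))))" for e
  have pos: "1 \<le> covering_number Q e Pols" if eQ: "0 < e" "Q \<in> I" for Q e
  proof -
    obtain C where C: "finite C" "card C = covering_number Q e Pols"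
      "\<And>\<pi>. \<pi> \<in> Pols \<Longrightarrow> \<exists>g\<in>C. l2_norm (measure_pmf Q) (\<lambda>x. of_bool (\<pi> x) - g x) < e"
      by (rule covering_number_attained[OF _ eQ(1), of Q Pols]) (use eQ in \<open>auto simp: I_def\<close>)
    then have "C \<noteq> {}" using ne by auto
    then show ?thesis using C(1,2) by (simp add: Suc_le_eq card_gt_0_iff flip: C(2))
  qed
  have anti: "g e \<le> g d" if "0 < d" "d \<le> e" for d
    unfolding g_def
  proof (rule SUP_mono)
    fix Q assume Q: "Q \<in> I"
    have "ln (real (covering_number Q e Pols)) \<le> ln (real (covering_number Q d Pols))"
      using pos[OF e Q] pos[OF that(1) Q] covering_number_antimono[OF _ that, of Q Pols] Q
      by (auto simp: I_def)
    then show "\<exists>m\<in>I. ennreal (sqrt (ln (real (covering_number Q e Pols))))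
        \<le> ennreal (sqrt (ln (real (covering_number m d Pols))))"
      using Q by (intro bexI[of _ Q] ennreal_leI) auto
  qed
  have "g e \<noteq> \<infinity>"
  proof
    assume "g e = \<infinity>"
    then have inf: "g d = \<infinity>" if "0 < d" "d \<le> e" for d using anti[OF that] by (simp add: top_unique)
    have "(\<integral>\<^sup>+ d. \<infinity> * indicator {0<..e} d \<partial>lborel) \<le> (\<integral>\<^sup>+ d. g d * indicator {0<..} d \<partial>lborel)"
      using inf by (intro nn_integral_mono) (auto simp: indicator_def)
    moreover have "(\<integral>\<^sup>+ d. \<infinity> * indicator {0<..e} d \<partial>lborel) = \<infinity>"
      using e by (subst nn_integral_cmult_indicator) (auto simp: ennreal_top_mult)
    moreover have "(\<integral>\<^sup>+ d. g d * indicator {0<..} d \<partial>lborel) < \<infinity>"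
      using entropy unfolding bounded_uniform_entropy_integral_def g_def I_def .
    ultimately show False by (simp add: top_unique)
  qed
  then obtain b where b: "g e = ennreal b" "0 \<le> b" by (cases "g e") auto
  have "covering_number Q e Pols \<le> nat \<lceil>exp (b\<^sup>2)\<rceil>" if "finite (set_pmf Q)" "set_pmf Q \<subseteq> space MX" for Q
  proof -
    have Q: "Q \<in> I" using that by (simp add: I_def)
    have "ennreal (sqrt (ln (real (covering_number Q e Pols)))) \<le> ennreal b"
      unfolding b(1)[symmetric] g_def by (rule SUP_upper[OF Q])
    then have "sqrt (ln (real (covering_number Q e Pols))) \<le> b" using b(2) by simp
    then have "ln (real (covering_number Q e Pols)) \<le> b\<^sup>2" using real_sqrt_le_iff[of _ "b\<^sup>2"] b(2) by simp
    then have "real (covering_number Q e Pols) \<le> exp (b\<^sup>2)"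
      using pos[OF e Q] exp_le_cancel_iff[of "ln (real (covering_number Q e Pols))" "b\<^sup>2"] by simp
    then show ?thesis by linarith
  qed
  then show thesis by (rule that)
qed

text \<open>Separated policies are transported isometrically to a finitely supported Q, where a ball
  of radius e contains at most one of them; so their number is bounded uniformly. A separated set of
  maximal cardinality is then a net, and its members lie in the class although the centers of the
  covering balls need not.\<close>

lemma finite_net:
  assumes entropy: "bounded_uniform_entropy_integral MX Pols" and ne: "Pols \<noteq> {}" and e: "0 < e"
  obtains T where "finite T" "T \<subseteq> Pols" "\<And>\<pi>. \<pi> \<in> Pols \<Longrightarrow> \<exists>\<tau>\<in>T. policy_dist P \<pi> \<tau> < 2 * e"
proof -
  obtain m where m: "\<And>Q. finite (set_pmf Q) \<Longrightarrow> set_pmf Q \<subseteq> space MX \<Longrightarrow> covering_number Q e Pols \<le> m"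
    by (rule covering_number_bounded[OF entropy ne e]) blast
  define sep where "sep S \<longleftrightarrow> finite S \<and> S \<subseteq> Pols \<and>
    (\<forall>\<pi>\<in>S. \<forall>\<pi>'\<in>S. \<pi> \<noteq> \<pi>' \<longrightarrow> 2 * e \<le> policy_dist P \<pi> \<pi>')" for S
  have sepD: "2 * e \<le> policy_dist P \<pi> \<pi>'" if "sep S" "\<pi> \<in> S" "\<pi>' \<in> S" "\<pi> \<noteq> \<pi>'" for S \<pi> \<pi>'
    using that unfolding sep_def by blast
  have bound: "card S \<le> m" if S: "sep S" for S
  proof -
    have S': "finite S" "S \<subseteq> measurable MX (count_space UNIV)" using S policies by (auto simp: sep_def)
    obtain Q where Q: "finite (set_pmf Q)" "set_pmf Q \<subseteq> space MX"
      "\<And>\<pi> \<pi>'. \<pi> \<in> S \<Longrightarrow> \<pi>' \<in> S \<Longrightarrow>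
        l2_norm (measure_pmf Q) (\<lambda>x. of_bool (\<pi> x) - of_bool (\<pi>' x)) = policy_dist P \<pi> \<pi>'"
      by (rule finitely_supported_isometry[OF S']) blast
    obtain C where C: "finite C" "card C = covering_number Q e Pols"
      "\<And>\<pi>. \<pi> \<in> Pols \<Longrightarrow> \<exists>g\<in>C. l2_norm (measure_pmf Q) (\<lambda>x. of_bool (\<pi> x) - g x) < e"
      by (rule covering_number_attained[OF Q(1) e, of Pols]) blast
    have "\<forall>\<pi>\<in>S. \<exists>g. g \<in> C \<and> l2_norm (measure_pmf Q) (\<lambda>x. of_bool (\<pi> x) - g x) < e"
    proof
      fix \<pi> assume "\<pi> \<in> S"
      then have "\<pi> \<in> Pols" using S unfolding sep_def by (elim conjE) (rule subsetD)
      from C(3)[OF this] show "\<exists>g. g \<in> C \<and> l2_norm (measure_pmf Q) (\<lambda>x. of_bool (\<pi> x) - g x) < e"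
        by (elim bexE) (intro exI conjI)
    qed
    from bchoice[OF this] obtain c
      where "\<forall>\<pi>\<in>S. c \<pi> \<in> C \<and> l2_norm (measure_pmf Q) (\<lambda>x. of_bool (\<pi> x) - c \<pi> x) < e" ..
    then have c: "\<And>\<pi>. \<pi> \<in> S \<Longrightarrow> c \<pi> \<in> C"
      "\<And>\<pi>. \<pi> \<in> S \<Longrightarrow> l2_norm (measure_pmf Q) (\<lambda>x. of_bool (\<pi> x) - c \<pi> x) < e"
      by auto
    have "inj_on c S"
    proof (rule inj_onI, rule ccontr)
      fix \<pi> \<pi>' assume h: "\<pi> \<in> S" "\<pi>' \<in> S" "c \<pi> = c \<pi>'" "\<pi> \<noteq> \<pi>'"
      have "policy_dist P \<pi> \<pi>' \<le> l2_norm (measure_pmf Q) (\<lambda>x. of_bool (\<pi> x) - c \<pi> x)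
          + l2_norm (measure_pmf Q) (\<lambda>x. c \<pi> x - of_bool (\<pi>' x))"
        using l2_norm_triangle[OF finite_pmf_square_integrable[OF Q(1)] finite_pmf_square_integrable[OF Q(1)],
            of "\<lambda>x. of_bool (\<pi> x) - c \<pi> x" "\<lambda>x. c \<pi> x - of_bool (\<pi>' x)"] Q(3)[OF h(1,2)]
        by simp
      also have "\<dots> < 2 * e"
        using c(2)[OF h(1)] c(2)[OF h(2)] h(3)
          l2_norm_minus_commute[of "measure_pmf Q" "c \<pi>'" "\<lambda>x. of_bool (\<pi>' x)"] by simp
      finally show False using sepD[OF S h(1,2,4)] by simp
    qed
    then have "card S \<le> card C" using c(1) C(1) by (intro card_inj_on_le[of c]) auto
    then show ?thesis using m[OF Q(1,2)] C(2) by simp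
  qed
  have "sep {}" by (simp add: sep_def)
  moreover have fin: "finite (card ` {S. sep S})"
    by (rule finite_subset[of _ "{..m}"]) (use bound in auto)
  ultimately have "Max (card ` {S. sep S}) \<in> card ` {S. sep S}" by (intro Max_in) auto
  then obtain S where S: "sep S" "card S = Max (card ` {S. sep S})" by auto
  have S_max: "card S' \<le> card S" if "sep S'" for S'
    unfolding S(2) using that by (intro Max_ge fin) auto
  show thesis
  proof (rule that[of S])
    show "finite S" "S \<subseteq> Pols" using S by (auto simp: sep_def)
    fix \<pi> assume \<pi>: "\<pi> \<in> Pols"
    show "\<exists>\<tau>\<in>S. policy_dist P \<pi> \<tau> < 2 * e"
    proof (rule ccontr)
      assume "\<not> ?thesis"
      then have far: "2 * e \<le> policy_dist P \<pi> \<tau>" if "\<tau> \<in> S" for \<tau> using that by auto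
      then have "\<pi> \<notin> S" using policy_dist_same[of \<pi>] e by force
      moreover have "sep (insert \<pi> S)"
        unfolding sep_def
      proof (intro conjI ballI impI)
        show "finite (insert \<pi> S)" "insert \<pi> S \<subseteq> Pols" using S(1) \<pi> by (auto simp: sep_def)
        fix \<pi>1 \<pi>2 assume "\<pi>1 \<in> insert \<pi> S" "\<pi>2 \<in> insert \<pi> S" "\<pi>1 \<noteq> \<pi>2"
        then show "2 * e \<le> policy_dist P \<pi>1 \<pi>2"
          using far[of \<pi>1] far[of \<pi>2] sepD[OF S(1), of \<pi>1 \<pi>2] policy_dist_commute[of \<pi>1 \<pi>] by auto
      qed
      ultimately show False using S_max[of "insert \<pi> S"] S(1) by (simp add: sep_def)
    qed
  qed
qed

text \<open>At each scale the pigeonhole principle puts infinitely many terms near one point of a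
  finite net; a diagonal sequence handles all scales together.\<close>

lemma Cauchy_subsequence:
  fixes p :: "nat \<Rightarrow> 'x \<Rightarrow> bool"
  assumes entropy: "bounded_uniform_entropy_integral MX Pols" and p: "\<And>j. p j \<in> Pols"
  obtains r :: "nat \<Rightarrow> nat" where "strict_mono r"
    "\<And>k i j. k < i \<Longrightarrow> k < j \<Longrightarrow> policy_dist P (p (r i)) (p (r j)) < (1/2) ^ k"
proof -
  have pm: "p j \<in> measurable MX (count_space UNIV)" for j using p policies by blast
  interpret subseqs "\<lambda>k s. \<forall>i j. policy_dist P (p (s i)) (p (s j)) < (1/2) ^ k"
  proof
    fix k and s :: "nat \<Rightarrow> nat"
    \<comment> \<open>The net lemma doubles the radius and the triangle inequality doubles it again,
      hence the quarter.\<close>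
    have ne: "Pols \<noteq> {}" and pos: "0 < (1/2::real) ^ k / 4" using p by auto
    obtain T where T: "finite T" "T \<subseteq> Pols"
      "\<And>\<pi>. \<pi> \<in> Pols \<Longrightarrow> \<exists>\<tau>\<in>T. policy_dist P \<pi> \<tau> < 2 * ((1/2) ^ k / 4)"
      by (rule finite_net[OF entropy ne pos]) blast
    have "\<forall>i. \<exists>\<tau>\<in>T. policy_dist P (p (s i)) \<tau> < 2 * ((1/2) ^ k / 4)" using T(3) p by blast
    from choice[of "\<lambda>i \<tau>. \<tau> \<in> T \<and> policy_dist P (p (s i)) \<tau> < (1/2) ^ k / 2"] this
    obtain t where "\<forall>i. t i \<in> T \<and> policy_dist P (p (s i)) (t i) < (1/2) ^ k / 2" by auto
    then have t: "\<And>i. t i \<in> T" "\<And>i. policy_dist P (p (s i)) (t i) < (1/2) ^ k / 2" by auto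
    have "finite (range t)" using t(1) by (intro finite_subset[OF _ T(1)]) auto
    then obtain i0 where "infinite {i. t i = t i0}"
      using pigeonhole_infinite[of "UNIV :: nat set" t] by auto
    then obtain r :: "nat \<Rightarrow> nat" where r: "strict_mono r" "\<And>i. t (r i) = t i0"
      using infinite_enumerate[of "{i. t i = t i0}"] by auto
    have "policy_dist P (p (s (r i))) (p (s (r j))) < (1/2) ^ k" for i j
    proof -
      have "t i0 \<in> measurable MX (count_space UNIV)" using t(1) T(2) policies by blast
      from policy_dist_triangle[OF pm this pm, of "s (r i)" "s (r j)"]
      show ?thesis using t(2)[of "r i"] t(2)[of "r j"] r(2) policy_dist_commute[of "t i0"] by simp
    qed
    then show "\<exists>r' :: nat \<Rightarrow> nat. strict_mono r' \<and> (\<forall>i j. policy_dist P (p ((s \<circ> r') i)) (p ((s \<circ> r') j)) < (1/2) ^ k)"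
      using r(1) by (intro exI[of _ r] conjI allI) simp_all
  qed
  have "policy_dist P (p (diagseq i)) (p (diagseq j)) < (1/2) ^ k" if "k < i" "k < j" for k i j
  proof -
    \<comment> \<open>The diagonal sequence is a subsequence of stage k only from index
      \<open>Suc k\<close> on; this is the origin of the strict inequalities k < i and k <
      j.\<close>
    have "\<forall>i j. policy_dist P (p ((diagseq \<circ> (+) (Suc k)) i)) (p ((diagseq \<circ> (+) (Suc k)) j)) < (1/2) ^ k"
      by (rule diagseq_holds) auto
    from this[rule_format, of "i - Suc k" "j - Suc k"] show ?thesis using that by simp
  qed
  then show thesis using subseq_diagseq by (rule_tac that) auto
qed

text \<open>Squared distances are probabilities of disagreement, so those of consecutive terms are
  summable, as in the Borel-Cantelli lemma. The limit is the eventual pointwise value; it agrees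
  with \<open>p j\<close> unless some consecutive pair from j on disagrees.\<close>

lemma limit_policy:
  fixes p :: "nat \<Rightarrow> 'x \<Rightarrow> bool"
  assumes p: "\<And>j. p j \<in> measurable MX (count_space UNIV)"
    and Cauchy: "\<And>k i j. k < i \<Longrightarrow> k < j \<Longrightarrow> policy_dist P (p i) (p j) < (1/2) ^ k"
  obtains \<pi> where "\<pi> \<in> measurable MX (count_space UNIV)"
    "\<And>j. (policy_dist P (p j) \<pi>)\<^sup>2 \<le> 32 * (1/2) ^ j"
proof -
  define \<pi> where "\<pi> x \<longleftrightarrow> (\<exists>m. \<forall>k\<ge>m. p k x)" for x
  note [measurable] = p
  have \<pi>: "\<pi> \<in> measurable MX (count_space UNIV)" unfolding \<pi>_def[abs_def] by measurable
  define A where "A k = {z \<in> space P. p k (fst z) \<noteq> p (Suc k) (fst z)}" for k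
  have A: "A k \<in> sets P" for k unfolding A_def by (rule sets_disagree[OF p p])
  \<comment> \<open>The Cauchy bound for \<open>p k\<close> and \<open>p (Suc k)\<close> is
    available only at level k - 1, and at k = 0 only the trivial bound 1 is left. The generous
    factor 16 absorbs both cases, and the geometric series turns it into 32.\<close>
  have mA: "measure P (A k) \<le> 16 * (1/2) ^ k" for k
  proof (cases k)
    case 0
    have "measure P (A k) \<le> 1" by (rule prob_le_1)
    also have "1 \<le> 16 * (1/2::real) ^ k" using 0 by simp
    finally show ?thesis .
  next
    case (Suc l)
    have "measure P (A k) = (policy_dist P (p k) (p (Suc k)))\<^sup>2"
      unfolding A_def by (rule policy_dist_power2[OF p p, symmetric])
    also have "\<dots> \<le> ((1/2) ^ l)\<^sup>2"
      using Cauchy[of l k "Suc k"] Suc by (intro power_mono) (auto simp: policy_dist_def)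
    also have "\<dots> \<le> (1/2) ^ l" by (simp add: power2_eq_square mult_le_cancel_left2 power_le_one)
    also have "\<dots> \<le> 16 * (1/2) ^ k" using Suc by simp
    finally show ?thesis .
  qed
  have "(policy_dist P (p j) \<pi>)\<^sup>2 \<le> 32 * (1/2) ^ j" for j
  proof -
    have sub: "{z \<in> space P. p j (fst z) \<noteq> \<pi> (fst z)} \<subseteq> (\<Union>k. A (j + k))"
    proof (rule subsetI, rule ccontr)
      fix z assume z: "z \<in> {z \<in> space P. p j (fst z) \<noteq> \<pi> (fst z)}" "z \<notin> (\<Union>k. A (j + k))"
      have eq: "p (j + k) (fst z) = p j (fst z)" for k
        using z by (induction k) (auto simp: A_def)
      have "\<pi> (fst z) \<longleftrightarrow> p j (fst z)"
      proof
        assume "\<pi> (fst z)"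
        then obtain m where "\<forall>k\<ge>m. p k (fst z)" unfolding \<pi>_def by blast
        then have "p (j + m) (fst z)" by simp
        then show "p j (fst z)" using eq by simp
      next
        assume h: "p j (fst z)"
        have "p k (fst z)" if "j \<le> k" for k using eq[of "k - j"] that h by simp
        then show "\<pi> (fst z)" unfolding \<pi>_def by blast
      qed
      then show False using z by simp
    qed
    have s: "(\<lambda>k. 16 * (1/2) ^ j * (1/2::real) ^ k) sums (16 * (1/2) ^ j * (1 / (1 - 1/2)))"
      by (intro sums_mult geometric_sums) simp
    have mA_add: "measure P (A (j + k)) \<le> 16 * (1/2) ^ j * (1/2) ^ k" for k
      using mA[of "j + k"] by (simp add: power_add)
    have summ: "summable (\<lambda>k. measure P (A (j + k)))"
      by (rule summable_comparison_test_ev[OF always_eventually sums_summable[OF s]])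
        (use mA_add in simp)
    have "measure P {z \<in> space P. p j (fst z) \<noteq> \<pi> (fst z)} \<le> measure P (\<Union>k. A (j + k))"
      using A sub by (intro finite_measure_mono) auto
    also have "\<dots> \<le> (\<Sum>k. measure P (A (j + k)))"
      using A summ by (intro finite_measure_subadditive_countably) auto
    also have "\<dots> \<le> (\<Sum>k. 16 * (1/2) ^ j * (1/2) ^ k)"
      using mA_add by (intro suminf_le summ sums_summable[OF s])
    also have "\<dots> = 32 * (1/2) ^ j" using sums_unique[OF s] by simp
    finally show ?thesis unfolding policy_dist_power2[OF p \<pi>] .
  qed
  then show thesis using \<pi> by (rule_tac that) auto
qed

text \<open>The pointwise limit itself may lie outside the class. Closedness supplies a member that
  agrees with it almost everywhere, and replacing one by the other changes no distance.\<close>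

lemma convergent_subsequence:
  assumes entropy: "bounded_uniform_entropy_integral MX Pols" and closed: "closed_policy_class MX P Pols"
    and p: "\<And>j::nat. p j \<in> Pols"
  obtains r :: "nat \<Rightarrow> nat" and \<pi> where "strict_mono r" "\<pi> \<in> Pols"
    "\<And>j. (policy_dist P (p (r j)) \<pi>)\<^sup>2 \<le> 32 * (1/2) ^ j"
proof -
  obtain r :: "nat \<Rightarrow> nat" where r: "strict_mono r"
    "\<And>k i j. k < i \<Longrightarrow> k < j \<Longrightarrow> policy_dist P (p (r i)) (p (r j)) < (1/2) ^ k"
    by (rule Cauchy_subsequence[where p=p, OF entropy p]) blast
  have pm: "p j \<in> measurable MX (count_space UNIV)" for j using p policies by blast
  obtain \<pi> where \<pi>: "\<pi> \<in> measurable MX (count_space UNIV)"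
    "\<And>j. (policy_dist P (p (r j)) \<pi>)\<^sup>2 \<le> 32 * (1/2) ^ j"
    by (rule limit_policy[of "\<lambda>j. p (r j)", OF pm r(2)]) blast+
  have "(\<lambda>j. (policy_dist P (p (r j)) \<pi>)\<^sup>2) \<longlonglongrightarrow> 0"
  proof (rule tendsto_sandwich[OF _ _ tendsto_const])
    show "(\<lambda>j. 32 * (1/2::real) ^ j) \<longlonglongrightarrow> 0"
      by (intro tendsto_mult_right_zero LIMSEQ_power_zero) simp
  qed (use \<pi>(2) in auto)
  then have "(\<lambda>j. sqrt ((policy_dist P (p (r j)) \<pi>)\<^sup>2)) \<longlonglongrightarrow> sqrt 0" by (rule tendsto_real_sqrt)
  then have "(\<lambda>j. policy_dist P (p (r j)) \<pi>) \<longlonglongrightarrow> 0" by (simp add: policy_dist_def)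
  then obtain \<pi>' where \<pi>': "\<pi>' \<in> Pols" "AE z in P. \<pi>' (fst z) = \<pi> (fst z)"
    using closed \<pi>(1) p unfolding closed_policy_class_def
    by (elim allE[of _ "\<lambda>j. p (r j)"] allE[of _ \<pi>]) auto
  have "policy_dist P (p (r j)) \<pi>' = policy_dist P (p (r j)) \<pi>" for j
  proof -
    note [measurable] = measurable_policy_fst[OF pm] measurable_policy_fst[OF \<pi>(1)]
      measurable_policy_fst[OF subsetD[OF policies \<pi>'(1)]]
    show ?thesis unfolding policy_dist_def l2_norm_def
      using \<pi>'(2) by (intro arg_cong[where f=sqrt] integral_cong_AE) (measurable, auto)
  qed
  then show thesis using r(1) \<pi>'(1) \<pi>(2) by (rule_tac that) auto
qed

end

section \<open>Quantiles\<close>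

lemma Levy_uniqueness_std_normal:
  assumes N: "prob_space N" and [measurable]: "X \<in> borel_measurable N"
    and char: "\<And>a. (\<integral>v. iexp (a * X v) \<partial>N) = exp (- a\<^sup>2 / 2)"
  shows "distr N borel X = std_normal_distribution"
proof (rule Levy_uniqueness)
  interpret prob_space N by fact
  show "real_distribution (distr N borel X)" by (rule real_distribution_distr) simp
  show "char (distr N borel X) = char std_normal_distribution"
  proof
    fix a
    have "char (distr N borel X) a = (\<integral>v. iexp (a * X v) \<partial>N)"
      unfolding char_def by (subst integral_distr) auto
    also have "\<dots> = exp (- a\<^sup>2 / 2)" by (rule char)
    also have "\<dots> = char std_normal_distribution a" by (simp add: char_std_normal_distribution)
    finally show "char (distr N borel X) a = char std_normal_distribution a" .
  qed
qed (rule real_dist_normal_dist)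

text \<open>Points arbitrarily little above the infimum reach level q, and the Lipschitz bound
  carries this back to z - \<eta>. Positivity holds because at most half of the mass lies below
  0.\<close>

lemma std_normal_quantile:
  assumes q: "1 / 2 < q" "q < 1"
  defines "z \<equiv> quantile std_normal_distribution (\<lambda>x. x) q"
  shows "0 < z" and "0 \<le> \<eta> \<Longrightarrow> q - \<eta> \<le> cdf std_normal_distribution (z - \<eta>)"
proof -
  define S where "S = {t. q \<le> cdf std_normal_distribution t}"
  have z: "z = Inf S"
    by (simp add: z_def quantile_def S_def cdf_def atMost_def)
  have "\<forall>\<^sub>F t in at_top. q < cdf std_normal_distribution t"
    using order_tendstoD(1)[OF std_normal.cdf_lim_at_top_prob q(2)] .
  then obtain t1 where "q < cdf std_normal_distribution t1"
    using eventually_happens'[OF trivial_limit_at_top_linorder] by blast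
  then have ne: "S \<noteq> {}" by (auto simp: S_def intro: less_imp_le)
  have cdf_mono: "cdf std_normal_distribution a \<le> cdf std_normal_distribution b" if "a \<le> b" for a b
    by (rule finite_borel_measure.cdf_nondecreasing[OF std_normal.finite_borel_measure_M that])
  have S_pos: "0 < t" if "t \<in> S" for t
  proof (rule ccontr)
    assume "\<not> 0 < t"
    then have "cdf std_normal_distribution t \<le> cdf std_normal_distribution 0" by (intro cdf_mono) simp
    then show False using that q std_normal_cdf_0 by (simp add: S_def)
  qed
  have ge: "q - \<eta> \<le> cdf std_normal_distribution (z - \<eta>)" if \<eta>: "0 \<le> \<eta>" for \<eta>
  proof (rule field_le_epsilon)
    fix e :: real assume e: "0 < e"
    obtain t where t: "t \<in> S" "t < z + e"
      using cInf_lessD[OF ne, of "z + e"] e by (auto simp: z)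
    have "q \<le> cdf std_normal_distribution (z + e)"
      using t cdf_mono[of t "z + e"] by (auto simp: S_def)
    also have "\<dots> \<le> cdf std_normal_distribution (z - \<eta>) + (\<eta> + e)"
      using std_normal_cdf_diff_le[of "z - \<eta>" "z + e"] \<eta> e by simp
    finally show "q - \<eta> \<le> cdf std_normal_distribution (z - \<eta>) + e" by simp
  qed
  then show "0 \<le> \<eta> \<Longrightarrow> q - \<eta> \<le> cdf std_normal_distribution (z - \<eta>)" .
  have "0 \<le> z" unfolding z using ne S_pos by (intro cInf_greatest) (auto intro: less_imp_le)
  moreover have "z \<noteq> 0"
    using ge[of 0] q std_normal_cdf_0 by auto
  ultimately show "0 < z" by simp
qed

context
  fixes N :: "'v measure" and G :: "'i \<Rightarrow> 'v \<Rightarrow> real" and F :: "'i set" and q :: real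
  assumes N: "prob_space N" and sup_meas: "(\<lambda>v. SUP f\<in>F. ereal (G f v)) \<in> borel_measurable N"
    and q: "0 < q"
begin

text \<open>The supremum dominates both coordinates. The threshold c lies strictly above the
  quantile because an infimum only guarantees that levels below c carry mass q.\<close>

lemma sup_quantile_pair:
  assumes fg: "f \<in> F" "g \<in> F" and t: "quantile N (\<lambda>v. SUP f\<in>F. ereal (G f v)) q < ereal c"
    and [measurable]: "G f \<in> borel_measurable N" "G g \<in> borel_measurable N"
  shows "q \<le> measure N {v \<in> space N. G f v \<le> c \<and> G g v \<le> c}"
proof -
  interpret prob_space N by (rule N)
  obtain t' where t': "q \<le> measure N {v \<in> space N. (SUP f\<in>F. ereal (G f v)) \<le> t'}" "t' < ereal c"
    using t unfolding quantile_def Inf_less_iff by blast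
  have "measure N {v \<in> space N. (SUP f\<in>F. ereal (G f v)) \<le> t'}
      \<le> measure N {v \<in> space N. G f v \<le> c \<and> G g v \<le> c}"
  proof (rule finite_measure_mono)
    show "{v \<in> space N. (SUP f\<in>F. ereal (G f v)) \<le> t'} \<subseteq> {v \<in> space N. G f v \<le> c \<and> G g v \<le> c}"
    proof safe
      fix v assume v: "(SUP f\<in>F. ereal (G f v)) \<le> t'"
      have "ereal (G h v) \<le> ereal c" if "h \<in> F" for h
        using SUP_upper[OF that, of "\<lambda>f. ereal (G f v)"] v t'(2) by (meson order.trans less_imp_le)
      from this[OF fg(1)] this[OF fg(2)] show "G f v \<le> c" "G g v \<le> c" by auto
    qed
  qed measurable
  then show ?thesis using t'(1) by linarith
qed

text \<open>Otherwise a single standard normal coordinate would have mass at least q below every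
  real number. The value has to be excluded because no policy could be relied on to pass a selection
  test with it.\<close>

lemma sup_quantile_not_minf:
  assumes f: "f \<in> F" and [measurable]: "G f \<in> borel_measurable N"
    and std: "distr N borel (G f) = std_normal_distribution"
  shows "quantile N (\<lambda>v. SUP f\<in>F. ereal (G f v)) q \<noteq> - \<infinity>"
proof
  assume minf: "quantile N (\<lambda>v. SUP f\<in>F. ereal (G f v)) q = - \<infinity>"
  have "q \<le> cdf std_normal_distribution c" for c
  proof -
    have "q \<le> measure N {v \<in> space N. G f v \<le> c \<and> G f v \<le> c}"
      by (rule sup_quantile_pair[OF f f]) (auto simp: minf)
    also have "\<dots> = cdf (distr N borel (G f)) c"
      unfolding cdf_def by (subst measure_distr) (auto intro!: arg_cong[where f="measure N"])
    finally show ?thesis by (simp add: std)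
  qed
  moreover have "\<forall>\<^sub>F c in at_bot. cdf std_normal_distribution c < q"
    by (rule order_tendstoD(2)[OF std_normal.cdf_lim_at_bot q])
  then obtain c where "cdf std_normal_distribution c < q"
    using eventually_happens'[OF trivial_limit_at_bot_linorder] by blast
  ultimately show False by (meson not_less)
qed

text \<open>Selection needs slack below the quantile. Lowering the threshold from t + d to t - d
  loses at most the mass of one strip of width 2 d for each coordinate, 4 d in total.\<close>

lemma sup_quantile_pair_shift:
  assumes fg: "f \<in> F" "g \<in> F" and t: "quantile N (\<lambda>v. SUP f\<in>F. ereal (G f v)) q = ereal t"
    and [measurable]: "G f \<in> borel_measurable N" "G g \<in> borel_measurable N"
    and std: "distr N borel (G f) = std_normal_distribution" "distr N borel (G g) = std_normal_distribution"
    and d: "0 < d"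
  shows "q - 4 * d \<le> measure N {v \<in> space N. G f v \<le> t - d \<and> G g v \<le> t - d}"
proof -
  interpret prob_space N by (rule N)
  have strip: "measure N {v \<in> space N. t - d < G h v \<and> G h v \<le> t + d} \<le> 2 * d"
    if [measurable]: "G h \<in> borel_measurable N" and "distr N borel (G h) = std_normal_distribution" for h
  proof -
    have "measure N {v \<in> space N. t - d < G h v \<and> G h v \<le> t + d} = measure (distr N borel (G h)) {t - d<..t + d}"
      by (subst measure_distr) (auto intro!: arg_cong[where f="measure N"])
    also have "\<dots> \<le> (t + d) - (t - d)"
      unfolding that(2) using d by (intro std_normal_interval_le) simp
    finally show ?thesis by simp
  qed
  let ?A = "{v \<in> space N. G f v \<le> t - d \<and> G g v \<le> t - d}"
  let ?B = "\<lambda>h. {v \<in> space N. t - d < G h v \<and> G h v \<le> t + d}"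
  have "q \<le> measure N {v \<in> space N. G f v \<le> t + d \<and> G g v \<le> t + d}"
    using d t by (intro sup_quantile_pair fg) auto
  also have "\<dots> \<le> measure N (?A \<union> (?B f \<union> ?B g))"
    by (intro finite_measure_mono) auto
  also have "\<dots> \<le> measure N ?A + measure N (?B f \<union> ?B g)" by (intro measure_Un_le) auto
  also have "measure N (?B f \<union> ?B g) \<le> measure N (?B f) + measure N (?B g)" by (intro measure_Un_le) auto
  finally show ?thesis using strip[of f] strip[of g] std by simp
qed

end

section \<open>Outer and inner probabilities\<close>

text \<open>Outer probabilities are traded for measurable good events. From here on such events are
  only intersected, so the measurability of suprema over policies never has to be discussed.\<close>

lemma is_op_eventually:
  assumes W: "prob_space W" and op: "is_op W R r" and e: "0 < \<epsilon>" and \<eta>: "0 < \<eta>"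
  shows "\<forall>\<^sub>F n in sequentially. \<exists>B\<in>sets W. 1 - \<eta> \<le> measure W B \<and> (\<forall>w\<in>B. R n w \<le> ereal (\<epsilon> * r n))"
proof -
  interpret prob_space W by fact
  have "(\<lambda>n. outer_measure_of W {w \<in> space W. ereal (\<epsilon> * r n) < R n w}) \<longlonglongrightarrow> 0"
    using op e by (simp add: is_op_def)
  then have "\<forall>\<^sub>F n in sequentially. outer_measure_of W {w \<in> space W. ereal (\<epsilon> * r n) < R n w} < ennreal \<eta>"
    by (rule order_tendstoD(2)) (use \<eta> in simp)
  then show ?thesis
  proof eventually_elim
    case (elim n)
    then obtain E where E: "E \<in> sets W" "{w \<in> space W. ereal (\<epsilon> * r n) < R n w} \<subseteq> E" "emeasure W E < ennreal \<eta>"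
      unfolding outer_measure_of_def INF_less_iff by auto
    have "measure W E \<le> \<eta>"
      using E(3) \<eta> by (simp add: emeasure_eq_measure ennreal_less_iff)
    moreover have "measure W (space W - E) = 1 - measure W E" using E(1) by (rule prob_compl)
    ultimately show ?case using E(1,2) by (intro bexI[of _ "space W - E"]) (auto simp: not_less)
  qed
qed

lemma liminf_inner_prob_eventually:
  assumes W: "prob_space W" and lim: "ereal p \<le> liminf (\<lambda>n. ereal (inner_prob W (A n)))" and \<eta>: "0 < \<eta>"
  shows "\<forall>\<^sub>F n in sequentially. \<exists>B\<in>sets W. p - \<eta> \<le> measure W B \<and> B \<subseteq> A n"
proof -
  interpret prob_space W by fact
  have "ereal (p - \<eta>) < liminf (\<lambda>n. ereal (inner_prob W (A n)))"
    using \<eta> by (intro less_le_trans[OF _ lim]) simp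
  then have "\<forall>\<^sub>F n in sequentially. ereal (p - \<eta>) < ereal (inner_prob W (A n))"
    by (rule less_LiminfD)
  then show ?thesis
  proof eventually_elim
    case (elim n)
    have "bdd_above (measure W ` {B \<in> sets W. B \<subseteq> A n})"
      by (rule bdd_aboveI2[of _ _ 1]) simp
    moreover have "{B \<in> sets W. B \<subseteq> A n} \<noteq> {}" by auto
    ultimately obtain B where "B \<in> sets W" "B \<subseteq> A n" "p - \<eta> < measure W B"
      using elim less_cSUP_iff[of "{B \<in> sets W. B \<subseteq> A n}" "measure W" "p - \<eta>"]
      by (auto simp: inner_prob_def)
    then show ?case by (intro bexI[of _ B]) auto
  qed
qed

lemma inner_prob_ge:
  assumes W: "prob_space W" and "B \<in> sets W" "B \<subseteq> A"
  shows "measure W B \<le> inner_prob W A"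
proof -
  interpret prob_space W by fact
  show ?thesis unfolding inner_prob_def
    using assms by (intro cSUP_upper bdd_aboveI2[of _ _ 1]) auto
qed

lemma liminf_inner_probI:
  assumes W: "prob_space W"
    and ev: "\<And>\<eta>. 0 < \<eta> \<Longrightarrow> \<forall>\<^sub>F n in sequentially. \<exists>B\<in>sets W. p - \<eta> \<le> measure W B \<and> B \<subseteq> A n"
  shows "ereal p \<le> liminf (\<lambda>n. ereal (inner_prob W (A n)))"
proof (rule ereal_le_epsilon2)
  fix \<eta> :: real assume \<eta>: "0 < \<eta>"
  have "\<forall>\<^sub>F n in sequentially. ereal (p - \<eta>) \<le> ereal (inner_prob W (A n))"
    using ev[OF \<eta>] inner_prob_ge[OF W] by (auto elim!: eventually_mono intro: order_trans)
  then have "ereal (p - \<eta>) \<le> liminf (\<lambda>n. ereal (inner_prob W (A n)))"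
    by (rule Liminf_bounded)
  then have "ereal (p - \<eta>) + ereal \<eta> \<le> liminf (\<lambda>n. ereal (inner_prob W (A n))) + ereal \<eta>"
    by (rule add_right_mono)
  then show "ereal p \<le> liminf (\<lambda>n. ereal (inner_prob W (A n))) + ereal \<eta>" by simp
qed

lemma (in prob_space) prob_Int_ge:
  assumes "A \<in> sets M" "B \<in> sets M" "1 - a \<le> measure M A" "1 - b \<le> measure M B"
  shows "1 - (a + b) \<le> measure M (A \<inter> B)"
proof -
  have "measure M A \<le> measure M ((A \<inter> B) \<union> (space M - B))"
    using assms sets.sets_into_space by (intro finite_measure_mono) auto
  also have "\<dots> \<le> measure M (A \<inter> B) + measure M (space M - B)"
    using assms by (intro measure_Un_le) auto
  also have "measure M (space M - B) = 1 - measure M B" using assms(2) by (rule prob_compl)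
  finally show ?thesis using assms by simp
qed

section \<open>Coverage\<close>

context iid_sample
begin

lemma prob_Int_geI:
  assumes "A \<in> sets W" "B \<in> sets W" "1 - a \<le> measure W A" "1 - b \<le> measure W B" "a + b \<le> c"
  shows "1 - c \<le> measure W (A \<inter> B)"
  using W.prob_Int_ge[OF assms(1-4)] assms(5) by linarith

text \<open>If the bound exceeded \<psi> for every late j, each late deviation would be at least
  -3\<delta>/4, and so would be their average under any tail weights; but suitable weights push the
  average down to -\<delta>. The witness j may depend on the sample point and can be required beyond
  any m, where all policies are selected.\<close>

lemma one_sided_coverage:
  fixes h :: "nat \<Rightarrow> 'z \<Rightarrow> real" and psih kph :: "nat \<Rightarrow> nat \<Rightarrow> 'w \<Rightarrow> real"
  assumes h: "\<And>j. square_integrable P (h j)" and mean: "\<And>j. (\<integral>z. h j z \<partial>P) = 0"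
    and k: "0 < k0" "\<And>j. k0 \<le> l2_norm P (h j)" "\<And>j. l2_norm P (h j) \<le> K"
    and q: "1 / 2 < q" "q < 1"
    and lin: "\<And>\<epsilon> \<eta>. 0 < \<epsilon> \<Longrightarrow> 0 < \<eta> \<Longrightarrow> \<forall>\<^sub>F n in sequentially. \<exists>B\<in>sets W. 1 - \<eta> \<le> measure W B \<and>
      (\<forall>w\<in>B. \<forall>j. \<bar>psih n j w - \<Psi> j - emp_mean Z n w (h j)\<bar> \<le> \<epsilon> * (1 / sqrt (real n)))"
    and kap: "\<And>\<epsilon> \<eta>. 0 < \<epsilon> \<Longrightarrow> 0 < \<eta> \<Longrightarrow> \<forall>\<^sub>F n in sequentially. \<exists>B\<in>sets W. 1 - \<eta> \<le> measure W B \<and>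
      (\<forall>w\<in>B. \<forall>j. \<bar>kph n j w - l2_norm P (h j)\<bar> \<le> \<epsilon>)"
    and lim: "\<Psi> \<longlonglongrightarrow> \<psi>" and \<eta>: "0 < \<eta>"
  defines "z \<equiv> quantile std_normal_distribution (\<lambda>x. x) q"
  shows "\<forall>\<^sub>F n in sequentially. \<forall>m. \<exists>B\<in>sets W. 1 - (1 - q + \<eta>) \<le> measure W B \<and>
    (\<forall>w\<in>B. \<exists>j\<ge>m. psih n j w - kph n j w * z / sqrt (real n) \<le> \<psi>)"
proof -
  have z: "0 < z" unfolding z_def by (rule std_normal_quantile(1)[OF q])
  \<comment> \<open>The bound z/2 keeps x nonnegative; the bound \<eta>/4 is the loss of level
    caused by moving from z to x.\<close>
  define e where "e = min (z / 2) (\<eta> / 4)"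
  have e: "0 < e" "e \<le> z / 2" "e \<le> \<eta> / 4" using z \<eta> by (auto simp: e_def)
  define x where "x = z - e"
  have x: "0 \<le> x" "x < z" using e z by (auto simp: x_def)
  have \<Phi>: "q - \<eta> / 4 \<le> cdf std_normal_distribution x"
    using std_normal_quantile(2)[OF q, of e] e by (simp add: x_def z_def)
  define \<delta> where "\<delta> = k0 * (z - x) / 4"
  have \<delta>: "0 < \<delta>" using k x by (simp add: \<delta>_def)
  \<comment> \<open>Linearization, estimation of the standard deviation and the bias cost \<delta>/4
    each, the middle one after multiplication by z. The probability \<eta> is spent in quarters on
    the shift of the quantile, the limit theorem and the two estimation events.\<close>
  have \<eta>4: "0 < \<eta> / 4" and \<delta>4: "0 < \<delta> / 4" and \<delta>z: "0 < \<delta> / (4 * z)" using \<eta> \<delta> z by auto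
  show ?thesis
    using tail_combination_coverage[where h=h, OF h mean k x \<eta>4] lin[OF \<delta>4 \<eta>4] kap[OF \<delta>z \<eta>4]
      eventually_gt_at_top[of 0]
  proof eventually_elim
    case (elim n)
    define s where "s = sqrt (real n)"
    have s: "0 < s" using elim by (simp add: s_def)
    show ?case
    proof
      fix m
      \<comment> \<open>Since n is fixed by now, even the bias inflated by sqrt n is negligible far
        enough along the sequence.\<close>
      have "(\<lambda>j. s * (\<Psi> j - \<psi>)) \<longlonglongrightarrow> s * (\<psi> - \<psi>)" by (intro tendsto_intros lim)
      then have "\<forall>\<^sub>F j in sequentially. s * (\<Psi> j - \<psi>) < \<delta> / 4"
        using \<delta> by (intro order_tendstoD(2)) auto
      then obtain m1 where m1: "\<And>j. m1 \<le> j \<Longrightarrow> s * (\<Psi> j - \<psi>) < \<delta> / 4"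
        unfolding eventually_sequentially by blast
      obtain c B1 where c: "c \<in> tail_weights (max m m1)" and B1: "B1 \<in> sets W"
        "cdf std_normal_distribution x - \<eta> / 4 \<le> measure W B1"
        "\<And>w. w \<in> B1 \<Longrightarrow> (\<Sum>j | c j \<noteq> 0. c j * (scaled_mean (h j) n w - z * l2_norm P (h j))) \<le> - \<delta>"
        using elim(1)[rule_format, of "max m m1"] unfolding \<delta>_def by blast
      obtain B2 where B2: "B2 \<in> sets W" "1 - \<eta> / 4 \<le> measure W B2"
        "\<And>w j. w \<in> B2 \<Longrightarrow> \<bar>psih n j w - \<Psi> j - emp_mean Z n w (h j)\<bar> \<le> \<delta> / 4 * (1 / s)"
        using elim(2) unfolding s_def by blast
      obtain B3 where B3: "B3 \<in> sets W" "1 - \<eta> / 4 \<le> measure W B3"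
        "\<And>w j. w \<in> B3 \<Longrightarrow> \<bar>kph n j w - l2_norm P (h j)\<bar> \<le> \<delta> / (4 * z)"
        using elim(3) by blast
      obtain l where l: "\<And>j. 0 \<le> c j" "\<And>j. j < max m m1 \<Longrightarrow> c j = 0" "\<forall>j\<ge>l. c j = 0" "(\<Sum>j<l. c j) = 1"
        by (rule tail_weightsE[OF c]) blast
      have "1 - (1 - q + \<eta> / 2) \<le> measure W B1" using B1(2) \<Phi> by simp
      from prob_Int_geI[OF B1(1) B2(1) this B2(2) order_refl]
      have p2: "1 - (1 - q + \<eta> / 2 + \<eta> / 4) \<le> measure W (B1 \<inter> B2)" .
      have prob: "1 - (1 - q + \<eta>) \<le> measure W (B1 \<inter> B2 \<inter> B3)"
        by (rule prob_Int_geI[OF sets.Int[OF B1(1) B2(1)] B3(1) p2 B3(2)]) simp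
      have "\<exists>j\<ge>m. psih n j w - kph n j w * z / s \<le> \<psi>" if w: "w \<in> B1 \<inter> B2 \<inter> B3" for w
      proof (rule ccontr)
        assume "\<not> ?thesis"
        then have gt: "\<psi> < psih n j w - kph n j w * z / s" if "m \<le> j" for j using that by auto
        have lower: "- (3 * \<delta> / 4) \<le> scaled_mean (h j) n w - z * l2_norm P (h j)" if j: "max m m1 \<le> j" for j
        proof -
          have "s * \<psi> < s * (psih n j w - kph n j w * z / s)" using gt[of j] j s by simp
          then have 1: "0 < s * (psih n j w - \<psi>) - kph n j w * z"
            using s by (simp add: algebra_simps)
          have "psih n j w - \<Psi> j - emp_mean Z n w (h j) \<le> \<delta> / 4 * (1 / s)"
            using B2(3)[of w j] w by auto
          then have "s * (psih n j w - \<Psi> j - emp_mean Z n w (h j)) \<le> s * (\<delta> / 4 * (1 / s))"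
            using s by (intro mult_left_mono) auto
          then have 2: "s * psih n j w \<le> s * \<Psi> j + scaled_mean (h j) n w + \<delta> / 4"
            using s by (simp add: scaled_mean_def s_def[symmetric] algebra_simps)
          have "l2_norm P (h j) - kph n j w \<le> \<delta> / (4 * z)" using B3(3)[of w j] w by auto
          then have "z * (l2_norm P (h j) - kph n j w) \<le> z * (\<delta> / (4 * z))"
            using z by (intro mult_left_mono) auto
          then have 3: "z * l2_norm P (h j) \<le> kph n j w * z + \<delta> / 4"
            using z by (simp add: algebra_simps)
          have "s * \<Psi> j - s * \<psi> < \<delta> / 4" using m1[of j] j by (simp add: algebra_simps)
          then show ?thesis using 1 2 3 by (simp add: algebra_simps)
        qed
        have "- (3 * \<delta> / 4) = (\<Sum>j<l. c j * (- (3 * \<delta> / 4)))"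
          unfolding sum_distrib_right[symmetric] l(4) by simp
        also have "\<dots> \<le> (\<Sum>j<l. c j * (scaled_mean (h j) n w - z * l2_norm P (h j)))"
        proof (rule sum_mono)
          fix j
          show "c j * (- (3 * \<delta> / 4)) \<le> c j * (scaled_mean (h j) n w - z * l2_norm P (h j))"
          proof (cases "j < max m m1")
            case True
            then show ?thesis using l(2) by simp
          next
            case False
            then have "max m m1 \<le> j" by (simp only: not_less)
            from mult_left_mono[OF lower[OF this] l(1)] show ?thesis .
          qed
        qed
        also have "\<dots> = (\<Sum>j | c j \<noteq> 0. c j * (scaled_mean (h j) n w - z * l2_norm P (h j)))"
          by (rule sum_nonzero_weights[OF l(3), symmetric])
        also have "\<dots> \<le> - \<delta>" using B1(3) w by blast
        finally show False using \<delta> by simp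
      qed
      then show "\<exists>B\<in>sets W. 1 - (1 - q + \<eta>) \<le> measure W B \<and>
          (\<forall>w\<in>B. \<exists>j\<ge>m. psih n j w - kph n j w * z / sqrt (real n) \<le> \<psi>)"
        using prob B1(1) B2(1) B3(1) unfolding s_def by (intro bexI[of _ "B1 \<inter> B2 \<inter> B3"]) auto
    qed
  qed
qed

text \<open>Geometric decay of the variances lets a plain union bound over infinitely many functions
  play the part of a maximal inequality, with a bound that is free of n and tends to 0 in k.\<close>

lemma tail_sup_Chebyshev:
  fixes g :: "nat \<Rightarrow> 'z \<Rightarrow> real" and k :: nat
  assumes g: "\<And>j. square_integrable P (g j)" "\<And>j. (\<integral>z. g j z \<partial>P) = 0"
    and C: "\<And>j. (l2_norm P (g j))\<^sup>2 \<le> C * (1/2) ^ j" and n: "0 < n" and a: "0 < a"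
  defines "A \<equiv> (\<Union>j. {w \<in> space W. a \<le> \<bar>scaled_mean (g (k + j)) n w\<bar>})"
  shows "A \<in> sets W" and "measure W A \<le> 2 * C * (1/2) ^ k / a\<^sup>2"
proof -
  note [measurable] = square_integrableD(1)[OF g(1)]
  define E where "E j = {w \<in> space W. a \<le> \<bar>scaled_mean (g (k + j)) n w\<bar>}" for j
  have E: "E j \<in> sets W" for j unfolding E_def by measurable
  have A: "A = (\<Union>j. E j)" by (simp add: A_def E_def)
  show "A \<in> sets W" unfolding A using E by auto
  have mE: "measure W (E j) \<le> C * (1/2) ^ k / a\<^sup>2 * (1/2) ^ j" for j
  proof -
    have "measure W (E j) \<le> (l2_norm P (g (k + j)))\<^sup>2 / a\<^sup>2"
      unfolding E_def by (rule scaled_mean_Chebyshev[OF g n a])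
    also have "\<dots> \<le> (C * (1/2) ^ (k + j)) / a\<^sup>2" by (intro divide_right_mono C) simp
    finally show ?thesis by (simp add: power_add)
  qed
  have s: "(\<lambda>j. C * (1/2) ^ k / a\<^sup>2 * (1/2::real) ^ j) sums (C * (1/2) ^ k / a\<^sup>2 * (1 / (1 - 1/2)))"
    by (intro sums_mult geometric_sums) simp
  have summ: "summable (\<lambda>j. measure W (E j))"
    by (rule summable_comparison_test_ev[OF always_eventually sums_summable[OF s]]) (use mE in simp)
  have "measure W A \<le> (\<Sum>j. measure W (E j))"
    unfolding A using E summ by (intro W.finite_measure_subadditive_countably) auto
  also have "\<dots> \<le> (\<Sum>j. C * (1/2) ^ k / a\<^sup>2 * (1/2) ^ j)"
    using mE by (intro suminf_le summ sums_summable[OF s])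
  also have "\<dots> = C * (1/2) ^ k / a\<^sup>2 * (1 / (1 - 1/2))" by (rule sums_unique[OF s, symmetric])
  also have "\<dots> = 2 * C * (1/2) ^ k / a\<^sup>2" by simp
  finally show "measure W A \<le> 2 * C * (1/2) ^ k / a\<^sup>2" .
qed

text \<open>The Boolean index distinguishes the two sequences that approach the lower and the upper
  endpoint.\<close>

lemma joint_selection:
  fixes g :: "bool \<Rightarrow> nat \<Rightarrow> 'z \<Rightarrow> real" and g0 :: "bool \<Rightarrow> 'z \<Rightarrow> real"
    and omh sgh :: "nat \<Rightarrow> bool \<Rightarrow> nat \<Rightarrow> 'w \<Rightarrow> real" and t :: ereal
  assumes g: "\<And>b j. square_integrable P (g b j)" "\<And>b j. (\<integral>z. g b j z \<partial>P) = 0"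
    and g0: "\<And>b. square_integrable P (g0 b)" "\<And>b. (\<integral>z. g0 b z \<partial>P) = 0"
    and C: "\<And>b j. (l2_norm P (\<lambda>z. g b j z - g0 b z))\<^sup>2 \<le> C * (1/2) ^ j"
    and s0: "0 < s0" "\<And>b j. s0 \<le> l2_norm P (g b j)" "\<And>b. s0 \<le> l2_norm P (g0 b)"
    and lin: "\<And>\<epsilon> \<eta>. 0 < \<epsilon> \<Longrightarrow> 0 < \<eta> \<Longrightarrow> \<forall>\<^sub>F n in sequentially. \<exists>B\<in>sets W. 1 - \<eta> \<le> measure W B \<and>
      (\<forall>w\<in>B. \<forall>b j. \<bar>omh n b j w - \<omega> - emp_mean Z n w (g b j)\<bar> \<le> \<epsilon> * (1 / sqrt (real n)))"
    and sig: "\<And>\<epsilon> \<eta>. 0 < \<epsilon> \<Longrightarrow> 0 < \<eta> \<Longrightarrow> \<forall>\<^sub>F n in sequentially. \<exists>B\<in>sets W. 1 - \<eta> \<le> measure W B \<and>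
      (\<forall>w\<in>B. \<forall>b j. \<bar>sgh n b j w - l2_norm P (g b j)\<bar> \<le> \<epsilon>)"
    and t: "t \<noteq> - \<infinity>" and b: "0 \<le> p"
    and lower: "\<And>r d. t = ereal r \<Longrightarrow> 0 < d \<Longrightarrow> \<forall>\<^sub>F n in sequentially. 1 - p - 5 * d \<le> measure W
      {w \<in> space W. \<forall>b. - (r - d / 2) \<le> scaled_mean (\<lambda>z. g0 b z / l2_norm P (g0 b)) n w}"
    and \<eta>: "0 < \<eta>"
  obtains k where "\<forall>\<^sub>F n in sequentially. \<exists>B\<in>sets W. 1 - (p + \<eta>) \<le> measure W B \<and>
    (\<forall>w\<in>B. \<forall>b. \<forall>j\<ge>k. ereal \<omega> \<le> ereal (omh n b j w) + ereal (sgh n b j w) * t / ereal (sqrt (real n)))"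
proof (cases t)
  case PInf
  have "\<forall>\<^sub>F n in sequentially. \<exists>B\<in>sets W. 1 - (p + \<eta>) \<le> measure W B \<and>
    (\<forall>w\<in>B. \<forall>b. \<forall>j\<ge>0. ereal \<omega> \<le> ereal (omh n b j w) + ereal (sgh n b j w) * t / ereal (sqrt (real n)))"
    using sig[OF half_gt_zero[OF s0(1)] \<eta>] eventually_gt_at_top[of 0]
  proof eventually_elim
    case (elim n)
    then obtain B where B: "B \<in> sets W" "1 - \<eta> \<le> measure W B"
      "\<And>w b j. w \<in> B \<Longrightarrow> \<bar>sgh n b j w - l2_norm P (g b j)\<bar> \<le> s0 / 2"
      by blast
    have "ereal \<omega> \<le> ereal (omh n b j w) + ereal (sgh n b j w) * t / ereal (sqrt (real n))" if "w \<in> B" for w b j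
    proof -
      \<comment> \<open>Positivity matters: an estimate 0 would give 0 * \<infinity> = 0 in
        \<open>ereal\<close> and void the infinite slack.\<close>
      have "0 < sgh n b j w" using B(3)[OF that, of b j] s0(1) s0(2)[of b j] by linarith
      then show ?thesis using elim PInf by (simp add: divide_ereal_def)
    qed
    then show ?case using B(1,2) b by (intro bexI[of _ B]) auto
  qed
  then show thesis by (rule that)
next
  case MInf
  then show thesis using t by simp
next
  case (real r)
  \<comment> \<open>The loss 5 d in \<open>lower\<close> becomes \<eta>/4. Four further events cost
    \<eta>/8 each, so the total stays below \<eta>.\<close>
  define d where "d = \<eta> / 20"
  have d: "0 < d" using \<eta> by (simp add: d_def)
  \<comment> \<open>Linearization and the passage from \<open>g0 b\<close> to \<open>g b j\<close>
    cost \<epsilon> each, and the error of \<open>sgh\<close> costs 2 \<epsilon> \<bar>r\<bar>.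
    Together this is 2 \<epsilon> (1 + \<bar>r\<bar>) = s0 d/2, which the slack \<sigma> d/2
    covers.\<close>
  define \<epsilon> where "\<epsilon> = s0 * d / (4 * (1 + \<bar>r\<bar>))"
  have \<epsilon>: "0 < \<epsilon>" using s0 d by (simp add: \<epsilon>_def)
  have \<epsilon>_eq: "2 * \<epsilon> * (1 + \<bar>r\<bar>) = s0 * d / 2"
  proof -
    have "1 + \<bar>r\<bar> \<noteq> 0" using abs_ge_zero[of r] by linarith
    then show ?thesis unfolding \<epsilon>_def by (simp add: divide_simps)
  qed
  have \<eta>8: "0 < \<eta> / 8" using \<eta> by simp
  have "(\<lambda>k. 2 * C * (1/2) ^ k / \<epsilon>\<^sup>2) \<longlonglongrightarrow> 2 * C * 0 / \<epsilon>\<^sup>2"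
    by (intro tendsto_intros LIMSEQ_power_zero) (use \<epsilon> in auto)
  then have ev1: "\<forall>\<^sub>F k in sequentially. 2 * C * (1/2) ^ k / \<epsilon>\<^sup>2 < \<eta> / 8"
    using \<eta> by (intro order_tendstoD(2)) auto
  have "(\<lambda>k. C * (1/2) ^ k) \<longlonglongrightarrow> C * 0"
    by (intro tendsto_intros LIMSEQ_power_zero) auto
  then have ev2: "\<forall>\<^sub>F k in sequentially. C * (1/2) ^ k < \<epsilon>\<^sup>2"
    using \<epsilon> by (intro order_tendstoD(2)) auto
  obtain k where k: "2 * C * (1/2) ^ k / \<epsilon>\<^sup>2 < \<eta> / 8" "\<And>j. k \<le> j \<Longrightarrow> C * (1/2) ^ j < \<epsilon>\<^sup>2"
    using eventually_conj[OF ev1 ev2] unfolding eventually_sequentially by (meson order_refl order_trans)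
  have close: "\<bar>l2_norm P (g b j) - l2_norm P (g0 b)\<bar> \<le> \<epsilon>" if "k \<le> j" for b j
  proof -
    have "(l2_norm P (\<lambda>z. g b j z - g0 b z))\<^sup>2 \<le> \<epsilon>\<^sup>2" using C[of b j] k(2)[OF that] by linarith
    then have "l2_norm P (\<lambda>z. g b j z - g0 b z) \<le> \<epsilon>" by (rule power2_le_imp_le) (use \<epsilon> in simp)
    then show ?thesis using l2_norm_triangle_diff[OF g(1)[of b j] g0(1)[of b]] by linarith
  qed
  have dsq: "square_integrable P (\<lambda>z. g b j z - g0 b z)" for b j
    by (intro square_integrable_diff g g0)
  have dmean: "(\<integral>z. g b j z - g0 b z \<partial>P) = 0" for b j
    using P.square_integrable_integrable[OF g(1)] P.square_integrable_integrable[OF g0(1)] g(2) g0(2) by simp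
  have "\<forall>\<^sub>F n in sequentially. \<exists>B\<in>sets W. 1 - (p + \<eta>) \<le> measure W B \<and>
    (\<forall>w\<in>B. \<forall>b. \<forall>j\<ge>k. ereal \<omega> \<le> ereal (omh n b j w) + ereal (sgh n b j w) * t / ereal (sqrt (real n)))"
    using lin[OF \<epsilon> \<eta>8] sig[OF \<epsilon> \<eta>8] lower[OF real d] eventually_gt_at_top[of 0]
  proof eventually_elim
    case (elim n)
    define s where "s = sqrt (real n)"
    have s: "0 < s" using elim by (simp add: s_def)
    obtain B1 where B1: "B1 \<in> sets W" "1 - \<eta> / 8 \<le> measure W B1"
      "\<And>w b j. w \<in> B1 \<Longrightarrow> \<bar>omh n b j w - \<omega> - emp_mean Z n w (g b j)\<bar> \<le> \<epsilon> * (1 / s)"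
      using elim(1) unfolding s_def by blast
    obtain B2 where B2: "B2 \<in> sets W" "1 - \<eta> / 8 \<le> measure W B2"
      "\<And>w b j. w \<in> B2 \<Longrightarrow> \<bar>sgh n b j w - l2_norm P (g b j)\<bar> \<le> \<epsilon>"
      using elim(2) by blast
    define B3 where "B3 = {w \<in> space W. \<forall>b. - (r - d / 2) \<le> scaled_mean (\<lambda>z. g0 b z / l2_norm P (g0 b)) n w}"
    have [measurable]: "scaled_mean (\<lambda>z. g0 b z / l2_norm P (g0 b)) n \<in> borel_measurable W" for b
      by (rule measurable_scaled_mean[OF square_integrableD(1)[OF square_integrable_divide[OF g0(1)]]])
    have B3: "B3 \<in> sets W" unfolding B3_def all_bool_eq by measurable
    have pB3: "1 - (p + \<eta> / 4) \<le> measure W B3" using elim(3) by (simp add: B3_def d_def)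
    define T where "T b = (\<Union>j. {w \<in> space W. \<epsilon> \<le> \<bar>scaled_mean (\<lambda>z. g b (k + j) z - g0 b z) n w\<bar>})" for b
    have T: "T b \<in> sets W" for b
      unfolding T_def using tail_sup_Chebyshev(1)[where g="\<lambda>j z. g b j z - g0 b z", OF dsq dmean C _ \<epsilon>] elim by simp
    have mT: "measure W (T b) \<le> 2 * C * (1/2) ^ k / \<epsilon>\<^sup>2" for b
      unfolding T_def using tail_sup_Chebyshev(2)[where g="\<lambda>j z. g b j z - g0 b z", OF dsq dmean C _ \<epsilon>] elim by simp
    have TB: "space W - T b \<in> sets W" "1 - \<eta> / 8 \<le> measure W (space W - T b)" for b
      using T mT[of b] k(1) W.prob_compl[OF T] by auto
    define B where "B = B3 \<inter> B1 \<inter> B2 \<inter> (space W - T True) \<inter> (space W - T False)"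
    have B: "B \<in> sets W" using B1(1) B2(1) B3 TB(1) by (auto simp: B_def)
    have p1: "1 - (p + \<eta> / 4 + \<eta> / 8) \<le> measure W (B3 \<inter> B1)"
      by (rule prob_Int_geI[OF B3 B1(1) pB3 B1(2)]) simp
    have p2: "1 - (p + \<eta> / 4 + \<eta> / 8 + \<eta> / 8) \<le> measure W (B3 \<inter> B1 \<inter> B2)"
      by (rule prob_Int_geI[OF _ B2(1) p1 B2(2)]) (use B3 B1(1) in auto)
    have p3: "1 - (p + \<eta> / 4 + \<eta> / 8 + \<eta> / 8 + \<eta> / 8) \<le> measure W (B3 \<inter> B1 \<inter> B2 \<inter> (space W - T True))"
      by (rule prob_Int_geI[OF _ TB(1) p2 TB(2)]) (use B3 B1(1) B2(1) in auto)
    have prob: "1 - (p + \<eta>) \<le> measure W B"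
      unfolding B_def
      by (rule prob_Int_geI[OF _ TB(1) p3 TB(2)]) (use B3 B1(1) B2(1) TB(1) \<eta> in auto)
    have "\<omega> \<le> omh n b j w + sgh n b j w * r / s" if w: "w \<in> B" and j: "k \<le> j" for w b j
    proof -
      define \<sigma> where "\<sigma> = l2_norm P (g0 b)"
      have \<sigma>: "s0 \<le> \<sigma>" "0 < \<sigma>" using s0(1) s0(3)[of b] by (auto simp: \<sigma>_def)
      have "w \<notin> T b" using w by (cases b) (auto simp: B_def)
      moreover have "w \<in> space W" using w by (simp add: B_def)
      ultimately have "\<bar>scaled_mean (\<lambda>z. g b (k + (j - k)) z - g0 b z) n w\<bar> < \<epsilon>"
        unfolding T_def by (auto simp: not_le)
      then have 1: "scaled_mean (g0 b) n w - \<epsilon> \<le> scaled_mean (g b j) n w"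
        using j by (simp add: scaled_mean_diff)
      have "- (r - d / 2) \<le> scaled_mean (\<lambda>z. g0 b z / \<sigma>) n w"
        using w by (simp add: B_def B3_def \<sigma>_def)
      also have "scaled_mean (\<lambda>z. g0 b z / \<sigma>) n w = scaled_mean (g0 b) n w / \<sigma>"
        using scaled_mean_cmult[of "1 / \<sigma>" "g0 b" n w] by simp
      finally have "\<sigma> * - (r - d / 2) \<le> scaled_mean (g0 b) n w"
        using \<sigma>(2) by (simp add: field_simps)
      then have 2: "\<sigma> * d / 2 - \<sigma> * r \<le> scaled_mean (g0 b) n w" by (simp add: algebra_simps)
      have "s * (- (\<epsilon> * (1 / s))) \<le> s * (omh n b j w - \<omega> - emp_mean Z n w (g b j))"
        using B1(3)[of w b j] w s by (intro mult_left_mono) (auto simp: B_def)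
      then have 3: "scaled_mean (g b j) n w - \<epsilon> \<le> s * (omh n b j w - \<omega>)"
        using s by (simp add: scaled_mean_def s_def[symmetric] algebra_simps)
      have "\<bar>sgh n b j w - l2_norm P (g b j)\<bar> \<le> \<epsilon>" using B2(3) w by (auto simp: B_def)
      then have "\<bar>sgh n b j w - \<sigma>\<bar> \<le> 2 * \<epsilon>" using close[OF j, of b] unfolding \<sigma>_def by linarith
      then have "\<bar>sgh n b j w - \<sigma>\<bar> * \<bar>r\<bar> \<le> 2 * \<epsilon> * \<bar>r\<bar>" by (rule mult_right_mono) simp
      then have "\<bar>(sgh n b j w - \<sigma>) * r\<bar> \<le> 2 * \<epsilon> * \<bar>r\<bar>" by (simp add: abs_mult)
      then have 4: "\<sigma> * r - 2 * \<epsilon> * \<bar>r\<bar> \<le> sgh n b j w * r" by (simp add: algebra_simps)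
      have 5: "s0 * d / 2 \<le> \<sigma> * d / 2" using \<sigma>(1) d by simp
      have "0 \<le> s * (omh n b j w - \<omega>) + sgh n b j w * r"
        using 1 2 3 4 5 \<epsilon>_eq by (simp add: algebra_simps)
      then have "0 \<le> (s * (omh n b j w - \<omega>) + sgh n b j w * r) / s" using s by simp
      also have "\<dots> = omh n b j w - \<omega> + sgh n b j w * r / s" using s by (simp add: field_simps)
      finally show ?thesis by simp
    qed
    then have "ereal \<omega> \<le> ereal (omh n b j w) + ereal (sgh n b j w) * t / ereal (sqrt (real n))"
      if "w \<in> B" "k \<le> j" for w b j
      using that s by (simp add: real s_def)
    then show ?case using B prob by (intro bexI[of _ B]) auto
  qed
  then show thesis by (rule that)
qed

end

text \<open>S need not be closed, so the infimum is identified as the value at a limit that may lie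
  outside S. Continuity on the compact class provides this and shows in particular that the infimum
  is finite.\<close>

lemma (in policy_class) infimum_sequence:
  assumes entropy: "bounded_uniform_entropy_integral MX Pols" and closed: "closed_policy_class MX P Pols"
    and S: "S \<subseteq> Pols" "S \<noteq> {}" and cont: "continuous_in_policy P Pols f"
  obtains p :: "nat \<Rightarrow> 'x \<Rightarrow> bool" and \<pi> where "\<And>j. p j \<in> S" "\<pi> \<in> Pols"
    "\<And>j. (policy_dist P (p j) \<pi>)\<^sup>2 \<le> 32 * (1/2) ^ j"
    "(\<lambda>j. f (p j)) \<longlonglongrightarrow> f \<pi>" "(INF \<pi>\<in>S. ereal (f \<pi>)) = ereal (f \<pi>)"
proof -
  have "\<exists>u. (\<forall>n. u n \<in> (\<lambda>\<pi>. ereal (f \<pi>)) ` S) \<and> u \<longlonglongrightarrow> (INF \<pi>\<in>S. ereal (f \<pi>))"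
    using Inf_as_limit[of "(\<lambda>\<pi>. ereal (f \<pi>)) ` S"] S(2) by simp
  then obtain u where u: "\<And>n. u n \<in> (\<lambda>\<pi>. ereal (f \<pi>)) ` S" "u \<longlonglongrightarrow> (INF \<pi>\<in>S. ereal (f \<pi>))"
    by blast
  have "\<forall>n. \<exists>\<pi>. \<pi> \<in> S \<and> u n = ereal (f \<pi>)" using u(1) by blast
  from choice[OF this] obtain p where p: "\<forall>n. p n \<in> S \<and> u n = ereal (f (p n))" ..
  have pP: "p n \<in> Pols" for n using p S(1) by blast
  obtain r :: "nat \<Rightarrow> nat" and \<pi> where r: "strict_mono r" "\<pi> \<in> Pols"
    "\<And>j. (policy_dist P (p (r j)) \<pi>)\<^sup>2 \<le> 32 * (1/2) ^ j"
    by (rule convergent_subsequence[where p=p, OF entropy closed pP]) blast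
  have "(\<lambda>j. 32 * (1/2::real) ^ j) \<longlonglongrightarrow> 32 * 0"
    by (intro tendsto_intros LIMSEQ_power_zero) simp
  then have z: "\<forall>\<^sub>F j in sequentially. 32 * (1/2::real) ^ j < d" if "0 < d" for d
    using that by (intro order_tendstoD(2)) auto
  have lim: "(\<lambda>j. f (p (r j))) \<longlonglongrightarrow> f \<pi>"
  proof (rule tendstoI)
    fix e :: real assume "0 < e"
    then obtain d where d: "0 < d" "\<And>\<pi>'. \<pi>' \<in> Pols \<Longrightarrow> policy_dist P \<pi> \<pi>' < d \<Longrightarrow> \<bar>f \<pi>' - f \<pi>\<bar> < e"
      using cont r(2) unfolding continuous_in_policy_def by blast
    have "0 < d\<^sup>2" using d(1) by simp
    from z[OF this] show "\<forall>\<^sub>F j in sequentially. dist (f (p (r j))) (f \<pi>) < e"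
    proof eventually_elim
      case (elim j)
      then have "(policy_dist P \<pi> (p (r j)))\<^sup>2 < d\<^sup>2" using r(3)[of j] by (simp add: policy_dist_commute)
      then have "policy_dist P \<pi> (p (r j)) < d" by (rule power2_less_imp_less) (use d(1) in simp)
      then show ?case using d(2) pP by (simp add: dist_real_def)
    qed
  qed
  have "(\<lambda>j. u (r j)) \<longlonglongrightarrow> (INF \<pi>\<in>S. ereal (f \<pi>))"
    using LIMSEQ_subseq_LIMSEQ[OF u(2) r(1)] by (simp add: comp_def)
  moreover have "(\<lambda>j. u (r j)) \<longlonglongrightarrow> ereal (f \<pi>)"
    using lim p by simp
  ultimately have "(INF \<pi>\<in>S. ereal (f \<pi>)) = ereal (f \<pi>)" by (rule LIMSEQ_unique)
  then show thesis using p r(2,3) lim by (intro that[of "\<lambda>j. p (r j)" \<pi>]) auto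
qed

theorem theorem2:
  fixes MX :: "'x measure" and MY :: "'y measure"
    and Mod :: "('x \<times> bool \<times> 'y) measure set"
    and P0 :: "('x \<times> bool \<times> 'y) measure"
    and Pols :: "('x \<Rightarrow> bool) set"
    and Omega Psi :: "('x \<Rightarrow> bool) \<Rightarrow> ('x \<times> bool \<times> 'y) measure \<Rightarrow> real"
    and D Dt :: "('x \<Rightarrow> bool) \<Rightarrow> ('x \<times> bool \<times> 'y) measure \<Rightarrow> ('x \<times> bool \<times> 'y) \<Rightarrow> real"
    and W :: "'w measure" and Z :: "nat \<Rightarrow> 'w \<Rightarrow> 'x \<times> bool \<times> 'y"
    and omh psh sgh kph :: "nat \<Rightarrow> ('x \<Rightarrow> bool) \<Rightarrow> 'w \<Rightarrow> real"
    and L :: "nat \<Rightarrow> 'w \<Rightarrow> real"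
    and N :: "'v measure" and G :: "(('x \<times> bool \<times> 'y) \<Rightarrow> real) \<Rightarrow> 'v \<Rightarrow> real"
    and \<alpha> \<beta> :: real
  defines "\<sigma> \<equiv> std_dev D P0"
    and "\<kappa> \<equiv> std_dev Dt P0"
    and "opt \<equiv> optimal_policies (\<lambda>\<pi>. Omega \<pi> P0) Pols"
    and "F \<equiv> normalized_gradients D P0 Pols"
  assumes level: "0 < \<alpha>" "\<alpha> < 1" "0 < \<beta>" "\<beta> < \<alpha>"
    \<comment> \<open>model, parameters, policies and data\<close>
    and model: "\<And>P. P \<in> Mod \<Longrightarrow> prob_space P \<and> sets P = sets (obs_space MX MY)"
      "\<And>P. P \<in> Mod \<Longrightarrow> locally_nonparametric Mod P"
      "P0 \<in> Mod"
    and policies: "Pols \<subseteq> measurable MX (count_space UNIV)"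
    and gradients: "\<And>\<pi> P. \<pi> \<in> Pols \<Longrightarrow> P \<in> Mod \<Longrightarrow> is_canonical_gradient Mod (Omega \<pi>) P (D \<pi> P)"
      "\<And>\<pi> P. \<pi> \<in> Pols \<Longrightarrow> P \<in> Mod \<Longrightarrow> is_canonical_gradient Mod (Psi \<pi>) P (Dt \<pi> P)"
    and data: "iid_draws W P0 Z"
    \<comment> \<open>the limiting Gaussian process and the lower confidence bound\<close>
    and gauss: "gaussian_process N F G"
      "\<And>f. f \<in> F \<Longrightarrow> (\<integral>v. G f v \<partial>N) = 0"
      "\<And>f g. f \<in> F \<Longrightarrow> g \<in> F \<Longrightarrow> (\<integral>v. G f v * G g v \<partial>N) = (\<integral>z. f z * g z \<partial>P0)"
      "(\<lambda>v. SUP f\<in>F. ereal (G f v)) \<in> borel_measurable N"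
    and lower_bound:
      "ereal (1 - \<beta> / 2) \<le> liminf (\<lambda>n. ereal (inner_prob W
         {w \<in> space W. ereal (L n w) \<le> (SUP \<pi>\<in>Pols. ereal (Omega \<pi> P0))}))"
    \<comment> \<open>(A) uniform asymptotic linearity\<close>
    and A:
      "is_op W (\<lambda>n w. SUP \<pi>\<in>Pols.
         ereal \<bar>omh n \<pi> w - Omega \<pi> P0 - emp_mean Z n w (D \<pi> P0)\<bar>) (\<lambda>n. 1 / sqrt (real n))"
      "is_op W (\<lambda>n w. SUP \<pi>\<in>opt.
         ereal \<bar>psh n \<pi> w - Psi \<pi> P0 - emp_mean Z n w (Dt \<pi> P0)\<bar>) (\<lambda>n. 1 / sqrt (real n))"
    \<comment> \<open>(B) restricted policy class\<close>
    and B: "bounded_uniform_entropy_integral MX Pols"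
      "closed_policy_class MX P0 Pols"
      "opt \<noteq> {}"
    \<comment> \<open>(C) standard deviations\<close>
    and C: "0 < (INF \<pi>\<in>Pols. ereal (\<sigma> \<pi>))" "(SUP \<pi>\<in>Pols. ereal (\<sigma> \<pi>)) < \<infinity>"
      "0 < (INF \<pi>\<in>Pols. ereal (\<kappa> \<pi>))" "(SUP \<pi>\<in>Pols. ereal (\<kappa> \<pi>)) < \<infinity>"
      "is_op W (\<lambda>n w. SUP \<pi>\<in>Pols. ereal \<bar>sgh n \<pi> w - \<sigma> \<pi>\<bar>) (\<lambda>n. 1)"
      "is_op W (\<lambda>n w. SUP \<pi>\<in>Pols. ereal \<bar>kph n \<pi> w - \<kappa> \<pi>\<bar>) (\<lambda>n. 1)"
    \<comment> \<open>(D) smoothness in the policy\<close>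
    and D: "continuous_in_policy P0 Pols (\<lambda>\<pi>. Psi \<pi> P0)"
      "\<exists>C2. \<forall>\<pi>\<in>Pols. \<forall>\<pi>'\<in>Pols.
         l2_norm P0 (\<lambda>z. D \<pi> P0 z - D \<pi>' P0 z) \<le> C2 * policy_dist P0 \<pi> \<pi>'"
  shows "ereal (1 - \<alpha>) \<le> liminf (\<lambda>n. ereal (inner_prob W
           {w \<in> space W.
              {(INF \<pi>\<in>opt. ereal (Psi \<pi> P0)) .. (SUP \<pi>\<in>opt. ereal (Psi \<pi> P0))} \<subseteq>
              conf_interval
                (selected_policies Pols n (L n w) (\<lambda>\<pi>. omh n \<pi> w) (\<lambda>\<pi>. sgh n \<pi> w)
                   (quantile N (\<lambda>v. SUP f\<in>F. ereal (G f v)) (1 - \<beta> / 2)))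
                n (\<lambda>\<pi>. psh n \<pi> w) (\<lambda>\<pi>. kph n \<pi> w)
                (quantile std_normal_distribution (\<lambda>x. x) (1 - (\<alpha> - \<beta>) / 2))}))"
proof -
  interpret iid_sample W P0 Z by unfold_locales (rule data)
  interpret policy_class MX MY P0 Pols
    by unfold_locales (use model(1)[OF model(3)] policies in auto)
  \<comment> \<open>The sign turns the upper endpoint into an infimum of \<open>- Psi\<close>, so
    that one one-sided result serves both ends; it leaves the norms of the gradients
    unchanged.\<close>
  define sg :: "bool \<Rightarrow> real" where "sg b = (if b then 1 else - 1)" for b
  define t where "t = quantile N (\<lambda>v. SUP f\<in>F. ereal (G f v)) (1 - \<beta> / 2)"
  define z where "z = quantile std_normal_distribution (\<lambda>x. x) (1 - (\<alpha> - \<beta>) / 2)"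
  have opt_sub: "opt \<subseteq> Pols" by (auto simp: opt_def optimal_policies_def)
  then have Pols_ne: "Pols \<noteq> {}" using B(3) by auto
  \<comment> \<open>Local nonparametricity identifies the tangent space with the centered
    square-integrable functions, which is why canonical gradients have mean 0.\<close>
  have centered: "square_integrable P0 f \<and> (\<integral>z. f z \<partial>P0) = 0"
    if "is_canonical_gradient Mod \<theta> P0 f" for \<theta> f
    using that model(2)[OF model(3)] by (auto simp: is_canonical_gradient_def locally_nonparametric_def)
  have Dsq: "square_integrable P0 (D \<pi> P0)" and Dmean: "(\<integral>z. D \<pi> P0 z \<partial>P0) = 0" if "\<pi> \<in> Pols" for \<pi>
    using centered[OF gradients(1)[OF that model(3)]] by auto
  have Dtsq: "square_integrable P0 (Dt \<pi> P0)" and Dtmean: "(\<integral>z. Dt \<pi> P0 z \<partial>P0) = 0" if "\<pi> \<in> Pols" for \<pi>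
    using centered[OF gradients(2)[OF that model(3)]] by auto
  obtain s0 where "0 < ereal s0" "ereal s0 < (INF \<pi>\<in>Pols. ereal (\<sigma> \<pi>))"
    using ereal_dense2[OF C(1)] by auto
  then have s0: "0 < s0" "s0 \<le> l2_norm P0 (D \<pi> P0)" if "\<pi> \<in> Pols" for \<pi>
    using less_INF_D[OF _ that, of "ereal s0" "\<lambda>\<pi>. ereal (\<sigma> \<pi>)"] by (auto simp: \<sigma>_def std_dev_def)
  obtain k0 where "0 < ereal k0" "ereal k0 < (INF \<pi>\<in>Pols. ereal (\<kappa> \<pi>))"
    using ereal_dense2[OF C(3)] by auto
  then have k0: "0 < k0" "k0 \<le> l2_norm P0 (Dt \<pi> P0)" if "\<pi> \<in> Pols" for \<pi>
    using less_INF_D[OF _ that, of "ereal k0" "\<lambda>\<pi>. ereal (\<kappa> \<pi>)"] by (auto simp: \<kappa>_def std_dev_def)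
  obtain K where "(SUP \<pi>\<in>Pols. ereal (\<kappa> \<pi>)) < ereal K"
    using ereal_dense2[OF C(4)] by auto
  then have K: "l2_norm P0 (Dt \<pi> P0) \<le> K" if "\<pi> \<in> Pols" for \<pi>
    using SUP_lessD[OF _ that, of "\<lambda>\<pi>. ereal (\<kappa> \<pi>)" "ereal K"] by (simp add: \<kappa>_def std_dev_def)
  obtain \<pi>0 where \<pi>0: "\<pi>0 \<in> opt" using B(3) by blast
  define \<omega> where "\<omega> = Omega \<pi>0 P0"
  have SUP_\<omega>: "(SUP \<pi>\<in>Pols. ereal (Omega \<pi> P0)) = ereal \<omega>"
    using \<pi>0 by (simp add: opt_def optimal_policies_def \<omega>_def)
  have opt_\<omega>: "Omega \<pi> P0 = \<omega>" if "\<pi> \<in> opt" for \<pi>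
    using that SUP_\<omega> by (simp add: opt_def optimal_policies_def)

  have cont: "continuous_in_policy P0 Pols (\<lambda>\<pi>. sg b * Psi \<pi> P0)" for b
    using D(1) by (cases b) (auto simp: continuous_in_policy_def sg_def abs_minus_commute)
  have "\<exists>pp. (\<forall>j. fst pp j \<in> opt) \<and> snd pp \<in> Pols \<and>
      (\<forall>j::nat. (policy_dist P0 (fst pp j) (snd pp))\<^sup>2 \<le> 32 * (1/2) ^ j) \<and>
      (\<lambda>j. sg b * Psi (fst pp j) P0) \<longlonglongrightarrow> sg b * Psi (snd pp) P0 \<and>
      (INF \<pi>\<in>opt. ereal (sg b * Psi \<pi> P0)) = ereal (sg b * Psi (snd pp) P0)" for b
    by (rule infimum_sequence[OF B(1,2) opt_sub B(3) cont[of b]]) (metis fst_conv snd_conv)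
  then obtain pp where pp: "\<And>b j. fst (pp b) j \<in> opt" "\<And>b. snd (pp b) \<in> Pols"
    "\<And>b j. (policy_dist P0 (fst (pp b) j) (snd (pp b)))\<^sup>2 \<le> 32 * (1/2) ^ j"
    "\<And>b. (\<lambda>j. sg b * Psi (fst (pp b) j) P0) \<longlonglongrightarrow> sg b * Psi (snd (pp b)) P0"
    "\<And>b. (INF \<pi>\<in>opt. ereal (sg b * Psi \<pi> P0)) = ereal (sg b * Psi (snd (pp b)) P0)"
    by metis
  define p where "p b = fst (pp b)" for b
  define \<pi>i where "\<pi>i b = snd (pp b)" for b
  note p = pp[folded p_def \<pi>i_def]
  have pP: "p b j \<in> Pols" for b j using p(1) opt_sub by blast
  obtain C2 where C2: "\<And>\<pi> \<pi>'. \<pi> \<in> Pols \<Longrightarrow> \<pi>' \<in> Pols \<Longrightarrow>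
      l2_norm P0 (\<lambda>z. D \<pi> P0 z - D \<pi>' P0 z) \<le> C2 * policy_dist P0 \<pi> \<pi>'"
    using D(2) by blast
  have Lip: "(l2_norm P0 (\<lambda>z. D (p b j) P0 z - D (\<pi>i b) P0 z))\<^sup>2 \<le> 32 * C2\<^sup>2 * (1/2) ^ j" for b j
  proof -
    have "(l2_norm P0 (\<lambda>z. D (p b j) P0 z - D (\<pi>i b) P0 z))\<^sup>2 \<le> (C2 * policy_dist P0 (p b j) (\<pi>i b))\<^sup>2"
      by (intro power_mono C2 pP p(2)) simp
    also have "\<dots> \<le> C2\<^sup>2 * (32 * (1/2) ^ j)"
      unfolding power_mult_distrib by (intro mult_left_mono p(3)) simp
    finally show ?thesis by (simp add: mult_ac)
  qed

  \<comment> \<open>Closedness puts \<open>\<pi>i b\<close> into the class, so its normalized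
    gradient indexes the Gaussian process whether or not \<open>\<pi>i b\<close> is optimal.\<close>
  define nf where "nf b = (\<lambda>z. D (\<pi>i b) P0 z / l2_norm P0 (D (\<pi>i b) P0))" for b
  have nfF: "nf b \<in> F" for b
    using p(2)[of b] by (auto simp: F_def normalized_gradients_def nf_def std_dev_def)
  have nfsq: "square_integrable P0 (nf b)" for b
    unfolding nf_def by (intro square_integrable_divide Dsq p(2))
  have nfmean: "(\<integral>z. nf b z \<partial>P0) = 0" for b
    unfolding nf_def using Dmean[OF p(2)] by simp
  have nfnorm: "l2_norm P0 (nf b) = 1" for b
    using l2_norm_cmult[of P0 "1 / l2_norm P0 (D (\<pi>i b) P0)" "D (\<pi>i b) P0"] s0[OF p(2)[of b]]
    by (simp add: nf_def)
  have N: "prob_space N" using gauss(1) by (simp add: gaussian_process_def)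
  have G_meas: "G (nf b) \<in> borel_measurable N" for b
    using gauss(1) nfF by (simp add: gaussian_process_def)
  have pair: "(\<integral>v. iexp (x * G (nf b) v + y * G (nf c) v) \<partial>N)
      = exp (- (l2_norm P0 (\<lambda>z. x * nf b z + y * nf c z))\<^sup>2 / 2)" for b c x y
    by (rule gaussian_process_pair_char[OF gauss(1) nfF nfF gauss(2,3) nfsq nfsq]) (auto simp: nfnorm)
  have std: "distr N borel (G (nf b)) = std_normal_distribution" for b
    using pair[of _ b 0 b] by (intro Levy_uniqueness_std_normal[OF N G_meas]) (simp add: l2_norm_cmult nfnorm)
  have q: "0 < 1 - \<beta> / 2" and \<beta>0: "0 \<le> \<beta> / 2" using level by auto
  have t: "t \<noteq> - \<infinity>"
    unfolding t_def by (rule sup_quantile_not_minf[where G=G, OF N gauss(4) q nfF[of True] G_meas std])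
  \<comment> \<open>The shifted quantile costs 4 d and weak convergence one more d. The levels r - d
    and r - d/2 leave room for the ramp between the Gaussian and the empirical event.\<close>
  have lower: "\<forall>\<^sub>F n in sequentially. 1 - \<beta> / 2 - 5 * d \<le> measure W
      {w \<in> space W. \<forall>b. - (r - d / 2) \<le> scaled_mean (\<lambda>z. D (\<pi>i b) P0 z / l2_norm P0 (D (\<pi>i b) P0)) n w}"
    if r: "t = ereal r" and d: "0 < d" for r d
  proof -
    have "1 - \<beta> / 2 - 4 * d \<le> measure N {v \<in> space N. G (nf True) v \<le> r - d \<and> G (nf False) v \<le> r - d}"
      by (rule sup_quantile_pair_shift[where G=G, OF N gauss(4) q nfF nfF r[unfolded t_def] G_meas G_meas std std d])
    moreover have "\<forall>\<^sub>F n in sequentially.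
        measure N {v \<in> space N. G (nf True) v \<le> r - d \<and> G (nf False) v \<le> r - d} - d
        \<le> measure W {w \<in> space W. - (r - d / 2) \<le> scaled_mean (nf True) n w \<and> - (r - d / 2) \<le> scaled_mean (nf False) n w}"
      using d by (intro joint_lower_bound[OF nfsq nfmean nfsq nfmean N G_meas G_meas pair]) auto
    ultimately show ?thesis
      unfolding all_bool_eq nf_def by (auto elim!: eventually_mono)
  qed

  have emp_cmult: "emp_mean Z n w (\<lambda>z. c * f z) = c * emp_mean Z n w f" for n w c f
    by (simp add: emp_mean_def sum_distrib_left[symmetric])
  \<comment> \<open>Optimality gives all the policies \<open>p b j\<close> the same value \<omega>
    of the primary metric, the one with which \<open>L n\<close> is compared.\<close>
  have evA1: "\<forall>\<^sub>F n in sequentially. \<exists>B\<in>sets W. 1 - \<eta> \<le> measure W B \<and>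
      (\<forall>w\<in>B. \<forall>b j. \<bar>omh n (p b j) w - \<omega> - emp_mean Z n w (D (p b j) P0)\<bar> \<le> \<epsilon> * (1 / sqrt (real n)))"
    if "0 < \<epsilon>" "0 < \<eta>" for \<epsilon> \<eta>
    using is_op_eventually[OF W.prob_space_axioms A(1) that]
  proof eventually_elim
    case (elim n)
    then obtain B where B: "B \<in> sets W" "1 - \<eta> \<le> measure W B"
      "\<And>w \<pi>. w \<in> B \<Longrightarrow> \<pi> \<in> Pols \<Longrightarrow>
        \<bar>omh n \<pi> w - Omega \<pi> P0 - emp_mean Z n w (D \<pi> P0)\<bar> \<le> \<epsilon> * (1 / sqrt (real n))"
      unfolding SUP_le_iff ereal_less_eq by blast
    then show ?case using opt_\<omega>[OF p(1)] pP by (intro bexI[of _ B]) (auto, metis)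
  qed
  have evA2: "\<forall>\<^sub>F n in sequentially. \<exists>B\<in>sets W. 1 - \<eta> \<le> measure W B \<and>
      (\<forall>w\<in>B. \<forall>j. \<bar>sg b * psh n (p b j) w - sg b * Psi (p b j) P0 - emp_mean Z n w (\<lambda>z. sg b * Dt (p b j) P0 z)\<bar>
        \<le> \<epsilon> * (1 / sqrt (real n)))"
    if "0 < \<epsilon>" "0 < \<eta>" for \<epsilon> \<eta> b
    using is_op_eventually[OF W.prob_space_axioms A(2) that]
  proof eventually_elim
    case (elim n)
    then obtain B where B: "B \<in> sets W" "1 - \<eta> \<le> measure W B"
      "\<And>w \<pi>. w \<in> B \<Longrightarrow> \<pi> \<in> opt \<Longrightarrow>
        \<bar>psh n \<pi> w - Psi \<pi> P0 - emp_mean Z n w (Dt \<pi> P0)\<bar> \<le> \<epsilon> * (1 / sqrt (real n))"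
      unfolding SUP_le_iff ereal_less_eq by blast
    have "\<bar>sg b * x - sg b * y - sg b * u\<bar> = \<bar>x - y - u\<bar>" for x y u
      by (cases b) (simp_all add: sg_def abs_if)
    then show ?case using B p(1) by (intro bexI[of _ B]) (simp_all add: emp_cmult)
  qed
  have evS: "\<forall>\<^sub>F n in sequentially. \<exists>B\<in>sets W. 1 - \<eta> \<le> measure W B \<and>
      (\<forall>w\<in>B. \<forall>b j. \<bar>sgh n (p b j) w - l2_norm P0 (D (p b j) P0)\<bar> \<le> \<epsilon>)"
    if "0 < \<epsilon>" "0 < \<eta>" for \<epsilon> \<eta>
    using is_op_eventually[OF W.prob_space_axioms C(5) that]
  proof eventually_elim
    case (elim n)
    then obtain B where B: "B \<in> sets W" "1 - \<eta> \<le> measure W B"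
      "\<And>w \<pi>. w \<in> B \<Longrightarrow> \<pi> \<in> Pols \<Longrightarrow> \<bar>sgh n \<pi> w - \<sigma> \<pi>\<bar> \<le> \<epsilon> * 1"
      unfolding SUP_le_iff ereal_less_eq by blast
    then show ?case using pP by (intro bexI[of _ B]) (simp_all add: \<sigma>_def std_dev_def)
  qed
  have evK: "\<forall>\<^sub>F n in sequentially. \<exists>B\<in>sets W. 1 - \<eta> \<le> measure W B \<and>
      (\<forall>w\<in>B. \<forall>j. \<bar>kph n (p b j) w - l2_norm P0 (\<lambda>z. sg b * Dt (p b j) P0 z)\<bar> \<le> \<epsilon>)"
    if "0 < \<epsilon>" "0 < \<eta>" for \<epsilon> \<eta> b
    using is_op_eventually[OF W.prob_space_axioms C(6) that]
  proof eventually_elim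
    case (elim n)
    then obtain B where B: "B \<in> sets W" "1 - \<eta> \<le> measure W B"
      "\<And>w \<pi>. w \<in> B \<Longrightarrow> \<pi> \<in> Pols \<Longrightarrow> \<bar>kph n \<pi> w - \<kappa> \<pi>\<bar> \<le> \<epsilon> * 1"
      unfolding SUP_le_iff ereal_less_eq by blast
    have "\<bar>sg b\<bar> = 1" by (simp add: sg_def)
    then show ?case using B pP by (intro bexI[of _ B]) (simp_all add: \<kappa>_def std_dev_def l2_norm_cmult)
  qed

  have side: "\<forall>\<^sub>F n in sequentially. \<forall>m. \<exists>B\<in>sets W. 1 - ((\<alpha> - \<beta>) / 2 + \<eta>) \<le> measure W B \<and>
      (\<forall>w\<in>B. \<exists>j\<ge>m. sg b * psh n (p b j) w - kph n (p b j) w * z / sqrt (real n) \<le> sg b * Psi (\<pi>i b) P0)"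
    if "0 < \<eta>" for b \<eta>
  proof -
    have sgb: "\<bar>sg b\<bar> = 1" by (simp add: sg_def)
    have "\<forall>\<^sub>F n in sequentially. \<forall>m. \<exists>B\<in>sets W. 1 - (1 - (1 - (\<alpha> - \<beta>) / 2) + \<eta>) \<le> measure W B \<and>
        (\<forall>w\<in>B. \<exists>j\<ge>m. sg b * psh n (p b j) w - kph n (p b j) w * z / sqrt (real n) \<le> sg b * Psi (\<pi>i b) P0)"
      unfolding z_def
    proof (rule one_sided_coverage[where h="\<lambda>j z. sg b * Dt (p b j) P0 z" and \<Psi>="\<lambda>j. sg b * Psi (p b j) P0"
          and ?k0.0=k0 and K=K, OF _ _ _ _ _ _ _ evA2 evK p(4) that])
      show "square_integrable P0 (\<lambda>z. sg b * Dt (p b j) P0 z)" for j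
        by (intro square_integrable_cmult Dtsq pP)
      show "(\<integral>z. sg b * Dt (p b j) P0 z \<partial>P0) = 0" for j
        using Dtmean[OF pP] by simp
      show "0 < k0" by (rule k0(1)[OF pP])
      show "k0 \<le> l2_norm P0 (\<lambda>z. sg b * Dt (p b j) P0 z)" for j
        using k0(2)[OF pP] by (simp add: l2_norm_cmult sgb)
      show "l2_norm P0 (\<lambda>z. sg b * Dt (p b j) P0 z) \<le> K" for j
        using K[OF pP] by (simp add: l2_norm_cmult sgb)
      show "1 / 2 < 1 - (\<alpha> - \<beta>) / 2" "1 - (\<alpha> - \<beta>) / 2 < 1" using level by auto
    qed
    then show ?thesis by simp
  qed

  show ?thesis
  proof (rule liminf_inner_probI[OF W.prob_space_axioms])
    fix \<eta> :: real assume "0 < \<eta>"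
    then have \<eta>: "0 < \<eta> / 4" by simp
    obtain k where k: "\<forall>\<^sub>F n in sequentially. \<exists>B\<in>sets W. 1 - (\<beta> / 2 + \<eta> / 4) \<le> measure W B \<and>
        (\<forall>w\<in>B. \<forall>b. \<forall>j\<ge>k. ereal \<omega> \<le> ereal (omh n (p b j) w) + ereal (sgh n (p b j) w) * t / ereal (sqrt (real n)))"
      by (rule joint_selection[where g="\<lambda>b j. D (p b j) P0" and ?g0.0="\<lambda>b. D (\<pi>i b) P0" and ?s0.0=s0,
            OF Dsq[OF pP] Dmean[OF pP] Dsq[OF p(2)] Dmean[OF p(2)] Lip s0(1)[OF pP] s0(2)[OF pP] s0(2)[OF p(2)]
              evA1 evS t \<beta>0 lower \<eta>]) (assumption | rule that)+
    have low: "\<forall>\<^sub>F n in sequentially. \<exists>B\<in>sets W. 1 - \<beta> / 2 - \<eta> / 4 \<le> measure W B \<and>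
        B \<subseteq> {w \<in> space W. ereal (L n w) \<le> (SUP \<pi>\<in>Pols. ereal (Omega \<pi> P0))}"
      by (rule liminf_inner_prob_eventually[OF W.prob_space_axioms lower_bound \<eta>])
    show "\<forall>\<^sub>F n in sequentially. \<exists>B\<in>sets W. 1 - \<alpha> - \<eta> \<le> measure W B \<and> B \<subseteq> {w \<in> space W.
        {(INF \<pi>\<in>opt. ereal (Psi \<pi> P0)) .. (SUP \<pi>\<in>opt. ereal (Psi \<pi> P0))} \<subseteq>
        conf_interval
          (selected_policies Pols n (L n w) (\<lambda>\<pi>. omh n \<pi> w) (\<lambda>\<pi>. sgh n \<pi> w)
             (quantile N (\<lambda>v. SUP f\<in>F. ereal (G f v)) (1 - \<beta> / 2)))
          n (\<lambda>\<pi>. psh n \<pi> w) (\<lambda>\<pi>. kph n \<pi> w)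
          (quantile std_normal_distribution (\<lambda>x. x) (1 - (\<alpha> - \<beta>) / 2))}"
      unfolding t_def[symmetric] z_def[symmetric]
      using k low side[OF \<eta>, of True] side[OF \<eta>, of False]
    proof eventually_elim
      case (elim n)
      obtain B1 where B1: "B1 \<in> sets W" "1 - (\<beta> / 2 + \<eta> / 4) \<le> measure W B1"
        "\<And>w b j. w \<in> B1 \<Longrightarrow> k \<le> j \<Longrightarrow>
          ereal \<omega> \<le> ereal (omh n (p b j) w) + ereal (sgh n (p b j) w) * t / ereal (sqrt (real n))"
        using elim(1) by blast
      obtain B2 where B2: "B2 \<in> sets W" "1 - (\<beta> / 2 + \<eta> / 4) \<le> measure W B2"
        "\<And>w. w \<in> B2 \<Longrightarrow> ereal (L n w) \<le> ereal \<omega>"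
        using elim(2) unfolding SUP_\<omega> by (auto simp: diff_diff_eq)
      obtain B3 where B3: "B3 \<in> sets W" "1 - ((\<alpha> - \<beta>) / 2 + \<eta> / 4) \<le> measure W B3"
        "\<And>w. w \<in> B3 \<Longrightarrow> \<exists>j\<ge>k. sg True * psh n (p True j) w - kph n (p True j) w * z / sqrt (real n)
          \<le> sg True * Psi (\<pi>i True) P0"
        using elim(3)[rule_format, of k] by blast
      obtain B4 where B4: "B4 \<in> sets W" "1 - ((\<alpha> - \<beta>) / 2 + \<eta> / 4) \<le> measure W B4"
        "\<And>w. w \<in> B4 \<Longrightarrow> \<exists>j\<ge>k. sg False * psh n (p False j) w - kph n (p False j) w * z / sqrt (real n)
          \<le> sg False * Psi (\<pi>i False) P0"
        using elim(4)[rule_format, of k] by blast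
      \<comment> \<open>The budget is \<beta>/2 for the selection, \<beta>/2 for \<open>L n\<close>
        and (\<alpha> - \<beta>)/2 for each endpoint, with \<eta>/4 added to each of the
        four.\<close>
      note P12 = prob_Int_geI[OF B1(1) B2(1) B1(2) B2(2) order_refl]
      note P123 = prob_Int_geI[OF sets.Int[OF B1(1) B2(1)] B3(1) P12 B3(2) order_refl]
      note P1234 = prob_Int_geI[OF sets.Int[OF sets.Int[OF B1(1) B2(1)] B3(1)] B4(1) P123 B4(2) order_refl]
      define B where "B = B1 \<inter> B2 \<inter> B3 \<inter> B4"
      have BW: "B \<in> sets W" using B1(1) B2(1) B3(1) B4(1) by (auto simp: B_def)
      have prob: "1 - \<alpha> - \<eta> \<le> measure W B"
        using P1234 unfolding B_def by (simp add: field_simps)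
      have "{(INF \<pi>\<in>opt. ereal (Psi \<pi> P0)) .. (SUP \<pi>\<in>opt. ereal (Psi \<pi> P0))} \<subseteq>
          conf_interval (selected_policies Pols n (L n w) (\<lambda>\<pi>. omh n \<pi> w) (\<lambda>\<pi>. sgh n \<pi> w) t)
            n (\<lambda>\<pi>. psh n \<pi> w) (\<lambda>\<pi>. kph n \<pi> w) z" (is "_ \<subseteq> conf_interval ?Sel _ _ _ _")
        if w: "w \<in> B" for w
      proof -
        have sel: "p b j \<in> ?Sel" if "k \<le> j" for b j
        proof -
          have "ereal (L n w) \<le> ereal (omh n (p b j) w) + ereal (sgh n (p b j) w) * t / ereal (sqrt (real n))"
            by (rule order_trans[OF B2(3) B1(3)]) (use w that in \<open>auto simp: B_def\<close>)
          then show ?thesis using pP by (simp add: selected_policies_def)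
        qed
        \<comment> \<open>The index varies with w, but it is at least k, so the policy is selected
          and a single member bounds the infimum over the whole selection.\<close>
        obtain j where j: "k \<le> j"
          "psh n (p True j) w - kph n (p True j) w * z / sqrt (real n) \<le> Psi (\<pi>i True) P0"
          using B3(3)[of w] w by (auto simp: B_def sg_def)
        have lo: "(INF \<pi>\<in>?Sel. ereal (psh n \<pi> w - kph n \<pi> w * z / sqrt (real n)))
            \<le> (INF \<pi>\<in>opt. ereal (Psi \<pi> P0))"
          using INF_lower2[OF sel[OF j(1), of True], of "\<lambda>\<pi>. ereal (psh n \<pi> w - kph n \<pi> w * z / sqrt (real n))"]
            j(2) p(5)[of True] by (simp add: sg_def)
        obtain i where i: "k \<le> i"
          "Psi (\<pi>i False) P0 \<le> psh n (p False i) w + kph n (p False i) w * z / sqrt (real n)"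
          using B4(3)[of w] w by (fastforce simp: B_def sg_def)
        have "(INF \<pi>\<in>opt. - ereal (Psi \<pi> P0)) = - ereal (Psi (\<pi>i False) P0)"
          using p(5)[of False] by (simp add: sg_def)
        then have "(SUP \<pi>\<in>opt. ereal (Psi \<pi> P0)) = ereal (Psi (\<pi>i False) P0)"
          unfolding ereal_INF_uminus_eq by (simp only: ereal_uminus_eq_iff)
        then have up: "(SUP \<pi>\<in>opt. ereal (Psi \<pi> P0))
            \<le> (SUP \<pi>\<in>?Sel. ereal (psh n \<pi> w + kph n \<pi> w * z / sqrt (real n)))"
          using SUP_upper2[OF sel[OF i(1), of False], of _ "\<lambda>\<pi>. ereal (psh n \<pi> w + kph n \<pi> w * z / sqrt (real n))"]
            i(2) by simp
        show ?thesis unfolding conf_interval_def using lo up by (auto intro: order_trans)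
      qed
      then show ?case using BW prob sets.sets_into_space[OF BW] by blast
    qed
  qed
qed

end
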